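(* Let $X\subset\mathbb S^2$ be a node-transitive spherical $t$-design, $t\ge2$, and let $P_X\subset\mathbb R^3$ be its Steiner-normalized Minkowski polytope. If $P_X$ is self-polar up to scale, then $P_X$ is a tetrahedron and $X$ is a regular tetrahedral $2$-design (the vertex set of a regular tetrahedron inscribed in $\mathbb S^2$). Consequently, if $t\ge3$, then $P_X$ is not self-polar up to scale.
   Context: $\sigma$ is the normalized (probability) surface measure on the unit sphere $\mathbb S^{2}\subset\mathbb R^3$. A finite set $X=\{x_1,\ldots,x_N\}\subset\mathbb S^{2}$ of $N$ distinct points is a spherical $t$-design if $\frac1N\sum_i p(x_i)=\int p\,d\sigma$ for every polynomial $p$ of total degree at most $t$. It is node-transitive if some subgroup $G\le O(3)$ preserves $X$ and acts transitively on it. For $t\ge2$, the Minkowski polytope $P_X\subset\mathbb R^3$ is the full-dimensional convex polytope, unique up to translation, with exactly $N$ facets, whose outer unit normals are $x_1,\ldots,x_N$, each of area $4\pi/N$. It is Steiner-normalized: the translate is chosen so that the Steiner point $3\int_{\mathbb S^{2}}h_{P_X}(u)u\,d\sigma(u)$ is $0$ (with $h_P(u)=\max_{y\in P}\langle u,y\rangle$), which implies $0\in\operatorname{int}P_X$. The polar is $P^\circ=\{z:\langle z,y\rangle\le1\ \forall y\in P\}$, and $P$ is self-polar up to scale if $P^\circ=cUP$ for some $c>0$ and $U\in O(3)$. *)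

theory Defs
  imports "HOL-Analysis.Analysis" "HOL-Algebra.Group"
begin

(* The normalized surface measure, as the law of x / norm x for x uniform in the unit ball: the
   measure of a part of the sphere is the volume fraction of the cone over it.  It is a measure
   on the whole space, concentrated on the sphere. *)
definition sphere_measure :: "(real^3) measure" where
  "sphere_measure = distr (uniform_measure lborel (ball 0 1)) borel sgn"

definition poly_of_degree_le :: "nat \<Rightarrow> (real^3 \<Rightarrow> real) \<Rightarrow> bool" where
  "poly_of_degree_le t p \<longleftrightarrow>
     (\<exists>c :: nat^3 \<Rightarrow> real. \<forall>x.
        p x = (\<Sum>a \<in> {a. (\<Sum>i\<in>UNIV. a $ i) \<le> t}. c a * (\<Prod>i\<in>UNIV. (x $ i) ^ (a $ i))))"

(* The sum over exponent vectors above is a genuine (finite) sum. *)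
lemma finite_exponents: "finite {a :: nat^3. (\<Sum>i\<in>UNIV. a $ i) \<le> t}"
proof (rule finite_subset)
  show "{a :: nat^3. (\<Sum>i\<in>UNIV. a $ i) \<le> t} \<subseteq> vec_lambda ` (Pi\<^sub>E UNIV (\<lambda>_. {..t}))"
  proof
    fix a :: "nat^3" assume "a \<in> {a. (\<Sum>i\<in>UNIV. a $ i) \<le> t}"
    moreover have "a $ i \<le> (\<Sum>i\<in>UNIV. a $ i)" for i by (rule member_le_sum) auto
    ultimately have "vec_nth a \<in> Pi\<^sub>E UNIV (\<lambda>_. {..t})"
      by (auto intro: order_trans)
    then show "a \<in> vec_lambda ` (Pi\<^sub>E UNIV (\<lambda>_. {..t}))"
      by (metis image_eqI vec_nth_inverse)
  qed
qed (simp add: finite_PiE)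

definition spherical_design :: "nat \<Rightarrow> (real^3) set \<Rightarrow> bool" where
  "spherical_design t X \<longleftrightarrow>
     finite X \<and> X \<noteq> {} \<and> X \<subseteq> sphere 0 1 \<and>
     (\<forall>p. poly_of_degree_le t p \<longrightarrow>
        (\<Sum>x\<in>X. p x) / real (card X) = (\<integral>u. p u \<partial>sphere_measure))"

definition O3 :: "(real^3 \<Rightarrow> real^3) monoid" where
  "O3 = \<lparr>carrier = {U. orthogonal_transformation U}, mult = (\<circ>), one = id\<rparr>"

definition node_transitive :: "(real^3) set \<Rightarrow> bool" where
  "node_transitive X \<longleftrightarrow>
     (\<exists>G. subgroup G O3 \<and> (\<forall>g\<in>G. g ` X = X) \<and> (\<forall>x\<in>X. \<forall>y\<in>X. \<exists>g\<in>G. g x = y))"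

(* Two-dimensional Lebesgue measure of a planar set, in orthonormal coordinates of a plane that
   contains it; the value does not depend on the isometric parametrization chosen. *)
definition planar_area :: "(real^3) set \<Rightarrow> real" where
  "planar_area F =
     measure lebesgue
       ((SOME f :: real^2 \<Rightarrow> real^3. (\<forall>x y. dist (f x) (f y) = dist x y) \<and> F \<subseteq> range f) -` F)"

definition outer_unit_normal :: "(real^3) set \<Rightarrow> (real^3) set \<Rightarrow> real^3 \<Rightarrow> bool" where
  "outer_unit_normal P F u \<longleftrightarrow>
     norm u = 1 \<and> (\<exists>b. P \<subseteq> {y. u \<bullet> y \<le> b} \<and> F = P \<inter> {y. u \<bullet> y = b})"

(* P is determined by X only up to translation, hence a relation rather than a function. *)
definition minkowski_polytope :: "(real^3) set \<Rightarrow> (real^3) set \<Rightarrow> bool" where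
  "minkowski_polytope X P \<longleftrightarrow>
     polytope P \<and> aff_dim P = 3 \<and>
     card {F. F facet_of P} = card X \<and>
     {u. \<exists>F. F facet_of P \<and> outer_unit_normal P F u} = X \<and>
     (\<forall>F. F facet_of P \<longrightarrow> planar_area F = 4 * pi / real (card X))"

definition support_function :: "(real^3) set \<Rightarrow> real^3 \<Rightarrow> real" where
  "support_function P u = (SUP y\<in>P. u \<bullet> y)"

definition steiner_point :: "(real^3) set \<Rightarrow> real^3" where
  "steiner_point P = 3 *\<^sub>R (\<integral>u. support_function P u *\<^sub>R u \<partial>sphere_measure)"

definition steiner_minkowski_polytope :: "(real^3) set \<Rightarrow> (real^3) set \<Rightarrow> bool" where
  "steiner_minkowski_polytope X P \<longleftrightarrow> minkowski_polytope X P \<and> steiner_point P = 0"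

definition polar :: "(real^3) set \<Rightarrow> (real^3) set" where
  "polar P = {z. \<forall>y\<in>P. z \<bullet> y \<le> 1}"

definition self_polar_up_to_scale :: "(real^3) set \<Rightarrow> bool" where
  "self_polar_up_to_scale P \<longleftrightarrow>
     (\<exists>c>0. \<exists>U. orthogonal_transformation U \<and> polar P = (\<lambda>y. c *\<^sub>R U y) ` P)"

definition regular_tetrahedron_vertices :: "(real^3) set \<Rightarrow> bool" where
  "regular_tetrahedron_vertices X \<longleftrightarrow>
     card X = 4 \<and> \<not> affine_dependent X \<and>
     (\<exists>d. \<forall>x\<in>X. \<forall>y\<in>X. x \<noteq> y \<longrightarrow> dist x y = d)"

end

theory Submission
  imports Defs
begin

text \<open>
  Let $N$ be the number of points of $X$, let $G$ be a group of symmetries acting transitively on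
  $X$, and let $h$ be the support function of $P$.

  Symmetry. The first step is that $P$ inherits the symmetries of $X$. For $g \<in> G$ the
  polytope $g(P)$ has the same facet normals and facet areas as $P$, and what has to be shown is
  the uniqueness part of Minkowski's theorem for these two polytopes. By Minkowski's first
  inequality, \<open>volume_le_of_support_le\<close>, the body $(P + g(P))/2$ has at most the
  volume of $P$. By the Brunn-Minkowski inequality it has at least that volume, and equality makes
  $g(P)$ a translate of $P$ (\<open>brunn_minkowski_equality\<close>). The translation maps
  centroid to centroid, so $P$ is symmetric about its centroid $c$
  (\<open>symmetric_up_to_translation\<close>). The Steiner point of $P - c$ is then fixed by $G$.
  A transitive group of a $2$-design fixes only the origin, because the design points sum to $0$
  and span the space. Since the Steiner point of $P$ is $0$, this gives $c = 0$
  (\<open>steiner_symmetric\<close>), and by transitivity $h$ is constant on $X$. So the facets of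
  $P$ touch a sphere about the origin.

  Equality in the Brunn-Minkowski inequality is analysed by slicing. If the midpoint body of $S$
  and $T$ is not larger than $S$ and $T$, which have equal volume, then the same holds for the
  slabs of $S$ and $T$ between parallel planes that cut off equal volumes from both. On such slabs
  the one-dimensional inequality \<open>prekopa_leindler_real_sup\<close>, which remembers the
  suprema of the functions, shows that the largest slice areas agree. Hence slices at matching
  heights have equal area, and the matching is a translation (\<open>slices_translate\<close>).

  Counting. The polar of $P$ is the convex hull of a multiple of $X$. If $P$ is self-polar, it is
  therefore the convex hull of $N$ points on a sphere about the origin. It has $N$ facets and $N$
  vertices, and by transitivity all facets contain the same number $k$ of vertices. In a generic
  direction a facet has $k - 2$ vertices that are neither highest nor lowest in it. A vertex that
  is neither highest nor lowest in $P$ is such a vertex for exactly two facets, since the plane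
  through it orthogonal to the direction cuts $P$ in a polygon which has two edges there. So $N (k
  - 2) = 2 (N - 2)$, and $N = 4$ (\<open>four_vertices\<close>).

  Four points. The first and second moments force all inner products of distinct points of a
  four-point $2$-design to be $-1/3$, so $X$ is a regular tetrahedron. Its third moment in the
  direction of a vertex is not $0$, so it is not a $3$-design.
\<close>

section \<open>The midpoint Prekopa-Leindler inequality\<close>

lemma emeasure_lborel_halve:
  fixes C :: "real set"
  assumes "C \<in> sets borel"
  shows "emeasure lborel {z. (1/2) * z \<in> C} = 2 * emeasure lborel C"
proof -
  have "emeasure lborel C = (\<integral>\<^sup>+x. indicator C x \<partial>lborel)" using assms by simp
  also have "\<dots> = ennreal \<bar>1/2\<bar> * (\<integral>\<^sup>+x. indicator C (0 + (1/2) * x) \<partial>lborel)"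
    by (rule nn_integral_real_affine) (use assms in auto)
  also have "(\<lambda>x::real. indicator C (0 + (1/2) * x) :: ennreal) = indicator {z. (1/2) * z \<in> C}"
    by (auto simp: fun_eq_iff indicator_def)
  also have "(\<integral>\<^sup>+x. indicator {z. (1/2) * z \<in> C} x \<partial>lborel) = emeasure lborel {z. (1/2) * z \<in> C}"
    by (rule nn_integral_indicator) (use assms in measurable)
  finally have "2 * emeasure lborel C = (ennreal 2 * ennreal (1/2)) * emeasure lborel {z. (1/2) * z \<in> C}"
    by (simp add: mult.assoc)
  also have "ennreal 2 * ennreal (1/2) = 1" by (subst ennreal_mult[symmetric]) auto
  finally show ?thesis by simp
qed

lemma emeasure_lborel_translate:
  fixes A :: "'a::euclidean_space set"
  assumes "A \<in> sets borel"
  shows "emeasure lborel ((+) c ` A) = emeasure lborel A"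
proof -
  have "emeasure lborel A = emeasure (distr lborel borel ((+) (-c))) A" by (simp add: lborel_distr_plus)
  also have "\<dots> = emeasure lborel ((+) (-c) -` A)" using assms by (subst emeasure_distr) auto
  also have "(+) (-c) -` A = (+) c ` A" by (auto simp: image_iff) (metis add.commute diff_add_cancel)
  finally show ?thesis by simp
qed

text \<open>Translating $K$ by the least point of $L$ and $L$ by the greatest point of $K$ makes
  both copies subsets of $K + L$ that have only one point in common.\<close>
lemma compact_midpoint_measure:
  fixes K L C :: "real set"
  assumes K: "compact K" "K \<noteq> {}" and L: "compact L" "L \<noteq> {}" and C: "C \<in> sets borel"
    and sub: "\<And>x y. x \<in> K \<Longrightarrow> y \<in> L \<Longrightarrow> (1/2) * (x + y) \<in> C"
  shows "emeasure lborel K + emeasure lborel L \<le> 2 * emeasure lborel C"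
proof -
  obtain a where a: "a \<in> K" "\<And>x. x \<in> K \<Longrightarrow> x \<le> a" using compact_attains_sup[OF K] by blast
  obtain b where b: "b \<in> L" "\<And>x. x \<in> L \<Longrightarrow> b \<le> x" using compact_attains_inf[OF L] by blast
  let ?K = "(+) b ` K" and ?L = "(+) a ` L" and ?C = "{z. (1/2) * z \<in> C}"
  have mK: "K \<in> sets borel" "?K \<in> sets borel" and mL: "L \<in> sets borel" "?L \<in> sets borel"
    using K L by (auto intro!: borel_compact compact_translation)
  have mC: "?C \<in> sets borel" using C by measurable
  have "?K \<inter> ?L \<subseteq> {a + b}"
  proof
    fix z assume "z \<in> ?K \<inter> ?L"
    then obtain x y where "x \<in> K" "z = b + x" "y \<in> L" "z = a + y" by auto
    with a(2)[of x] b(2)[of y] show "z \<in> {a + b}" by auto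
  qed
  then have "emeasure lborel (?K \<inter> ?L) \<le> emeasure lborel {a + b}" by (intro emeasure_mono) auto
  then have null: "?K \<inter> ?L \<in> null_sets lborel" using mK mL by (simp add: null_sets_def)
  have "emeasure lborel K + emeasure lborel L = emeasure lborel ?K + emeasure lborel ?L"
    using mK mL by (simp add: emeasure_lborel_translate)
  also have "\<dots> = emeasure lborel (?K \<union> ?L)"
    using null mK mL by (simp add: emeasure_Un' del: sets_lborel)
  also have "\<dots> \<le> emeasure lborel ?C"
  proof (intro emeasure_mono)
    show "?K \<union> ?L \<subseteq> ?C" using sub[OF _ b(1)] sub[OF a(1)] by (auto simp: add.commute)
  qed (use mC in simp)
  finally show ?thesis unfolding emeasure_lborel_halve[OF C] .
qed

lemma emeasure_le_compact_approx:
  fixes A :: "real set"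
  assumes A: "A \<in> sets borel" "a0 \<in> A" and e: "e > 0"
    and le: "\<And>K. compact K \<Longrightarrow> K \<noteq> {} \<Longrightarrow> K \<subseteq> A \<Longrightarrow> emeasure lborel K + c \<le> d"
  shows "emeasure lborel A + c \<le> d + ennreal e"
proof -
  obtain T where T: "closed T" "T \<subseteq> A" "emeasure lebesgue (A - T) < ennreal e"
  proof (rule sets_lebesgue_inner_closed[of A e])
    show "A \<in> sets lebesgue" using A(1) by simp
  qed (use e in auto)
  define K where "K n = insert a0 (T \<inter> {- real n..real n})" for n
  have mT: "T \<in> sets borel" using T by (simp add: borel_closed)
  have "emeasure lborel T = (SUP n. emeasure lborel (T \<inter> {- real n..real n}))"
  proof (subst SUP_emeasure_incseq)
    show "incseq (\<lambda>n. T \<inter> {- real n..real n})" by (auto simp: incseq_def)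
    have "(\<Union>n. T \<inter> {- real n..real n}) = T"
    proof (intro antisym subsetI)
      fix x assume "x \<in> T"
      moreover obtain n where "\<bar>x\<bar> \<le> real n" using real_arch_simple by blast
      ultimately show "x \<in> (\<Union>n. T \<inter> {- real n..real n})" by (intro UN_I[of n]) auto
    qed auto
    then show "emeasure lborel T = emeasure lborel (\<Union>n. T \<inter> {- real n..real n})" by simp
  qed (use mT in auto)
  moreover have "emeasure lborel (T \<inter> {- real n..real n}) + c \<le> d" for n
  proof -
    have "compact (K n)" unfolding K_def using T by (intro compact_insert) (auto intro: closed_Int_compact)
    moreover from this have "emeasure lborel (T \<inter> {- real n..real n}) \<le> emeasure lborel (K n)"
      by (intro emeasure_mono) (auto simp: K_def borel_compact)
    moreover have "K n \<noteq> {}" "K n \<subseteq> A" using T A by (auto simp: K_def)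
    ultimately show ?thesis using le[of "K n"] by (meson add_right_mono order_trans)
  qed
  ultimately have "emeasure lborel T + c \<le> d"
    by (auto simp: ennreal_SUP_add_left[symmetric] intro!: SUP_least)
  moreover have "emeasure lborel A = emeasure lborel T + emeasure lborel (A - T)"
    using T mT A by (subst plus_emeasure) (auto simp: Un_absorb1)
  moreover have "emeasure lborel (A - T) \<le> ennreal e" using T A mT by (simp add: less_imp_le)
  ultimately have "emeasure lborel A + c \<le> (emeasure lborel T + ennreal e) + c"
    by (simp add: add_left_mono add_right_mono)
  also have "\<dots> = (emeasure lborel T + c) + ennreal e" by (simp add: ac_simps)
  also have "\<dots> \<le> d + ennreal e" by (rule add_right_mono) fact
  finally show ?thesis .
qed

text \<open>The only place where a volume inequality is proved from scratch: the higher dimensions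
  follow from this one by integration.\<close>
lemma brunn_minkowski_real:
  fixes A B C :: "real set"
  assumes A: "A \<in> sets borel" "A \<noteq> {}" and B: "B \<in> sets borel" "B \<noteq> {}" and C: "C \<in> sets borel"
    and sub: "\<And>x y. x \<in> A \<Longrightarrow> y \<in> B \<Longrightarrow> (1/2) * (x + y) \<in> C"
  shows "emeasure lborel A + emeasure lborel B \<le> 2 * emeasure lborel C"
proof (rule ennreal_le_epsilon)
  fix e :: real assume e: "e > 0"
  obtain a0 b0 where ab: "a0 \<in> A" "b0 \<in> B" using A B by blast
  have "emeasure lborel A + emeasure lborel B \<le> (2 * emeasure lborel C + ennreal (e/2)) + ennreal (e/2)"
  proof (rule emeasure_le_compact_approx[OF A(1) ab(1)])
    fix K assume K: "compact K" "K \<noteq> {}" "K \<subseteq> A"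
    have "emeasure lborel B + emeasure lborel K \<le> 2 * emeasure lborel C + ennreal (e/2)"
    proof (rule emeasure_le_compact_approx[OF B(1) ab(2)])
      fix L assume L: "compact L" "L \<noteq> {}" "L \<subseteq> B"
      show "emeasure lborel L + emeasure lborel K \<le> 2 * emeasure lborel C"
        using compact_midpoint_measure[OF K(1,2) L(1,2) C] sub K L by (metis add.commute subsetD)
    qed (use e in auto)
    then show "emeasure lborel K + emeasure lborel B \<le> 2 * emeasure lborel C + ennreal (e/2)"
      by (simp add: add.commute)
  qed (use e in auto)
  also have "\<dots> = 2 * emeasure lborel C + ennreal e"
    using e by (simp add: add.assoc ennreal_plus[symmetric] del: ennreal_plus)
  finally show "emeasure lborel A + emeasure lborel B \<le> 2 * emeasure lborel C + ennreal e" .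
qed

text \<open>The layer-cake formula is used with levels measured relative to a bound $F$, so that two
  functions with different suprema can be compared level by level.\<close>
lemma scaled_layer:
  fixes c :: ennreal
  assumes F: "F > 0"
  shows "ennreal F * (\<integral>\<^sup>+t. indicator {t. 0 \<le> t \<and> ennreal (F * t) < c} t \<partial>lborel) = c"
proof (cases c)
  case (real r)
  have "{t. 0 \<le> t \<and> ennreal (F * t) < c} = {0..<r / F}"
    using F unfolding real(2) by (auto simp: ennreal_less_iff pos_less_divide_eq mult.commute)
  then show ?thesis using real F by (simp add: ennreal_mult[symmetric])
next
  case top
  have "{t. 0 \<le> t \<and> ennreal (F * t) < c} = {0::real..}"
    using top by auto
  moreover have "emeasure lborel {0::real..} = \<infinity>"
  proof -
    have "ennreal (real n) \<le> emeasure lborel {0::real..}" for n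
    proof -
      have "emeasure lborel {0..real n} \<le> emeasure lborel {0::real..}" by (rule emeasure_mono) auto
      then show ?thesis by simp
    qed
    then have "(SUP n. of_nat n) \<le> emeasure lborel {0::real..}"
      by (intro SUP_least) (simp add: ennreal_of_nat_eq_real_of_nat)
    then show ?thesis by (simp add: ennreal_SUP_of_nat_eq_top top_unique)
  qed
  ultimately show ?thesis using top F by (simp add: ennreal_mult_top)
qed

lemma nn_integral_layers:
  fixes f :: "'a::euclidean_space \<Rightarrow> ennreal"
  assumes f: "f \<in> borel_measurable borel" and F: "F > 0"
  shows "(\<integral>\<^sup>+x. f x \<partial>lborel) =
    ennreal F * (\<integral>\<^sup>+t. indicator {0..} t * emeasure lborel {x. ennreal (F * t) < f x} \<partial>lborel)"
proof -
  let ?g = "\<lambda>x t. ennreal F * (indicator {0..} t * indicator {x. ennreal (F * t) < f x} x) :: ennreal"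
  note [measurable] = f
  have m: "(\<lambda>(x, t). ?g x t) \<in> borel_measurable (lborel \<Otimes>\<^sub>M lborel)" by measurable
  have "(\<integral>\<^sup>+x. f x \<partial>lborel) = (\<integral>\<^sup>+x. (\<integral>\<^sup>+t. ?g x t \<partial>lborel) \<partial>lborel)"
  proof (rule nn_integral_cong)
    fix x
    have "(\<integral>\<^sup>+t. ?g x t \<partial>lborel) = ennreal F * (\<integral>\<^sup>+t. indicator {t. 0 \<le> t \<and> ennreal (F * t) < f x} t \<partial>lborel)"
      by (subst nn_integral_cmult[symmetric]) (auto intro!: nn_integral_cong simp: indicator_def)
    then show "f x = (\<integral>\<^sup>+t. ?g x t \<partial>lborel)" using scaled_layer[OF F, of "f x"] by simp
  qed
  also have "\<dots> = (\<integral>\<^sup>+t. (\<integral>\<^sup>+x. ?g x t \<partial>lborel) \<partial>lborel)"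
    using lborel_pair.Fubini'[OF m] by simp
  also have "\<dots> = (\<integral>\<^sup>+t. ennreal F * (indicator {0..} t * emeasure lborel {x. ennreal (F * t) < f x}) \<partial>lborel)"
    by (intro nn_integral_cong) (simp add: nn_integral_cmult)
  also have "\<dots> = ennreal F * (\<integral>\<^sup>+t. indicator {0..} t * emeasure lborel {x. ennreal (F * t) < f x} \<partial>lborel)"
    by (rule nn_integral_cmult) measurable
  finally show ?thesis .
qed

text \<open>When both functions are divided by their suprema $F$ and $G$, their superlevel sets at
  relative height $t < 1$ are both nonempty, so the one-dimensional Brunn-Minkowski inequality
  applies to them. Keeping the suprema in the conclusion is what makes the equality case accessible:
  if all three integrals are equal and positive, then $F + G \<le> 2\sqrt{FG}$, so $F = G$.\<close>
lemma prekopa_leindler_real_sup: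
  fixes f g h :: "real \<Rightarrow> ennreal"
  assumes meas: "f \<in> borel_measurable borel" "g \<in> borel_measurable borel" "h \<in> borel_measurable borel"
    and mid: "\<And>x y. f x * g y \<le> (h ((1/2) * (x + y)))\<^sup>2"
    and F: "F > 0" "\<And>x. f x \<le> ennreal F" "\<And>t. 0 \<le> t \<Longrightarrow> t < F \<Longrightarrow> \<exists>x. f x > ennreal t"
    and G: "G > 0" "\<And>x. g x \<le> ennreal G" "\<And>t. 0 \<le> t \<Longrightarrow> t < G \<Longrightarrow> \<exists>x. g x > ennreal t"
  shows "ennreal G * (\<integral>\<^sup>+x. f x \<partial>lborel) + ennreal F * (\<integral>\<^sup>+x. g x \<partial>lborel)
     \<le> ennreal (2 * sqrt (F * G)) * (\<integral>\<^sup>+x. h x \<partial>lborel)"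
proof -
  note [measurable] = meas
  define H where "H = sqrt (F * G)"
  have H: "H > 0" "H * H = F * G" using F G by (auto simp: H_def)
  let ?L = "\<lambda>f F t. indicator {0::real..} t * emeasure lborel {x::real. ennreal (F * t) < f x}"
  have "?L f F t + ?L g G t \<le> 2 * ?L h H t" for t
  proof (cases "0 \<le> t \<and> t < 1")
    case True
    have "emeasure lborel {x. ennreal (F * t) < f x} + emeasure lborel {x. ennreal (G * t) < g x}
        \<le> 2 * emeasure lborel {x. ennreal (H * t) < h x}"
    proof (rule brunn_minkowski_real)
      show "{x. ennreal (F * t) < f x} \<noteq> {}" "{x. ennreal (G * t) < g x} \<noteq> {}"
        using F(3)[of "F * t"] G(3)[of "G * t"] True F(1) G(1) by auto
      fix x y assume "x \<in> {x. ennreal (F * t) < f x}" "y \<in> {x. ennreal (G * t) < g x}"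
      then have fx: "ennreal (F * t) < f x" and gy: "ennreal (G * t) < g y" by auto
      obtain r where r: "f x = ennreal r" "0 \<le> r" using F(2)[of x]
        by (cases "f x") (auto simp: top_unique)
      obtain s where s: "g y = ennreal s" "0 \<le> s" using G(2)[of y]
        by (cases "g y") (auto simp: top_unique)
      have rs: "F * t < r" "G * t < s" using fx gy r s True F G by (auto simp: ennreal_less_iff)
      \<comment> \<open>The midpoint hypothesis at levels Ft and Gt gives level Ht, because H is the
        geometric mean of F and G.\<close>
      have "(H * t)\<^sup>2 = (F * t) * (G * t)" using H by (simp add: power2_eq_square algebra_simps)
      also have "\<dots> < r * s" using rs True F G
        by (intro mult_strict_mono') auto
      finally have lt: "(H * t)\<^sup>2 < r * s" .
      have "ennreal (H * t) < h ((1/2) * (x + y))"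
      proof (rule ccontr)
        assume "\<not> ?thesis"
        then have "(h ((1/2) * (x + y)))\<^sup>2 \<le> (ennreal (H * t))\<^sup>2" by (intro power_mono) auto
        then have "f x * g y \<le> (ennreal (H * t))\<^sup>2" using mid[of x y] by (rule order_trans[rotated])
        then have "ennreal (r * s) \<le> ennreal ((H * t)\<^sup>2)"
          using r s H True by (simp add: ennreal_mult[symmetric] ennreal_power del: ennreal_le_iff ennreal_le_iff2)
        with lt show False using ennreal_le_iff[of "(H*t)\<^sup>2" "r * s"] by simp
      qed
      then show "(1/2) * (x + y) \<in> {x. ennreal (H * t) < h x}" by simp
    qed measurable
    then show ?thesis using True by simp
  next
    case False
    have "{x. ennreal (F * t) < f x} = {}" "{x. ennreal (G * t) < g x} = {}" if "1 \<le> t"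
    proof -
      have "F \<le> F * t" "G \<le> G * t" using that F G by auto
      then have "ennreal F \<le> ennreal (F * t)" "ennreal G \<le> ennreal (G * t)" by (auto intro: ennreal_leI)
      then show "{x. ennreal (F * t) < f x} = {}" "{x. ennreal (G * t) < g x} = {}"
        using F(2) G(2) by (auto simp: not_less intro: order_trans)
    qed
    then show ?thesis using False by (cases "0 \<le> t") auto
  qed
  then have le: "(\<integral>\<^sup>+t. ?L f F t + ?L g G t \<partial>lborel) \<le> (\<integral>\<^sup>+t. 2 * ?L h H t \<partial>lborel)"
    by (intro nn_integral_mono) auto
  have "ennreal G * (\<integral>\<^sup>+x. f x \<partial>lborel) + ennreal F * (\<integral>\<^sup>+x. g x \<partial>lborel)
     = ennreal (F * G) * (\<integral>\<^sup>+t. ?L f F t \<partial>lborel) + ennreal (F * G) * (\<integral>\<^sup>+t. ?L g G t \<partial>lborel)"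
    using F G by (subst nn_integral_layers[of f F], simp, simp, subst nn_integral_layers[of g G])
       (simp_all add: ennreal_mult mult.assoc mult.left_commute)
  also have "\<dots> = ennreal (F * G) * (\<integral>\<^sup>+t. ?L f F t + ?L g G t \<partial>lborel)"
    by (subst nn_integral_add) (auto simp: distrib_left)
  also have "\<dots> \<le> ennreal (F * G) * (\<integral>\<^sup>+t. 2 * ?L h H t \<partial>lborel)" using le by (rule mult_left_mono) auto
  also have "\<dots> = ennreal (2 * H) * (ennreal H * (\<integral>\<^sup>+t. ?L h H t \<partial>lborel))"
    using H F G by (subst nn_integral_cmult) (auto simp: H(2)[symmetric] ennreal_mult mult_ac)
  also have "\<dots> = ennreal (2 * H) * (\<integral>\<^sup>+x. h x \<partial>lborel)"
    using H by (subst nn_integral_layers[of h H]) auto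
  finally show ?thesis by (simp add: H_def)
qed

text \<open>Only midpoints occur, so the geometric mean can be replaced by a square, and the
  functions may take the value $\infty$. Stated as a property of the space, the inequality passes to
  products.\<close>
definition midpoint_prekopa_leindler :: "'a::euclidean_space itself \<Rightarrow> bool" where
  "midpoint_prekopa_leindler _ \<longleftrightarrow>
    (\<forall>f g h :: 'a \<Rightarrow> ennreal.
       f \<in> borel_measurable borel \<longrightarrow> g \<in> borel_measurable borel \<longrightarrow> h \<in> borel_measurable borel \<longrightarrow>
       (\<forall>x y. f x * g y \<le> (h ((1/2) *\<^sub>R (x + y)))\<^sup>2) \<longrightarrow>
       (\<integral>\<^sup>+x. f x \<partial>lborel) * (\<integral>\<^sup>+x. g x \<partial>lborel) \<le> (\<integral>\<^sup>+x. h x \<partial>lborel)\<^sup>2)"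

lemma ennreal_arith_geo_mean:
  fixes a b :: ennreal
  shows "4 * (a * b) \<le> (a + b)\<^sup>2"
proof (cases a; cases b)
  fix r s assume rs: "0 \<le> r" "a = ennreal r" "0 \<le> s" "b = ennreal s"
  have "4 * (r * s) \<le> (r + s)\<^sup>2"
    using zero_le_power2[of "r - s"] by (simp add: power2_eq_square algebra_simps)
  then have "ennreal (4 * (r * s)) \<le> ennreal ((r + s)\<^sup>2)" by (rule ennreal_leI)
  then show ?thesis using rs by (simp add: ennreal_mult ennreal_power[symmetric])
qed (auto simp: power2_eq_square ennreal_top_mult ennreal_mult_top)

lemma ennreal_layers_nonempty:
  fixes f :: "'a \<Rightarrow> ennreal"
  assumes "\<And>x. f x \<le> ennreal N" and "f x0 > 0"
  obtains F where "F > 0" "\<And>x. f x \<le> ennreal F" "\<And>t. 0 \<le> t \<Longrightarrow> t < F \<Longrightarrow> \<exists>x. f x > ennreal t"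
proof -
  have le: "(SUP x. f x) \<le> ennreal N" using assms by (intro SUP_least) auto
  then have fin: "(SUP x. f x) \<noteq> Orderings.top" by (metis ennreal_less_top order_le_less_trans order_less_irrefl)
  define F where "F = enn2real (SUP x. f x)"
  have F: "ennreal F = (SUP x. f x)" unfolding F_def using fin by (simp only: ennreal_enn2real_if if_False)
  show thesis
  proof
    have "0 < ennreal F" unfolding F using assms(2) by (rule less_SUP_iff[THEN iffD2, OF bexI]) auto
    then show "F > 0" by simp
    show "f x \<le> ennreal F" for x unfolding F by (rule SUP_upper) auto
    show "\<exists>x. f x > ennreal t" if "0 \<le> t" "t < F" for t
    proof -
      have "ennreal t < (SUP x. f x)" unfolding F[symmetric] using that by (simp add: ennreal_less_iff)
      then show ?thesis by (auto simp: less_SUP_iff)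
    qed
  qed
qed

lemma prekopa_leindler_real_bounded:
  fixes f g h :: "real \<Rightarrow> ennreal"
  assumes meas: "f \<in> borel_measurable borel" "g \<in> borel_measurable borel" "h \<in> borel_measurable borel"
    and mid: "\<And>x y. f x * g y \<le> (h ((1/2) * (x + y)))\<^sup>2"
    and bd: "\<And>x. f x \<le> ennreal N" "\<And>x. g x \<le> ennreal N"
  shows "(\<integral>\<^sup>+x. f x \<partial>lborel) * (\<integral>\<^sup>+x. g x \<partial>lborel) \<le> (\<integral>\<^sup>+x. h x \<partial>lborel)\<^sup>2"
proof (cases "(\<forall>x. f x = 0) \<or> (\<forall>x. g x = 0)")
  case True
  then show ?thesis by auto
next
  case False
  then obtain x0 y0 where "f x0 > 0" "g y0 > 0" by (auto simp: zero_less_iff_neq_zero)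
  obtain F where F: "F > 0" "\<And>x. f x \<le> ennreal F" "\<And>t. 0 \<le> t \<Longrightarrow> t < F \<Longrightarrow> \<exists>x. f x > ennreal t"
    using ennreal_layers_nonempty[of f N, OF bd(1) \<open>f x0 > 0\<close>] by metis
  obtain G where G: "G > 0" "\<And>x. g x \<le> ennreal G" "\<And>t. 0 \<le> t \<Longrightarrow> t < G \<Longrightarrow> \<exists>x. g x > ennreal t"
    using ennreal_layers_nonempty[of g N, OF bd(2) \<open>g y0 > 0\<close>] by metis
  define a b c where "a = (\<integral>\<^sup>+x. f x \<partial>lborel)" and "b = (\<integral>\<^sup>+x. g x \<partial>lborel)" and "c = (\<integral>\<^sup>+x. h x \<partial>lborel)"
  have key: "ennreal G * a + ennreal F * b \<le> ennreal (2 * sqrt (F * G)) * c"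
    unfolding a_def b_def c_def by (rule prekopa_leindler_real_sup[OF meas mid F G])
  have "ennreal (4 * (F * G)) * (a * b) = 4 * ((ennreal G * a) * (ennreal F * b))"
    using F G by (simp add: ennreal_mult ac_simps)
  also have "\<dots> \<le> (ennreal G * a + ennreal F * b)\<^sup>2" by (rule ennreal_arith_geo_mean)
  also have "\<dots> \<le> (ennreal (2 * sqrt (F * G)) * c)\<^sup>2" using key by (rule power_mono) simp
  also have "\<dots> = ennreal (4 * (F * G)) * c\<^sup>2"
    using F G by (simp add: power_mult_distrib ennreal_power)
  finally have *: "ennreal (4 * (F * G)) * (a * b) \<le> ennreal (4 * (F * G)) * c\<^sup>2" .
  define K where "K = 4 * (F * G)"
  have K: "K > 0" using F G by (simp add: K_def)
  have inv: "ennreal (1 / K) * (ennreal K * z) = z" for z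
    using K by (simp add: mult.assoc[symmetric] ennreal_mult[symmetric])
  have "ennreal (1 / K) * (ennreal K * (a * b)) \<le> ennreal (1 / K) * (ennreal K * c\<^sup>2)"
    using * unfolding K_def by (rule mult_left_mono) simp
  then show ?thesis unfolding inv by (simp add: a_def b_def c_def)
qed

lemma midpoint_prekopa_leindler_real: "midpoint_prekopa_leindler TYPE(real)"
  unfolding midpoint_prekopa_leindler_def
proof (intro allI impI)
  fix f g h :: "real \<Rightarrow> ennreal"
  assume meas[measurable]: "f \<in> borel_measurable borel" "g \<in> borel_measurable borel" "h \<in> borel_measurable borel"
    and mid: "\<forall>x y. f x * g y \<le> (h ((1/2) *\<^sub>R (x + y)))\<^sup>2"
  let ?t = "\<lambda>f n x. min (f x) (ennreal (real n)) :: ennreal"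
  have SUP_t: "(SUP n. ?t f n x) = f x" for f :: "real \<Rightarrow> ennreal" and x
  proof -
    have "(SUP n. ennreal (real n)) = Orderings.top"
      using ennreal_SUP_of_nat_eq_top by (simp only: ennreal_of_nat_eq_real_of_nat)
    then show ?thesis by (simp only: inf_min[symmetric] inf_SUP[symmetric] inf_top_right)
  qed
  have inc: "incseq (?t f)" for f :: "real \<Rightarrow> ennreal"
    by (auto simp: incseq_def le_fun_def intro: min.coboundedI2)
  have lim: "(\<integral>\<^sup>+x. f x \<partial>lborel) = (SUP n. (\<integral>\<^sup>+x. ?t f n x \<partial>lborel))"
    if [measurable]: "f \<in> borel_measurable borel" for f :: "real \<Rightarrow> ennreal"
    by (subst nn_integral_monotone_convergence_SUP[symmetric, OF inc]) (auto simp: SUP_t)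
  have "(\<integral>\<^sup>+x. ?t f n x \<partial>lborel) * (\<integral>\<^sup>+x. ?t g m x \<partial>lborel) \<le> (\<integral>\<^sup>+x. h x \<partial>lborel)\<^sup>2" for n m
  proof (rule prekopa_leindler_real_bounded)
    fix x y
    have "?t f n x * ?t g m y \<le> f x * g y" by (intro mult_mono) auto
    also have "\<dots> \<le> (h ((1/2) * (x + y)))\<^sup>2" using mid by simp
    finally show "?t f n x * ?t g m y \<le> (h ((1/2) * (x + y)))\<^sup>2" .
    show "?t f n x \<le> ennreal (max (real n) (real m))" "?t g m x \<le> ennreal (max (real n) (real m))"
      by (auto intro: min.coboundedI2 ennreal_leI)
  qed measurable
  then show "(\<integral>\<^sup>+x. f x \<partial>lborel) * (\<integral>\<^sup>+x. g x \<partial>lborel) \<le> (\<integral>\<^sup>+x. h x \<partial>lborel)\<^sup>2"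
    unfolding lim[OF meas(1)] lim[OF meas(2)] SUP_mult_left_ennreal SUP_mult_right_ennreal
    by (intro SUP_least)
qed

text \<open>For fixed first coordinates the inequality in the second factor says that the partial
  integrals satisfy the hypothesis of the inequality in the first factor.\<close>
lemma midpoint_prekopa_leindler_prod:
  assumes A: "midpoint_prekopa_leindler TYPE('a::euclidean_space)"
    and B: "midpoint_prekopa_leindler TYPE('b::euclidean_space)"
  shows "midpoint_prekopa_leindler TYPE('a \<times> 'b)"
  unfolding midpoint_prekopa_leindler_def
proof (intro allI impI)
  fix f g h :: "'a \<times> 'b \<Rightarrow> ennreal"
  assume "f \<in> borel_measurable borel" "g \<in> borel_measurable borel" "h \<in> borel_measurable borel"
    and mid: "\<forall>x y. f x * g y \<le> (h ((1/2) *\<^sub>R (x + y)))\<^sup>2"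
  then have meas[measurable]: "f \<in> borel_measurable (borel \<Otimes>\<^sub>M borel)" "g \<in> borel_measurable (borel \<Otimes>\<^sub>M borel)"
    "h \<in> borel_measurable (borel \<Otimes>\<^sub>M borel)" by (simp_all add: borel_prod)
  let ?I = "\<lambda>f t. (\<integral>\<^sup>+z. f (t, z) \<partial>lborel) :: ennreal"
  have fub: "(\<integral>\<^sup>+x. f x \<partial>lborel) = (\<integral>\<^sup>+t. ?I f t \<partial>lborel)"
    if [measurable]: "f \<in> borel_measurable (borel \<Otimes>\<^sub>M borel)" for f :: "'a \<times> 'b \<Rightarrow> ennreal"
    by (simp add: lborel_prod[symmetric] lborel.nn_integral_fst)
  have sl: "?I f s * ?I g t \<le> (?I h ((1/2) *\<^sub>R (s + t)))\<^sup>2" for s t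
    using B[unfolded midpoint_prekopa_leindler_def, rule_format, of "\<lambda>z. f (s, z)" "\<lambda>z. g (t, z)" "\<lambda>z. h ((1/2) *\<^sub>R (s + t), z)"]
      mid[rule_format, of "(s, _)" "(t, _)"] by simp
  show "(\<integral>\<^sup>+x. f x \<partial>lborel) * (\<integral>\<^sup>+x. g x \<partial>lborel) \<le> (\<integral>\<^sup>+x. h x \<partial>lborel)\<^sup>2"
    unfolding fub[OF meas(1)] fub[OF meas(2)] fub[OF meas(3)]
    using A[unfolded midpoint_prekopa_leindler_def, rule_format, of "?I f" "?I g" "?I h"] sl by simp
qed

lemma brunn_minkowski_midpoint:
  fixes A B C :: "'a::euclidean_space set"
  assumes PL: "midpoint_prekopa_leindler TYPE('a)"
    and m: "A \<in> sets borel" "B \<in> sets borel" "C \<in> sets borel"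
    and sub: "\<And>x y. x \<in> A \<Longrightarrow> y \<in> B \<Longrightarrow> (1/2) *\<^sub>R (x + y) \<in> C"
  shows "emeasure lborel A * emeasure lborel B \<le> (emeasure lborel C)\<^sup>2"
proof -
  have "indicator A x * indicator B y \<le> (indicator C ((1/2) *\<^sub>R (x + y)) :: ennreal)\<^sup>2" for x y
    using sub[of x y] by (auto simp: indicator_def)
  then show ?thesis
    using PL[unfolded midpoint_prekopa_leindler_def, rule_format, of "indicator A" "indicator B" "indicator C"] m
    by simp
qed

section \<open>Orthonormal frames and planar area\<close>

text \<open>An orthonormal coordinate system of the space whose first axis is $u$: the planes
  orthogonal to $u$ become the sets of points with a given first coordinate.\<close>
definition adapted_frame :: "real^3 \<Rightarrow> (real \<times> (real \<times> real) \<Rightarrow> real^3) \<Rightarrow> bool" where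
  "adapted_frame u \<phi> \<longleftrightarrow>
     linear \<phi> \<and> surj \<phi> \<and> (\<forall>x. norm (\<phi> x) = norm x) \<and> (\<forall>x. u \<bullet> \<phi> x = fst x)"

definition cart3 :: "real \<times> (real \<times> real) \<Rightarrow> real^3" where
  "cart3 = (\<lambda>(t, a, b). vector [t, a, b])"

definition cart2 :: "real \<times> real \<Rightarrow> real^2" where
  "cart2 = (\<lambda>(a, b). vector [a, b])"

lemma linear_cart3: "linear cart3"
  by (auto intro!: linearI simp: cart3_def vec_eq_iff forall_3 vector_3)

lemma linear_cart2: "linear cart2"
  by (auto intro!: linearI simp: cart2_def vec_eq_iff forall_2 vector_2)

lemma norm_cart3: "norm (cart3 x) = norm x"
  by (cases x) (auto simp: cart3_def norm_eq_sqrt_inner inner_vec_def sum_3 vector_3 add.assoc)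

lemma norm_cart2: "norm (cart2 x) = norm x"
  by (cases x) (auto simp: cart2_def norm_eq_sqrt_inner inner_vec_def sum_2 vector_2)

lemma surj_cart3: "surj cart3"
proof (rule surjI)
  show "cart3 (x $ 1, x $ 2, x $ 3) = x" for x
    by (auto simp: cart3_def vec_eq_iff forall_3 vector_3)
qed

lemma borel_measurable_linear:
  fixes f :: "'a::euclidean_space \<Rightarrow> 'b::real_normed_vector"
  assumes "linear f" shows "f \<in> borel_measurable borel"
  using assms by (intro borel_measurable_continuous_onI linear_continuous_on) (simp add: linear_conv_bounded_linear)

lemma prod_Basis_cart:
  fixes f :: "real^'n \<Rightarrow> 'b::comm_monoid_mult"
  shows "(\<Prod>b\<in>Basis. f b) = (\<Prod>i\<in>UNIV. f (axis i 1))"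
proof -
  have B: "(Basis :: (real^'n) set) = range (\<lambda>i. axis i 1)" by (auto simp: Basis_vec_def)
  have i: "inj (\<lambda>i. axis i 1 :: real^'n)" by (auto intro!: injI simp: axis_eq_axis)
  show ?thesis unfolding B prod.reindex[OF i] comp_def ..
qed

lemma box_Pair: "box (a, b) (c, d) = box a c \<times> box b (d :: 'b::euclidean_space)"
  for a c :: "'a::euclidean_space"
  by (auto simp: box_def Basis_prod_def ball_Un)

lemma emeasure_lborel_Times:
  assumes "A \<in> sets borel" "B \<in> sets borel"
  shows "emeasure lborel (A \<times> B) = emeasure lborel A * emeasure lborel B"
  using assms by (simp add: lborel_prod[symmetric] lborel.emeasure_pair_measure_Times)

lemma linear_isometry_inj:
  assumes "linear f" "\<And>x. norm (f x) = norm x"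
  shows "inj f"
proof (rule injI)
  fix x y assume "f x = f y"
  then have "norm (f (x - y)) = 0" using assms(1) by (simp add: linear_diff)
  then show "x = y" using assms(2) by simp
qed

lemma distr_lborel_cart3: "distr lborel borel cart3 = lborel"
proof (rule lborel_eqI[symmetric])
  fix l u :: "real^3" assume le: "\<And>b. b \<in> Basis \<Longrightarrow> l \<bullet> b \<le> u \<bullet> b"
  have le': "l $ i \<le> u $ i" for i
    using le[of "axis i 1"] by (simp add: inner_axis)
  note borel_measurable_linear[OF linear_cart3, measurable]
  have "emeasure (distr lborel borel cart3) (box l u) = emeasure lborel (cart3 -` box l u)"
    by (subst emeasure_distr) auto
  also have "cart3 -` box l u = box (l $ 1, l $ 2, l $ 3) (u $ 1, u $ 2, u $ 3)"
    by (auto simp: cart3_def mem_box_cart forall_3 vector_3 box_Pair)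
  also have "emeasure lborel \<dots> = ennreal ((u$1 - l$1) * ((u$2 - l$2) * (u$3 - l$3)))"
    using le' unfolding box_Pair
    by (simp add: emeasure_lborel_Times ennreal_mult borel_open open_Times open_box del: box_real)
      (simp add: emeasure_lborel_Ioo)
  also have "\<dots> = ennreal (\<Prod>b\<in>Basis. (u - l) \<bullet> b)"
    unfolding prod_Basis_cart UNIV_3 by (simp add: inner_axis)
  finally show "emeasure (distr lborel borel cart3) (box l u) = ennreal (\<Prod>b\<in>Basis. (u - l) \<bullet> b)" .
qed simp

lemma distr_lborel_cart2: "distr lborel borel cart2 = lborel"
proof (rule lborel_eqI[symmetric])
  fix l u :: "real^2" assume le: "\<And>b. b \<in> Basis \<Longrightarrow> l \<bullet> b \<le> u \<bullet> b"
  have le': "l $ i \<le> u $ i" for i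
    using le[of "axis i 1"] by (simp add: inner_axis)
  note borel_measurable_linear[OF linear_cart2, measurable]
  have "emeasure (distr lborel borel cart2) (box l u) = emeasure lborel (cart2 -` box l u)"
    by (subst emeasure_distr) auto
  also have "cart2 -` box l u = box (l $ 1, l $ 2) (u $ 1, u $ 2)"
    by (auto simp: cart2_def mem_box_cart forall_2 vector_2 box_Pair)
  also have "emeasure lborel \<dots> = ennreal ((u$1 - l$1) * (u$2 - l$2))"
    using le' unfolding box_Pair by (simp add: emeasure_lborel_Times ennreal_mult)
  also have "\<dots> = ennreal (\<Prod>b\<in>Basis. (u - l) \<bullet> b)"
    unfolding prod_Basis_cart UNIV_2 by (simp add: inner_axis)
  finally show "emeasure (distr lborel borel cart2) (box l u) = ennreal (\<Prod>b\<in>Basis. (u - l) \<bullet> b)" .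
qed simp

lemma distr_lborel_orthogonal:
  fixes g :: "real^3 \<Rightarrow> real^3"
  assumes g: "orthogonal_transformation g"
  shows "distr lborel borel g = lborel"
proof (rule lborel_eqI[symmetric])
  fix l u :: "real^3" assume le: "\<And>b. b \<in> Basis \<Longrightarrow> l \<bullet> b \<le> u \<bullet> b"
  note borel_measurable_linear[OF orthogonal_transformation_linear[OF g], measurable]
  have "bij g" using g by (rule orthogonal_transformation_bij)
  have inv: "orthogonal_transformation (inv_into UNIV g)" using g by (rule orthogonal_transformation_inv)
  have im: "g -` box l u = inv_into UNIV g ` box l u" using \<open>bij g\<close> by (rule bij_vimage_eq_inv_image)
  have "g -` box l u \<in> sets borel"
    using linear_continuous_on[of g UNIV] orthogonal_transformation_linear[OF g]
    by (intro borel_open open_vimage) (auto simp: linear_conv_bounded_linear)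
  moreover have m: "g -` box l u \<in> lmeasurable" unfolding im by (rule measurable_orthogonal_image[OF inv]) simp
  ultimately have "emeasure lborel (g -` box l u) = ennreal (measure lebesgue (g -` box l u))"
    using emeasure_eq_measure2[OF m] by simp
  also have "measure lebesgue (g -` box l u) = measure lebesgue (box l u)"
    unfolding im by (rule measure_orthogonal_image[OF inv]) simp
  also have "\<dots> = (\<Prod>b\<in>Basis. (u - l) \<bullet> b)" using le by (simp add: measure_lborel_box_eq)
  finally show "emeasure (distr lborel borel g) (box l u) = ennreal (\<Prod>b\<in>Basis. (u - l) \<bullet> b)"
    by (subst emeasure_distr) auto
qed simp

lemma adapted_frame_exists:
  assumes "norm u = 1"
  obtains \<phi> where "adapted_frame u \<phi>"
proof -
  have "norm (axis 1 1 :: real^3) = norm u" using assms by (simp add: norm_axis_1)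
  then obtain g :: "real^3 \<Rightarrow> real^3" where g: "orthogonal_transformation g" "g (axis 1 1) = u"
    by (rule orthogonal_transformation_exists) (rule that)
  have "adapted_frame u (g \<circ> cart3)"
    unfolding adapted_frame_def
  proof (intro conjI allI)
    show "linear (g \<circ> cart3)" by (rule linear_compose[OF linear_cart3 orthogonal_transformation_linear[OF g(1)]])
    show "surj (g \<circ> cart3)" by (rule comp_surj[OF surj_cart3 orthogonal_transformation_surj[OF g(1)]])
    fix x
    show "norm ((g \<circ> cart3) x) = norm x" using g by (simp add: norm_cart3 orthogonal_transformation_norm)
    have "u \<bullet> (g \<circ> cart3) x = axis 1 1 \<bullet> cart3 x"
      using g(1) unfolding orthogonal_transformation_def g(2)[symmetric] by simp
    also have "\<dots> = fst x" by (cases x) (simp add: cart3_def inner_axis' vector_3)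
    finally show "u \<bullet> (g \<circ> cart3) x = fst x" .
  qed
  then show thesis by (rule that)
qed

lemma adapted_frameD:
  assumes "adapted_frame u \<phi>"
  shows "linear \<phi>" "surj \<phi>" "\<And>x. norm (\<phi> x) = norm x" "\<And>x. u \<bullet> \<phi> x = fst x" "inj \<phi>"
    "\<phi> \<in> borel_measurable borel" "continuous_on S \<phi>"
proof -
  show *: "linear \<phi>" "surj \<phi>" "\<And>x. norm (\<phi> x) = norm x" "\<And>x. u \<bullet> \<phi> x = fst x"
    using assms by (auto simp: adapted_frame_def)
  show "inj \<phi>" using *(1,3) by (rule linear_isometry_inj)
  show "\<phi> \<in> borel_measurable borel" using *(1) by (rule borel_measurable_linear)
  show "continuous_on S \<phi>" using *(1) by (simp add: linear_conv_bounded_linear linear_continuous_on)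
qed

lemma distr_lborel_frame:
  assumes "adapted_frame u \<phi>"
  shows "distr lborel borel \<phi> = lborel"
proof -
  note f = adapted_frameD[OF assms]
  define g where "g = (\<lambda>x::real^3. \<phi> (x $ 1, x $ 2, x $ 3))"
  have cart: "cart3 (x $ 1, x $ 2, x $ 3) = x" for x
    by (simp add: cart3_def vec_eq_iff forall_3 vector_3)
  have "linear (\<lambda>x::real^3. (x $ 1, x $ 2, x $ 3))" by (rule linearI) auto
  then have "linear g" unfolding g_def using f(1) by (rule linear_compose[unfolded comp_def])
  moreover have "norm (g x) = norm x" for x
    unfolding g_def f(3) using norm_cart3[of "(x $ 1, x $ 2, x $ 3)"] by (simp only: cart)
  ultimately have g: "orthogonal_transformation g" by (simp add: orthogonal_transformation)
  have "\<phi> = g \<circ> cart3" unfolding g_def by (auto simp: fun_eq_iff cart3_def vector_3)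
  then have "distr lborel borel \<phi> = distr (distr lborel borel cart3) borel g"
    using borel_measurable_linear[OF linear_cart3] borel_measurable_linear[OF orthogonal_transformation_linear[OF g]]
    by (simp add: distr_distr)
  then show ?thesis by (simp add: distr_lborel_cart3 distr_lborel_orthogonal[OF g])
qed

lemma emeasure_frame:
  assumes "adapted_frame u \<phi>" "S \<in> sets borel"
  shows "emeasure lborel (\<phi> -` S) = emeasure lborel S"
proof -
  note adapted_frameD(6)[OF assms(1), measurable]
  have "emeasure lborel S = emeasure (distr lborel borel \<phi>) S" using assms by (simp add: distr_lborel_frame)
  also have "\<dots> = emeasure lborel (\<phi> -` S)" using assms by (subst emeasure_distr) auto
  finally show ?thesis by simp
qed

text \<open>An isometry fixing the origin preserves inner products by polarization, and the squared
  norms of its additivity and homogeneity defects then vanish.\<close>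
lemma isometry_diff_linear:
  fixes f :: "'a::euclidean_space \<Rightarrow> 'b::real_inner"
  assumes "\<And>x y. dist (f x) (f y) = dist x y"
  shows "linear (\<lambda>x. f x - f 0)"
proof -
  let ?g = "\<lambda>x. f x - f 0"
  have n: "norm (?g x) = norm x" for x using assms[of x 0] by (simp add: dist_norm)
  have d: "norm (?g x - ?g y) = norm (x - y)" for x y using assms[of x y] by (simp add: dist_norm)
  have ip: "?g x \<bullet> ?g y = x \<bullet> y" for x y
  proof -
    have "2 * (?g x \<bullet> ?g y) = (norm (?g x))\<^sup>2 + (norm (?g y))\<^sup>2 - (norm (?g x - ?g y))\<^sup>2"
      by (simp only: power2_norm_eq_inner inner_diff inner_commute) (simp add: inner_diff inner_commute algebra_simps)
    also have "\<dots> = 2 * (x \<bullet> y)"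
      unfolding n d by (simp add: power2_norm_eq_inner inner_diff inner_commute)
    finally show ?thesis by simp
  qed
  show ?thesis
  proof (rule linearI)
    fix x y
    define a b c where "a = ?g (x + y)" and "b = ?g x" and "c = ?g y"
    have "(a - b - c) \<bullet> (a - b - c) = a \<bullet> a + b \<bullet> b + c \<bullet> c - 2 * (a \<bullet> b) - 2 * (a \<bullet> c) + 2 * (b \<bullet> c)"
      by (simp add: inner_diff inner_commute)
    also have "\<dots> = 0" unfolding a_def b_def c_def ip by (simp add: inner_add inner_commute)
    finally have "a - b - c = 0" by (simp only: inner_eq_zero_iff)
    then have "a = b + c" by (simp add: algebra_simps)
    then show "?g (x + y) = ?g x + ?g y" unfolding a_def b_def c_def .
  next
    fix r x
    define a b where "a = ?g (r *\<^sub>R x)" and "b = ?g x"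
    have "(a - r *\<^sub>R b) \<bullet> (a - r *\<^sub>R b) = a \<bullet> a - 2 * r * (a \<bullet> b) + r * r * (b \<bullet> b)"
      by (simp add: inner_diff inner_commute)
    also have "\<dots> = 0" unfolding a_def b_def ip by simp
    finally have "a - r *\<^sub>R b = 0" by (simp only: inner_eq_zero_iff)
    then show "?g (r *\<^sub>R x) = r *\<^sub>R ?g x" unfolding a_def b_def by simp
  qed
qed

lemma measure_lebesgue_isometry_image:
  fixes T :: "real^2 \<Rightarrow> real^2"
  assumes T: "\<And>x y. dist (T x) (T y) = dist x y" and S: "S \<in> lmeasurable"
  shows "measure lebesgue (T ` S) = measure lebesgue S"
proof -
  let ?g = "\<lambda>x. T x - T 0"
  have "norm (?g x) = norm x" for x using T[of x 0] by (simp add: dist_norm)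
  then have g: "orthogonal_transformation ?g"
    using isometry_diff_linear[of T, OF T] by (simp add: orthogonal_transformation)
  have "T ` S = (+) (T 0) ` ?g ` S" by (auto simp: image_image)
  then show ?thesis using measure_orthogonal_image[OF g S] by (simp add: measure_translation)
qed

lemma emeasure_cart2:
  assumes "S \<in> sets borel"
  shows "emeasure lborel (cart2 -` S) = emeasure lborel S"
proof -
  note borel_measurable_linear[OF linear_cart2, measurable]
  have "emeasure lborel S = emeasure (distr lborel borel cart2) S" using assms by (simp add: distr_lborel_cart2)
  also have "\<dots> = emeasure lborel (cart2 -` S)" using assms by (subst emeasure_distr) auto
  finally show ?thesis by simp
qed

text \<open>The parametrization chosen in the definition of the planar area is an arbitrary isometry
  whose range contains $F$. Since $F$ spans its plane, that range is the plane itself, and two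
  isometric parametrizations of one plane differ by an isometry of $\mathbb R^2$, which preserves
  Lebesgue measure.\<close>
lemma planar_area_eq_section:
  assumes u: "norm u = 1" and \<phi>: "adapted_frame u \<phi>" and F: "compact F" "F \<subseteq> {y. u \<bullet> y = b}" "aff_dim F = 2"
  shows "planar_area F = measure lborel (Pair b -` \<phi> -` F)"
proof -
  note f = adapted_frameD[OF \<phi>]
  define \<psi> where "\<psi> = (\<lambda>z::real^2. \<phi> (b, z $ 1, z $ 2))"
  have nrm2: "norm (p :: real \<times> real) = norm (cart2 p)" for p by (simp add: norm_cart2)
  have c2: "cart2 (z $ 1, z $ 2) = z" for z by (auto simp: cart2_def vec_eq_iff forall_2 vector_2)
  have \<psi>_iso: "dist (\<psi> x) (\<psi> y) = dist x y" for x y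
  proof -
    have "dist (\<psi> x) (\<psi> y) = norm (\<phi> ((b, x $ 1, x $ 2) - (b, y $ 1, y $ 2)))"
      unfolding \<psi>_def dist_norm by (simp only: linear_diff[OF f(1)])
    also have "\<dots> = norm (0::real, (x - y) $ 1, (x - y) $ 2)" by (simp add: f(3))
    also have "\<dots> = norm ((x - y) $ 1, (x - y) $ 2)" by (simp add: norm_Pair)
    also have "\<dots> = norm (x - y)" unfolding nrm2 c2 ..
    finally show ?thesis by (simp add: dist_norm)
  qed
  let ?H = "{y. u \<bullet> y = b}"
  have range_\<psi>: "range \<psi> = ?H"
  proof
    show "range \<psi> \<subseteq> ?H" by (auto simp: \<psi>_def f(4))
    show "?H \<subseteq> range \<psi>"
    proof
      fix y assume y: "y \<in> ?H"
      obtain x where x: "y = \<phi> x" using f(2) by (rule surjE)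
      have "fst x = b" using y f(4)[of x] x by simp
      then have "y = \<psi> (cart2 (snd x))" unfolding \<psi>_def x
        by (cases x) (simp add: cart2_def vector_2)
      then show "y \<in> range \<psi>" by blast
    qed
  qed
  define Q where "Q = (\<lambda>f :: real^2 \<Rightarrow> real^3. (\<forall>x y. dist (f x) (f y) = dist x y) \<and> F \<subseteq> range f)"
  define f0 where "f0 = (SOME f. Q f)"
  have "Q \<psi>" unfolding Q_def using \<psi>_iso F(2) range_\<psi> by simp
  then have "Q f0" unfolding f0_def by (rule someI[of Q \<psi>])
  then have f0: "\<And>x y. dist (f0 x) (f0 y) = dist x y" "F \<subseteq> range f0" by (auto simp: Q_def)
  have area: "planar_area F = measure lebesgue (f0 -` F)"
    unfolding planar_area_def f0_def Q_def ..
  have iso_aff: "affine (range h)" "aff_dim (range h) = 2" if h: "\<And>x y. dist (h x) (h y) = dist x y" for h :: "real^2 \<Rightarrow> real^3"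
  proof -
    let ?g = "\<lambda>x. h x - h 0"
    have lin: "linear ?g" by (rule isometry_diff_linear[OF h])
    have "inj ?g" using h by (intro injI) (metis diff_add_cancel dist_eq_0_iff)
    have r: "range h = (+) (h 0) ` range ?g" by (auto simp: image_image)
    have "subspace (range ?g)" using lin by (simp add: linear_subspace_image)
    then show "affine (range h)" unfolding r by (metis affine_translation subspace_imp_affine)
    show "aff_dim (range h) = 2" unfolding r aff_dim_translation_eq
      using aff_dim_injective_linear_image[OF lin \<open>inj ?g\<close>, of UNIV] by simp
  qed
  have "range f0 = affine hull F"
    using iso_aff[OF f0(1)] f0(2) F(3)
    by (intro affine_dim_equal[symmetric]) (auto simp: hull_minimal)
  moreover have "range \<psi> = affine hull F"
    using iso_aff[OF \<psi>_iso] F(2,3) range_\<psi>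
    by (intro affine_dim_equal[symmetric]) (auto simp: hull_minimal)
  ultimately have req: "range f0 = range \<psi>" by simp
  define T where "T = inv_into UNIV \<psi> \<circ> f0"
  have "inj \<psi>" using \<psi>_iso by (metis dist_eq_0_iff injI)
  have \<psi>T: "\<psi> (T x) = f0 x" for x
    unfolding T_def using req by (metis comp_apply f_inv_into_f rangeI)
  have T_iso: "dist (T x) (T y) = dist x y" for x y
    using \<psi>_iso[of "T x" "T y"] f0(1)[of x y] by (simp add: \<psi>T)
  have "inj f0" using f0(1) by (metis dist_eq_0_iff injI)
  have im: "\<psi> -` F = T ` (f0 -` F)"
  proof
    show "\<psi> -` F \<subseteq> T ` (f0 -` F)"
    proof
      fix z assume z: "z \<in> \<psi> -` F"
      obtain x where "\<psi> z = f0 x" using req by (metis rangeE rangeI)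
      then have "T x = z" using \<psi>T[of x] \<open>inj \<psi>\<close> by (metis injD)
      then show "z \<in> T ` (f0 -` F)" using z \<open>\<psi> z = f0 x\<close> by auto
    qed
  qed (auto simp: \<psi>T)
  have cont: "continuous_on UNIV h" if "\<And>x y. dist (h x) (h y) = dist x y" for h :: "real^2 \<Rightarrow> real^3"
    using that unfolding continuous_on_iff by auto
  have comp: "compact (h -` F)" if h: "\<And>x y. dist (h x) (h y) = dist x y" for h :: "real^2 \<Rightarrow> real^3"
  proof -
    have "closed (h -` F)" using cont[OF h] F(1)
      by (simp add: closed_vimage compact_imp_closed)
    moreover have "bounded (h -` F)"
    proof -
      obtain B where B: "\<And>y. y \<in> F \<Longrightarrow> dist (h 0) y \<le> B" using compact_imp_bounded[OF F(1)] by (meson bounded_any_center)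
      then show ?thesis unfolding bounded_any_center[where a=0] using h by (metis vimageE)
    qed
    ultimately show ?thesis by (simp add: compact_eq_bounded_closed)
  qed
  have "measure lebesgue (\<psi> -` F) = measure lebesgue (f0 -` F)"
    unfolding im by (rule measure_lebesgue_isometry_image[OF T_iso lmeasurable_compact[OF comp[OF f0(1)]]])
  moreover have "measure lebesgue (\<psi> -` F) = measure lborel (\<psi> -` F)"
    using comp[OF \<psi>_iso] by (simp add: borel_compact)
  moreover have "measure lborel (\<psi> -` F) = measure lborel (cart2 -` (\<psi> -` F))"
    using comp[OF \<psi>_iso] by (simp add: measure_def emeasure_cart2 borel_compact)
  moreover have "cart2 -` (\<psi> -` F) = Pair b -` \<phi> -` F"
    by (auto simp: \<psi>_def cart2_def vector_2)
  ultimately show ?thesis using area by simp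
qed

section \<open>Volume by parallel slices\<close>

lemma compact_emeasure_lborel:
  assumes "compact S" shows "emeasure lborel S = ennreal (measure lborel S)"
  using emeasure_eq_measure2[OF fmeasurable_compact[OF assms]] .

lemma compact_measure_mono:
  assumes "A \<subseteq> B" "compact A" "compact B"
  shows "measure lborel A \<le> measure lborel B"
  using assms by (intro measure_mono_fmeasurable fmeasurable_compact) (auto simp: borel_compact)

lemma measure_compact_affine_image:
  fixes S :: "'a::euclidean_space set"
  assumes S: "compact S" and c: "c \<noteq> 0"
  shows "measure lborel ((\<lambda>x. a + c *\<^sub>R x) ` S) = \<bar>c\<bar> ^ DIM('a) * measure lborel S"
proof -
  let ?f = "\<lambda>x. a + c *\<^sub>R x"
  have comp: "compact (?f ` S)" using S by (intro compact_continuous_image continuous_intros)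
  have vim: "?f -` (?f ` S) = S" using c by auto
  have "emeasure lborel (?f ` S) = emeasure (density (distr lborel borel ?f) (\<lambda>_. ennreal (\<bar>c\<bar>^DIM('a)))) (?f ` S)"
    using lborel_affine[OF c, of a] by simp
  also have "\<dots> = ennreal (\<bar>c\<bar>^DIM('a)) * emeasure (distr lborel borel ?f) (?f ` S)"
    using comp by (subst emeasure_density) (simp_all add: borel_compact nn_integral_cmult_indicator)
  also have "emeasure (distr lborel borel ?f) (?f ` S) = emeasure lborel S"
    using comp by (subst emeasure_distr) (auto simp: borel_compact vim)
  finally show ?thesis by (simp add: measure_def enn2real_mult)
qed

definition slice_area :: "(real \<times> (real \<times> real)) set \<Rightarrow> real \<Rightarrow> real" where
  "slice_area S t = measure lborel (Pair t -` S)"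

lemma slice_area_nonneg [simp]: "0 \<le> slice_area S t" by (simp add: slice_area_def)

lemma compact_slice:
  fixes S :: "(real \<times> (real \<times> real)) set"
  assumes "compact S" shows "compact (Pair t -` S)"
proof -
  have "Pair t -` S = snd ` (S \<inter> {x. fst x = t})" by (force simp: image_iff)
  moreover have "compact (S \<inter> {x. fst x = t})"
    using assms by (intro compact_Int_closed closed_Collect_eq continuous_intros)
  ultimately show ?thesis by (simp add: compact_continuous_image continuous_on_snd)
qed

lemma slice_area_emeasure:
  assumes "compact S" shows "ennreal (slice_area S t) = emeasure lborel (Pair t -` S)"
  using compact_emeasure_lborel[OF compact_slice[OF assms]] by (simp add: slice_area_def)

lemma borel_measurable_slice_area:
  assumes "compact S" shows "(\<lambda>t. ennreal (slice_area S t)) \<in> borel_measurable borel"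
proof -
  have "S \<in> sets (lborel \<Otimes>\<^sub>M lborel)" unfolding lborel_prod using assms by (simp add: borel_compact)
  then have "(\<lambda>t. emeasure lborel (Pair t -` S)) \<in> borel_measurable lborel"
    by (rule lborel.measurable_emeasure_Pair)
  then show ?thesis by (simp add: slice_area_emeasure[OF assms])
qed

lemma volume_by_slices:
  assumes "compact S"
  shows "emeasure lborel S = (\<integral>\<^sup>+t. ennreal (slice_area S t) \<partial>lborel)"
proof -
  have "S \<in> sets (lborel \<Otimes>\<^sub>M lborel)" unfolding lborel_prod using assms by (simp add: borel_compact)
  from lborel.emeasure_pair_measure_alt[OF this]
  show ?thesis by (simp add: lborel_prod slice_area_emeasure[OF assms])
qed

text \<open>The cone over a slice with apex $p$ lies in the body, so the slices shrink at most
  linearly towards the height of $p$.\<close>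
lemma slice_area_convex:
  assumes S: "compact S" "convex S" and p: "p \<in> S" and l: "0 \<le> l" "l < 1"
  shows "(1 - l)\<^sup>2 * slice_area S t \<le> slice_area S ((1 - l) * t + l * fst p)"
proof -
  let ?f = "\<lambda>z. l *\<^sub>R snd p + (1 - l) *\<^sub>R z"
  have sub: "?f ` (Pair t -` S) \<subseteq> Pair ((1 - l) * t + l * fst p) -` S"
  proof clarsimp
    fix z1 z2 assume "(t, z1, z2) \<in> S"
    then have "(1 - l) *\<^sub>R (t, z1, z2) + l *\<^sub>R p \<in> S"
      using S p l by (intro convexD) auto
    then show "((1 - l) * t + l * fst p, l *\<^sub>R snd p + ((1 - l) * z1, (1 - l) * z2)) \<in> S"
      by (cases p) (simp add: add.commute)
  qed
  have c: "compact (?f ` (Pair t -` S))"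
    using compact_slice[OF S(1)] by (intro compact_continuous_image continuous_intros)
  have "(1 - l)\<^sup>2 * slice_area S t = measure lborel (?f ` (Pair t -` S))"
    using l by (subst measure_compact_affine_image[OF compact_slice[OF S(1)]]) (simp_all add: slice_area_def power2_eq_square)
  also have "\<dots> \<le> slice_area S ((1 - l) * t + l * fst p)"
    unfolding slice_area_def by (rule compact_measure_mono[OF sub c compact_slice[OF S(1)]])
  finally show ?thesis .
qed

text \<open>All slices at heights near $h$ are contained in one compact shadow of a thin slab, and
  these shadows decrease to the slice at height $h$. At an extremal height, which is that of a facet
  below, the slice area can drop to $0$ on one side, so continuity fails there and this estimate
  takes its place.\<close>
lemma slice_area_upper_semicontinuous:
  assumes S: "compact S" and e: "e > 0"
  obtains d where "d > 0" "\<And>t. \<bar>t - h\<bar> < d \<Longrightarrow> slice_area S t \<le> slice_area S h + e"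
proof -
  define B where "B n = snd ` (S \<inter> {x. h - 1 / real (Suc n) \<le> fst x \<and> fst x \<le> h + 1 / real (Suc n)})" for n
  have cB: "compact (B n)" for n unfolding B_def
    using S by (intro compact_continuous_image compact_Int_closed continuous_intros closed_Collect_conj closed_Collect_le)
  have dec: "decseq B"
  proof (rule decseq_SucI)
    fix n
    have "1 / real (Suc (Suc n)) \<le> 1 / real (Suc n)" by (intro divide_left_mono) auto
    then show "B (Suc n) \<subseteq> B n" unfolding B_def by (intro image_mono Int_mono) auto
  qed
  have INT: "(\<Inter>n. B n) = Pair h -` S"
  proof (intro antisym subsetI)
    fix z assume z: "z \<in> (\<Inter>n. B n)"
    have "\<exists>t. (t, z) \<in> S \<and> \<bar>t - h\<bar> \<le> 1 / real (Suc n)" for n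
    proof -
      from z have "z \<in> B n" by auto
      then obtain x where x: "x \<in> S" "h - 1 / real (Suc n) \<le> fst x" "fst x \<le> h + 1 / real (Suc n)" "snd x = z"
        unfolding B_def by auto
      then show ?thesis by (intro exI[of _ "fst x"]) (auto simp: abs_le_iff)
    qed
    then obtain t where t: "\<And>n. (t n, z) \<in> S" "\<And>n. \<bar>t n - h\<bar> \<le> 1 / real (Suc n)" by metis
    have "\<forall>n. norm (t n - h) \<le> inverse (real (Suc n))" using t(2) by (simp only: real_norm_def inverse_eq_divide) simp
    then have "(\<lambda>n. t n - h) \<longlonglongrightarrow> 0"
      by (rule Lim_null_comparison[OF always_eventually LIMSEQ_inverse_real_of_nat])
    then have "t \<longlonglongrightarrow> h" by (simp add: LIM_zero_iff)
    then have "(\<lambda>n. (t n, z)) \<longlonglongrightarrow> (h, z)" by (intro tendsto_Pair tendsto_const)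
    then have "(h, z) \<in> S"
      by (rule closed_sequentially[OF compact_imp_closed[OF S], rotated]) (rule t(1))
    then show "z \<in> Pair h -` S" by simp
  next
    fix z assume "z \<in> Pair h -` S"
    then show "z \<in> (\<Inter>n. B n)" unfolding B_def by (auto simp: image_iff intro!: bexI[of _ "(h, z)"])
  qed
  have "(\<lambda>n. measure lborel (B n)) \<longlonglongrightarrow> measure lborel (\<Inter>n. B n)"
    by (rule Lim_measure_decseq) (use cB dec in \<open>auto simp: borel_compact compact_emeasure_lborel\<close>)
  then have "(\<lambda>n. measure lborel (B n)) \<longlonglongrightarrow> slice_area S h" by (simp only: INT slice_area_def)
  then have "eventually (\<lambda>n. measure lborel (B n) < slice_area S h + e) sequentially"
    using e by (intro order_tendstoD(2)) auto
  then obtain n where n: "measure lborel (B n) < slice_area S h + e" by (auto simp: eventually_sequentially)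
  show thesis
  proof
    show "0 < 1 / real (Suc n)" by simp
    fix t assume t: "\<bar>t - h\<bar> < 1 / real (Suc n)"
    have "Pair t -` S \<subseteq> B n" unfolding B_def using t by (force simp: image_iff)
    then have "slice_area S t \<le> measure lborel (B n)"
      unfolding slice_area_def by (rule compact_measure_mono[OF _ compact_slice[OF S] cB])
    then show "slice_area S t \<le> slice_area S h + e" using n by simp
  qed
qed

lemma volume_le_height_times_area:
  assumes S: "compact S" "\<And>x. x \<in> S \<Longrightarrow> \<alpha> \<le> fst x \<and> fst x \<le> \<beta>" and ab: "\<alpha> \<le> \<beta>"
    and B: "\<And>t. \<alpha> \<le> t \<Longrightarrow> t \<le> \<beta> \<Longrightarrow> slice_area S t \<le> B"
  shows "measure lborel S \<le> (\<beta> - \<alpha>) * B"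
proof -
  have B0: "0 \<le> B" using B[of \<alpha>] ab slice_area_nonneg[of S \<alpha>] by linarith
  have z: "slice_area S t = 0" if "t \<notin> {\<alpha>..\<beta>}" for t
  proof -
    have "Pair t -` S = {}" using S(2) that by fastforce
    then show ?thesis by (simp add: slice_area_def)
  qed
  have "ennreal (measure lborel S) = (\<integral>\<^sup>+t. ennreal (slice_area S t) \<partial>lborel)"
    using volume_by_slices[OF S(1)] compact_emeasure_lborel[OF S(1)] by simp
  also have "\<dots> \<le> (\<integral>\<^sup>+t. ennreal B * indicator {\<alpha>..\<beta>} t \<partial>lborel)"
    using B z by (intro nn_integral_mono) (auto simp: indicator_def intro!: ennreal_leI)
  also have "\<dots> = ennreal ((\<beta> - \<alpha>) * B)"
    using ab B0 by (simp add: nn_integral_cmult ennreal_mult mult.commute)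
  finally show ?thesis using ab B0 by simp
qed

lemma height_times_area_le_volume:
  assumes S: "compact S" and ab: "\<alpha> \<le> \<beta>" and B0: "0 \<le> B"
    and B: "\<And>t. \<alpha> < t \<Longrightarrow> t < \<beta> \<Longrightarrow> B \<le> slice_area S t"
  shows "(\<beta> - \<alpha>) * B \<le> measure lborel S"
proof -
  have "ennreal ((\<beta> - \<alpha>) * B) = (\<integral>\<^sup>+t. ennreal B * indicator {\<alpha><..<\<beta>} t \<partial>lborel)"
    using ab B0 by (simp add: nn_integral_cmult ennreal_mult mult.commute)
  also have "\<dots> \<le> (\<integral>\<^sup>+t. ennreal (slice_area S t) \<partial>lborel)"
    using B by (intro nn_integral_mono) (auto simp: indicator_def intro!: ennreal_leI)
  also have "\<dots> = ennreal (measure lborel S)"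
    using volume_by_slices[OF S(1)] compact_emeasure_lborel[OF S(1)] by simp
  finally show ?thesis by simp
qed

lemma cone_volume_ge:
  assumes S: "compact S" and h: "h > 0"
    and star: "\<And>x l. x \<in> S \<Longrightarrow> fst x = h \<Longrightarrow> 0 \<le> l \<Longrightarrow> l \<le> 1 \<Longrightarrow> l *\<^sub>R x \<in> S"
  shows "h * slice_area S h / 3 \<le> measure lborel S"
proof -
  define A where "A = slice_area S h"
  have A0: "A \<ge> 0" by (simp add: A_def)
  have ge: "(t / h)\<^sup>2 * A \<le> slice_area S t" if t: "0 < t" "t \<le> h" for t
  proof -
    let ?f = "\<lambda>z. (0 :: real \<times> real) + (t / h) *\<^sub>R z"
    have sub: "?f ` (Pair h -` S) \<subseteq> Pair t -` S"
    proof clarsimp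
      fix a b assume "(h, a, b) \<in> S"
      from star[OF this, of "t / h"] show "(t, t * a / h, t * b / h) \<in> S" using t h by simp
    qed
    have c: "compact (?f ` (Pair h -` S))"
      using compact_slice[OF S(1)] by (intro compact_continuous_image continuous_intros)
    have "(t / h)\<^sup>2 * A = measure lborel (?f ` (Pair h -` S))"
      using t h by (subst measure_compact_affine_image[OF compact_slice[OF S(1)]]) (simp_all add: slice_area_def A_def power2_eq_square)
    also have "\<dots> \<le> slice_area S t"
      unfolding slice_area_def by (rule compact_measure_mono[OF sub c compact_slice[OF S(1)]])
    finally show ?thesis .
  qed
  have "(\<integral>\<^sup>+t. ennreal ((t / h)\<^sup>2 * A) * indicator {0..h} t \<partial>lborel) = ennreal (h * A / 3 - 0)"
  proof (rule nn_integral_FTC_Icc[where F = "\<lambda>t. t^3 / (3 * h^2) * A", THEN trans])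
    show "((\<lambda>t. t^3 / (3 * h^2) * A) has_real_derivative (t / h)\<^sup>2 * A) (at t)" for t
      using h by (auto intro!: derivative_eq_intros simp: power2_eq_square field_simps)
  qed (use h A0 in \<open>auto simp: power2_eq_square power3_eq_cube\<close>)
  then have "ennreal (h * A / 3) = (\<integral>\<^sup>+t. ennreal ((t / h)\<^sup>2 * A) * indicator {0..h} t \<partial>lborel)" by simp
  also have "\<dots> \<le> (\<integral>\<^sup>+t. ennreal (slice_area S t) \<partial>lborel)"
  proof (intro nn_integral_mono)
    fix t :: real
    show "ennreal ((t / h)\<^sup>2 * A) * indicator {0..h} t \<le> ennreal (slice_area S t)"
      using ge[of t] by (cases "0 < t \<and> t \<le> h"; cases "t = 0") (auto simp: indicator_def intro!: ennreal_leI)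
  qed
  also have "\<dots> = ennreal (measure lborel S)"
    using volume_by_slices[OF S(1)] compact_emeasure_lborel[OF S(1)] by simp
  finally show ?thesis by (simp add: A_def)
qed

section \<open>Minkowski's first inequality\<close>

lemma frame_vimage_compact:
  assumes \<phi>: "adapted_frame u \<phi>" and S: "compact S"
  shows "compact (\<phi> -` S)"
proof -
  note f = adapted_frameD[OF \<phi>]
  have "closed (\<phi> -` S)" using f(7) compact_imp_closed[OF S] by (rule closed_vimage[rotated])
  moreover have "bounded (\<phi> -` S)"
  proof -
    obtain B where B: "\<And>y. y \<in> S \<Longrightarrow> norm y \<le> B" using compact_imp_bounded[OF S] unfolding bounded_iff by auto
    show ?thesis unfolding bounded_iff
    proof (intro exI ballI)
      fix x assume "x \<in> \<phi> -` S"
      then show "norm x \<le> B" using B[of "\<phi> x"] f(3)[of x] by simp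
    qed
  qed
  ultimately show ?thesis by (simp add: compact_eq_bounded_closed)
qed

lemma measure_frame:
  assumes "adapted_frame u \<phi>" "compact S"
  shows "measure lborel (\<phi> -` S) = measure lborel S"
  using emeasure_frame[OF assms(1), of S] assms(2) by (simp add: measure_def borel_compact)

lemma slab_volume_le:
  assumes \<phi>: "adapted_frame u \<phi>" and T: "compact T" "T \<subseteq> {y. \<alpha> \<le> u \<bullet> y \<and> u \<bullet> y \<le> \<beta>}" and ab: "\<alpha> \<le> \<beta>"
    and B: "\<And>t. \<alpha> \<le> t \<Longrightarrow> t \<le> \<beta> \<Longrightarrow> slice_area (\<phi> -` T) t \<le> B"
  shows "measure lborel T \<le> (\<beta> - \<alpha>) * B"
proof -
  have "measure lborel (\<phi> -` T) \<le> (\<beta> - \<alpha>) * B"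
  proof (rule volume_le_height_times_area[OF frame_vimage_compact[OF \<phi> T(1)] _ ab B])
    fix x assume "x \<in> \<phi> -` T"
    then have "\<phi> x \<in> {y. \<alpha> \<le> u \<bullet> y \<and> u \<bullet> y \<le> \<beta>}" using T(2) by auto
    then show "\<alpha> \<le> fst x \<and> fst x \<le> \<beta>" using adapted_frameD(4)[OF \<phi>] by simp
  qed
  then show ?thesis by (simp add: measure_frame[OF \<phi> T(1)])
qed

definition midset :: "'a::real_vector set \<Rightarrow> 'a set \<Rightarrow> 'a set" where
  "midset A B = (\<lambda>(a, b). (1/2) *\<^sub>R (a + b)) ` (A \<times> B)"

lemma midset_iff: "z \<in> midset A B \<longleftrightarrow> (\<exists>a\<in>A. \<exists>b\<in>B. z = (1/2) *\<^sub>R (a + b))"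
  by (auto simp: midset_def)

lemma compact_midset:
  fixes A B :: "'a::euclidean_space set"
  assumes "compact A" "compact B" shows "compact (midset A B)"
  unfolding midset_def case_prod_unfold
  using assms by (intro compact_continuous_image compact_Times continuous_intros)

lemma midpoint_prekopa_leindler_triple: "midpoint_prekopa_leindler TYPE(real \<times> (real \<times> real))"
  by (intro midpoint_prekopa_leindler_prod midpoint_prekopa_leindler_real)

lemma brunn_minkowski_compact:
  fixes A B C :: "'a::euclidean_space set"
  assumes PL: "midpoint_prekopa_leindler TYPE('a)"
    and c: "compact A" "compact B" "compact C" and sub: "midset A B \<subseteq> C"
  shows "measure lborel A * measure lborel B \<le> (measure lborel C)\<^sup>2"
proof -
  have "emeasure lborel A * emeasure lborel B \<le> (emeasure lborel C)\<^sup>2"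
  proof (rule brunn_minkowski_midpoint[OF PL])
    fix x y assume "x \<in> A" "y \<in> B"
    then have "(1/2) *\<^sub>R (x + y) \<in> midset A B" unfolding midset_iff by blast
    then show "(1/2) *\<^sub>R (x + y) \<in> C" using sub by blast
  qed (use c in \<open>simp_all add: borel_compact\<close>)
  then have "ennreal (measure lborel A * measure lborel B) \<le> ennreal ((measure lborel C)\<^sup>2)"
    unfolding compact_emeasure_lborel[OF c(1)] compact_emeasure_lborel[OF c(2)] compact_emeasure_lborel[OF c(3)]
    by (simp only: ennreal_mult[symmetric] ennreal_power measure_nonneg)
  then show ?thesis by (simp only: ennreal_le_iff zero_le_power2)
qed

lemma midset_frame:
  assumes \<phi>: "adapted_frame u \<phi>"
  shows "midset (\<phi> -` A) (\<phi> -` B) \<subseteq> \<phi> -` midset A B"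
proof
  fix z assume "z \<in> midset (\<phi> -` A) (\<phi> -` B)"
  then obtain a b where ab: "\<phi> a \<in> A" "\<phi> b \<in> B" "z = (1/2) *\<^sub>R (a + b)" by (auto simp: midset_iff)
  have "\<phi> z = (1/2) *\<^sub>R (\<phi> a + \<phi> b)"
    unfolding ab(3) by (simp only: linear_scale[OF adapted_frameD(1)[OF \<phi>]] linear_add[OF adapted_frameD(1)[OF \<phi>]])
  then show "z \<in> \<phi> -` midset A B" using ab by (auto simp: midset_iff)
qed

lemma brunn_minkowski_real3:
  fixes A B :: "(real^3) set"
  assumes c: "compact A" "compact B"
  shows "measure lborel A * measure lborel B \<le> (measure lborel (midset A B))\<^sup>2"
proof -
  have "norm (axis 1 1 :: real^3) = 1" by (simp add: norm_axis_1)
  then obtain \<phi> where \<phi>: "adapted_frame (axis 1 1) \<phi>" by (rule adapted_frame_exists)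
  have "measure lborel (\<phi> -` A) * measure lborel (\<phi> -` B) \<le> (measure lborel (\<phi> -` midset A B))\<^sup>2"
    by (rule brunn_minkowski_compact[OF midpoint_prekopa_leindler_triple])
       (intro frame_vimage_compact[OF \<phi>] c compact_midset midset_frame[OF \<phi>])+
  then show ?thesis
    by (simp only: measure_frame[OF \<phi> c(1)] measure_frame[OF \<phi> c(2)] measure_frame[OF \<phi> compact_midset[OF c]])
qed

definition wulff :: "'a::real_inner set \<Rightarrow> ('a \<Rightarrow> real) \<Rightarrow> 'a set" where
  "wulff X h = {y. \<forall>x\<in>X. x \<bullet> y \<le> h x}"

lemma closed_wulff: "closed (wulff X h)"
proof -
  have "wulff X h = (\<Inter>x\<in>X. {y. x \<bullet> y \<le> h x})" by (auto simp: wulff_def)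
  then show ?thesis by (simp add: closed_INT closed_halfspace_le)
qed

lemma wulff_scale:
  assumes "c > 0"
  shows "wulff X (\<lambda>x. c * h x) = (*\<^sub>R) c ` wulff X h"
proof (intro antisym subsetI)
  fix y assume y: "y \<in> wulff X (\<lambda>x. c * h x)"
  have "(1 / c) *\<^sub>R y \<in> wulff X h"
    using y assms by (auto simp: wulff_def field_simps)
  moreover have "y = c *\<^sub>R ((1 / c) *\<^sub>R y)" using assms by simp
  ultimately show "y \<in> (*\<^sub>R) c ` wulff X h" by (rule rev_image_eqI)
qed (use assms in \<open>auto simp: wulff_def\<close>)

lemma measure_compact_scale:
  fixes S :: "'a::euclidean_space set"
  assumes "compact S" "c > 0"
  shows "measure lborel ((*\<^sub>R) c ` S) = c ^ DIM('a) * measure lborel S"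
  using measure_compact_affine_image[OF assms(1), of c 0] assms(2) by simp

text \<open>A polytope with the origin in its interior. The normals are $X$, the distances of the
  facet planes from the origin are $h$, and the facet with normal $x$ has area $A(x)$, measured in
  the frame $\Phi(x)$.\<close>
context
  fixes X :: "(real^3) set" and h A :: "real^3 \<Rightarrow> real" and \<Phi> :: "real^3 \<Rightarrow> real \<times> (real \<times> real) \<Rightarrow> real^3"
  assumes finX: "finite X" and unit: "\<And>x. x \<in> X \<Longrightarrow> norm x = 1"
    and frame: "\<And>x. x \<in> X \<Longrightarrow> adapted_frame x (\<Phi> x)"
    and hpos: "\<And>x. x \<in> X \<Longrightarrow> 0 < h x"
    and comp: "compact (wulff X h)"
    and face: "\<And>x. x \<in> X \<Longrightarrow> slice_area (\<Phi> x -` wulff X h) (h x) = A x"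
begin

text \<open>When the facet planes move outwards by $s\,m$, the part added in front of a facet lies
  in a slab of thickness $s\,m(x)$ of a slightly enlarged copy of the body, and the slices of that
  copy near the facet have area at most about that of the facet.\<close>
lemma face_cap_volume:
  assumes x: "x \<in> X" and s: "0 < s" "0 \<le> m" "m \<le> C * h x" "0 \<le> C"
    and d: "h x * C * s < d" "\<And>t. \<bar>t - h x\<bar> < d \<Longrightarrow> slice_area (\<Phi> x -` wulff X h) t \<le> B" "0 \<le> B"
  shows "measure lborel ((*\<^sub>R) (1 + C * s) ` wulff X h \<inter> {y. h x \<le> x \<bullet> y \<and> x \<bullet> y \<le> h x + s * m})
      \<le> s * m * ((1 + C * s)\<^sup>2 * B)" (is "measure _ ?T \<le> _")
proof -
  let ?P = "wulff X h" and ?r = "1 + C * s"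
  have r: "?r \<ge> 1" using s by simp
  note lin = adapted_frameD(1)[OF frame[OF x]]
  have cT: "compact ?T"
    by (intro compact_Int_closed compact_scaling comp closed_Collect_conj closed_Collect_le continuous_intros)
  have sub: "?T \<subseteq> {y. h x \<le> x \<bullet> y \<and> x \<bullet> y \<le> h x + s * m}" by blast
  have "measure lborel ?T \<le> (h x + s * m - h x) * (?r\<^sup>2 * B)"
  proof (rule slab_volume_le[OF frame[OF x] cT sub])
    show "h x \<le> h x + s * m" using s by simp
    fix t assume t: "h x \<le> t" "t \<le> h x + s * m"
    have cS: "compact (\<Phi> x -` ?P)" by (rule frame_vimage_compact[OF frame[OF x] comp])
    let ?f = "\<lambda>z. (0 :: real \<times> real) + ?r *\<^sub>R z"
    have "Pair t -` (\<Phi> x -` ?T) \<subseteq> ?f ` (Pair (t / ?r) -` (\<Phi> x -` ?P))"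
    proof
      fix z assume "z \<in> Pair t -` (\<Phi> x -` ?T)"
      then obtain p where p: "p \<in> ?P" "\<Phi> x (t, z) = ?r *\<^sub>R p" by auto
      have "\<Phi> x (t / ?r, (1 / ?r) *\<^sub>R z) = \<Phi> x ((1 / ?r) *\<^sub>R (t, z))" by simp
      also have "\<dots> = (1 / ?r) *\<^sub>R \<Phi> x (t, z)" by (rule linear_scale[OF lin])
      also have "\<dots> = p" using p(2) r by simp
      finally have "(1 / ?r) *\<^sub>R z \<in> Pair (t / ?r) -` (\<Phi> x -` ?P)" using p(1) by simp
      moreover have "z = ?f ((1 / ?r) *\<^sub>R z)" using r by simp
      ultimately show "z \<in> ?f ` (Pair (t / ?r) -` (\<Phi> x -` ?P))" by (rule rev_image_eqI)
    qed
    then have "slice_area (\<Phi> x -` ?T) t \<le> measure lborel (?f ` (Pair (t / ?r) -` (\<Phi> x -` ?P)))"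
      unfolding slice_area_def
      by (rule compact_measure_mono)
        (intro compact_slice frame_vimage_compact[OF frame[OF x]] cT cS compact_continuous_image continuous_intros)+
    also have "\<dots> = ?r\<^sup>2 * slice_area (\<Phi> x -` ?P) (t / ?r)"
      using r by (subst measure_compact_affine_image[OF compact_slice[OF cS]]) (simp_all add: slice_area_def power2_eq_square)
    also have "\<dots> \<le> ?r\<^sup>2 * B"
    proof (rule mult_left_mono[OF d(2)])
      have "t \<le> h x * ?r"
      proof -
        have "s * m \<le> s * (C * h x)" using s by (intro mult_left_mono) auto
        then show ?thesis using t by (simp add: algebra_simps)
      qed
      then have up: "t / ?r \<le> h x" using r by (simp add: pos_divide_le_eq)
      have "h x \<le> t" by fact
      have "(h x - h x * C * s) * ?r = h x - h x * (C * s) * (C * s)" by (simp add: algebra_simps)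
      also have "\<dots> \<le> t" using t(1) hpos[OF x] s by (smt (verit) mult_nonneg_nonneg)
      finally have "h x - h x * C * s \<le> t / ?r" using r by (simp add: pos_le_divide_eq)
      then show "\<bar>t / ?r - h x\<bar> < d" using up d(1) by linarith
    qed simp
    finally show "slice_area (\<Phi> x -` ?T) t \<le> ?r\<^sup>2 * B" .
  qed
  then show ?thesis by simp
qed

lemma wulff_perturbation_subset:
  assumes m: "\<And>x. x \<in> X \<Longrightarrow> 0 \<le> m x"
  obtains C where "0 \<le> C" "\<And>x. x \<in> X \<Longrightarrow> m x \<le> C * h x"
    "\<And>s. 0 \<le> s \<Longrightarrow> wulff X (\<lambda>x. h x + s * m x) \<subseteq> (*\<^sub>R) (1 + C * s) ` wulff X h"
proof
  define C where "C = (\<Sum>x\<in>X. m x / h x)"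
  show C: "0 \<le> C" unfolding C_def using m hpos by (intro sum_nonneg) (simp add: less_imp_le)
  show mC: "m x \<le> C * h x" if "x \<in> X" for x
  proof -
    have "m x / h x \<le> C" unfolding C_def using that finX m hpos
      by (intro member_le_sum) (auto simp: less_imp_le)
    then show ?thesis using hpos[OF that] by (simp add: pos_divide_le_eq)
  qed
  show "wulff X (\<lambda>x. h x + s * m x) \<subseteq> (*\<^sub>R) (1 + C * s) ` wulff X h" if s: "0 \<le> s" for s
  proof -
    have "0 < 1 + C * s" using C s by (simp add: add_pos_nonneg)
    then show ?thesis unfolding wulff_scale[OF \<open>0 < 1 + C * s\<close>, symmetric]
    proof (intro subsetI)
      fix y assume y: "y \<in> wulff X (\<lambda>x. h x + s * m x)"
      have "x \<bullet> y \<le> (1 + C * s) * h x" if x: "x \<in> X" for x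
      proof -
        have "s * m x \<le> s * (C * h x)" using mC[OF x] s by (intro mult_left_mono) auto
        then show ?thesis using y x by (auto simp: wulff_def algebra_simps)
      qed
      then show "y \<in> wulff X (\<lambda>x. (1 + C * s) * h x)" by (simp add: wulff_def)
    qed
  qed
qed

lemma compact_wulff_perturbation:
  assumes m: "\<And>x. x \<in> X \<Longrightarrow> 0 \<le> m x" and s: "0 \<le> s"
  shows "compact (wulff X (\<lambda>x. h x + s * m x))"
proof -
  obtain C where "wulff X (\<lambda>x. h x + s * m x) \<subseteq> (*\<^sub>R) (1 + C * s) ` wulff X h"
  proof (rule wulff_perturbation_subset[of m])
    show "0 \<le> m x" if "x \<in> X" for x using m[OF that] .
    fix C assume "\<And>s. 0 \<le> s \<Longrightarrow> wulff X (\<lambda>x. h x + s * m x) \<subseteq> (*\<^sub>R) (1 + C * s) ` wulff X h"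
    from that[OF this[OF s]] show thesis .
  qed
  then have "bounded (wulff X (\<lambda>x. h x + s * m x))"
    by (rule bounded_subset[OF compact_imp_bounded[OF compact_scaling[OF comp]]])
  then show ?thesis using closed_wulff by (simp add: compact_eq_bounded_closed)
qed

text \<open>The first-order upper bound for the volume under a change of the support numbers: the
  enlarged body is covered by the original one and by the slabs in front of the facets.\<close>
lemma wulff_perturbation:
  assumes m: "\<And>x. x \<in> X \<Longrightarrow> 0 \<le> m x" and e: "e > 0"
  shows "\<forall>\<^sub>F s in at_right 0. measure lborel (wulff X (\<lambda>x. h x + s * m x))
     \<le> measure lborel (wulff X h) + s * ((\<Sum>x\<in>X. A x * m x) + e)"
proof -
  let ?P = "wulff X h"
  obtain C where C: "0 \<le> C" and mC: "\<And>x. x \<in> X \<Longrightarrow> m x \<le> C * h x"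
    and Wsub: "\<And>s. 0 \<le> s \<Longrightarrow> wulff X (\<lambda>x. h x + s * m x) \<subseteq> (*\<^sub>R) (1 + C * s) ` ?P"
  proof (rule wulff_perturbation_subset[of m])
    show "0 \<le> m x" if "x \<in> X" for x using m[OF that] .
    fix C assume "0 \<le> C" "\<And>x. x \<in> X \<Longrightarrow> m x \<le> C * h x"
      "\<And>s. 0 \<le> s \<Longrightarrow> wulff X (\<lambda>x. h x + s * m x) \<subseteq> (*\<^sub>R) (1 + C * s) ` ?P"
    from that[OF this] show thesis .
  qed
  define M where "M = (\<Sum>x\<in>X. m x)"
  have M: "0 \<le> M" unfolding M_def using m by (rule sum_nonneg)
  \<comment> \<open>Allowing each facet the additional area e1 costs at most M e1 < e in total; the
    summand 1 avoids a division by zero.\<close>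
  define e1 where "e1 = e / (2 * (M + 1))"
  have e1: "e1 > 0" using e M by (simp add: e1_def)
  have A0: "0 \<le> A x" if "x \<in> X" for x using face[OF that] slice_area_nonneg by metis
  have "\<exists>d>0. \<forall>t. \<bar>t - h x\<bar> < d \<longrightarrow> slice_area (\<Phi> x -` ?P) t \<le> A x + e1" if x: "x \<in> X" for x
  proof -
    obtain d where "d > 0" "\<And>t. \<bar>t - h x\<bar> < d \<Longrightarrow> slice_area (\<Phi> x -` ?P) t \<le> slice_area (\<Phi> x -` ?P) (h x) + e1"
      using slice_area_upper_semicontinuous[OF frame_vimage_compact[OF frame[OF x] comp] e1, of "h x"] by metis
    then show ?thesis using face[OF x] by auto
  qed
  then obtain d where d: "\<And>x. x \<in> X \<Longrightarrow> d x > 0"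
    "\<And>x t. x \<in> X \<Longrightarrow> \<bar>t - h x\<bar> < d x \<Longrightarrow> slice_area (\<Phi> x -` ?P) t \<le> A x + e1" by metis
  have "\<forall>\<^sub>F s in at_right 0. \<forall>x\<in>X. h x * C * s < d x"
  proof (rule eventually_ball_finite[OF finX], rule)
    fix x assume x: "x \<in> X"
    have "((\<lambda>s. h x * C * s) \<longlongrightarrow> h x * C * 0) (at_right 0)" by (intro tendsto_intros)
    then show "\<forall>\<^sub>F s in at_right 0. h x * C * s < d x" using d(1)[OF x] by (intro order_tendstoD(2)) auto
  qed
  moreover
  let ?S = "\<Sum>x\<in>X. m x * (A x + e1)"
  have Slt: "?S < (\<Sum>x\<in>X. A x * m x) + e"
  proof -
    have "?S = (\<Sum>x\<in>X. A x * m x) + M * e1"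
      by (simp add: M_def distrib_left sum.distrib sum_distrib_left mult.commute)
    moreover have "M * e1 < e"
    proof -
      have "M * e1 \<le> (M + 1) * e1" using e1 by simp
      also have "\<dots> = e / 2" using M by (simp add: e1_def divide_simps)
      finally show ?thesis using e by simp
    qed
    ultimately show ?thesis by simp
  qed
  have "\<forall>\<^sub>F s in at_right 0. (1 + C * s)\<^sup>2 * ?S < (\<Sum>x\<in>X. A x * m x) + e"
  proof -
    have "((\<lambda>s. (1 + C * s)\<^sup>2 * ?S) \<longlongrightarrow> (1 + C * 0)\<^sup>2 * ?S) (at_right 0)" by (intro tendsto_intros)
    then show ?thesis using Slt by (intro order_tendstoD(2)) auto
  qed
  moreover have "\<forall>\<^sub>F s in at_right 0. 0 < (s::real)" by (rule eventually_at_right_less)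
  ultimately show ?thesis
  proof eventually_elim
    case (elim s)
    then have s: "0 < s" and ds: "\<And>x. x \<in> X \<Longrightarrow> h x * C * s < d x" and S: "(1 + C * s)\<^sup>2 * ?S < (\<Sum>x\<in>X. A x * m x) + e"
      by auto
    let ?r = "1 + C * s"
    let ?W = "wulff X (\<lambda>x. h x + s * m x)"
    let ?T = "\<lambda>x. (*\<^sub>R) ?r ` ?P \<inter> {y. h x \<le> x \<bullet> y \<and> x \<bullet> y \<le> h x + s * m x}"
    have r: "?r > 0" using C s by (smt (verit) mult_nonneg_nonneg)
    have Wr: "?W \<subseteq> (*\<^sub>R) ?r ` ?P" using Wsub s by simp
    have cW: "compact ?W" using compact_wulff_perturbation[OF m] s by simp
    have cT: "compact (?T x)" for x
      by (intro compact_Int_closed compact_scaling comp closed_Collect_conj closed_Collect_le continuous_intros)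
    have cU: "compact (\<Union>x\<in>X. ?T x)" using finX cT by (intro compact_UN) auto
    have "?W \<subseteq> ?P \<union> (\<Union>x\<in>X. ?T x)"
    proof
      fix y assume y: "y \<in> ?W"
      show "y \<in> ?P \<union> (\<Union>x\<in>X. ?T x)"
      proof (cases "y \<in> ?P")
        case False
        then obtain x where x: "x \<in> X" "h x \<le> x \<bullet> y" by (force simp: wulff_def)
        moreover have "x \<bullet> y \<le> h x + s * m x" using y x by (simp add: wulff_def)
        ultimately show ?thesis using y Wr by auto
      qed simp
    qed
    then have "measure lborel ?W \<le> measure lborel (?P \<union> (\<Union>x\<in>X. ?T x))"
      by (rule compact_measure_mono[OF _ cW compact_Un[OF comp cU]])
    also have "\<dots> \<le> measure lborel ?P + measure lborel (\<Union>x\<in>X. ?T x)"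
      by (rule measure_Un_le) (simp_all only: sets_lborel borel_compact[OF comp] borel_compact[OF cU])
    also have "measure lborel (\<Union>x\<in>X. ?T x) \<le> (\<Sum>x\<in>X. measure lborel (?T x))"
      by (rule measure_UNION_le[OF finX]) (simp only: sets_lborel borel_compact[OF cT])
    also have "\<dots> \<le> (\<Sum>x\<in>X. s * m x * (?r\<^sup>2 * (A x + e1)))"
    proof (rule sum_mono)
      fix x assume x: "x \<in> X"
      show "measure lborel (?T x) \<le> s * m x * (?r\<^sup>2 * (A x + e1))"
        by (rule face_cap_volume[OF x s m[OF x] mC[OF x] C ds[OF x] d(2)[OF x]]) (use A0[OF x] e1 in simp_all)
    qed
    also have "\<dots> = s * (?r\<^sup>2 * ?S)" by (simp add: sum_distrib_left mult_ac)
    also have "\<dots> \<le> s * ((\<Sum>x\<in>X. A x * m x) + e)" using S s by (intro mult_left_mono) auto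
    finally show ?case by simp
  qed
qed

text \<open>The cones over the facets with apex at the origin overlap in null sets, since a common
  point lies on a plane through the origin determined by two distinct normals.\<close>
lemma volume_ge_cones: "(\<Sum>x\<in>X. A x * h x) \<le> 3 * measure lborel (wulff X h)"
proof -
  let ?P = "wulff X h"
  define cone where "cone x = (\<lambda>(l, y). l *\<^sub>R y) ` ({0..1::real} \<times> (?P \<inter> {y. x \<bullet> y = h x}))" for x
  have memI: "l *\<^sub>R y \<in> cone x" if "0 \<le> l" "l \<le> 1" "y \<in> ?P" "x \<bullet> y = h x" for l y x
    unfolding cone_def using that by (intro image_eqI[where x="(l, y)"]) auto
  have memE: "\<exists>l y. z = l *\<^sub>R y \<and> 0 \<le> l \<and> l \<le> 1 \<and> y \<in> ?P \<and> x \<bullet> y = h x" if z: "z \<in> cone x" for z x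
  proof -
    obtain p where "p \<in> {0..1::real} \<times> (?P \<inter> {y. x \<bullet> y = h x})" "z = fst p *\<^sub>R snd p"
      using z unfolding cone_def case_prod_unfold by (elim imageE)
    then show ?thesis by (intro exI[of _ "fst p"] exI[of _ "snd p"]) auto
  qed
  have cc: "compact (cone x)" for x
    unfolding cone_def case_prod_unfold
    by (intro compact_continuous_image compact_Times compact_Int_closed comp compact_Icc closed_Collect_eq continuous_intros)
  have sub: "cone x \<subseteq> ?P" for x
  proof
    fix z assume "z \<in> cone x"
    then obtain l y where z: "z = l *\<^sub>R y" "0 \<le> l" "l \<le> 1" "y \<in> ?P" using memE by blast
    show "z \<in> ?P" unfolding wulff_def
    proof clarify
      fix x' assume x': "x' \<in> X"
      have "l * (x' \<bullet> y) \<le> l * h x'" using z x' by (intro mult_left_mono) (auto simp: wulff_def)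
      also have "\<dots> \<le> h x'" using z hpos[OF x'] by (simp add: mult_left_le_one_le)
      finally show "x' \<bullet> z \<le> h x'" using z(1) by simp
    qed
  qed
  have vol: "h x * A x / 3 \<le> measure lborel (cone x)" if x: "x \<in> X" for x
  proof -
    let ?S = "\<Phi> x -` cone x"
    note f = adapted_frameD[OF frame[OF x]]
    have top: "z \<in> cone x \<longleftrightarrow> z \<in> ?P" if "x \<bullet> z = h x" for z
      using memI[of 1 z x] that sub[of x] by auto
    have "h x * slice_area ?S (h x) / 3 \<le> measure lborel ?S"
    proof (rule cone_volume_ge[OF frame_vimage_compact[OF frame[OF x] cc] hpos[OF x]])
      fix p l assume p: "p \<in> ?S" "fst p = h x" "0 \<le> (l::real)" "l \<le> 1"
      have "\<Phi> x p \<in> ?P" "x \<bullet> \<Phi> x p = h x" using p sub f(4)[of p] by auto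
      then have "l *\<^sub>R \<Phi> x p \<in> cone x" using p by (intro memI) auto
      then show "l *\<^sub>R p \<in> ?S" by (simp add: linear_scale[OF f(1)])
    qed
    moreover have "Pair (h x) -` ?S = Pair (h x) -` (\<Phi> x -` ?P)"
    proof -
      have "x \<bullet> \<Phi> x (h x, z) = h x" for z by (simp add: f(4))
      from top[OF this] show ?thesis by (simp only: set_eq_iff vimage_eq simp_thms)
    qed
    ultimately show ?thesis
      using face[OF x] measure_frame[OF frame[OF x] cc] by (simp add: slice_area_def)
  qed
  have neg: "pairwise (\<lambda>x y. negligible (cone x \<inter> cone y)) X"
  proof (rule pairwiseI)
    fix x y assume xy: "x \<in> X" "y \<in> X" "x \<noteq> y"
    let ?a = "h y *\<^sub>R x - h x *\<^sub>R y"
    have "?a \<noteq> 0"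
    proof
      assume "?a = 0"
      then have eq: "h y *\<^sub>R x = h x *\<^sub>R y" by simp
      then have "norm (h y *\<^sub>R x) = norm (h x *\<^sub>R y)" by simp
      then have "h y = h x" using xy unit hpos[OF xy(1)] hpos[OF xy(2)] by simp
      with eq hpos[OF xy(1)] xy(3) show False by simp
    qed
    have "cone x \<inter> cone y \<subseteq> {z. ?a \<bullet> z = 0}"
    proof
      fix z assume z: "z \<in> cone x \<inter> cone y"
      obtain l v where l: "z = l *\<^sub>R v" "0 \<le> l" "v \<in> ?P" "x \<bullet> v = h x" using z memE[of z x] by blast
      obtain k w where k: "z = k *\<^sub>R w" "0 \<le> k" "w \<in> ?P" "y \<bullet> w = h y" using z memE[of z y] by blast
      have xz: "x \<bullet> z = l * h x" unfolding l(1) using l(4) by simp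
      have yz: "y \<bullet> z = k * h y" unfolding k(1) using k(4) by simp
      have "y \<bullet> z \<le> l * h y" unfolding l(1) using l(2,3) xy(2) by (simp add: wulff_def mult_left_mono)
      moreover have "x \<bullet> z \<le> k * h x" unfolding k(1) using k(2,3) xy(1) by (simp add: wulff_def mult_left_mono)
      ultimately have "k = l" using xz yz hpos[OF xy(1)] hpos[OF xy(2)] by simp
      then show "z \<in> {z. ?a \<bullet> z = 0}" using xz yz by (simp add: inner_diff_left)
    qed
    then show "negligible (cone x \<inter> cone y)"
      using negligible_hyperplane[of ?a 0] \<open>?a \<noteq> 0\<close> by (meson negligible_subset)
  qed
  have mc: "measure lebesgue S = measure lborel S" if "compact S" for S :: "(real^3) set"
    using that by (simp add: borel_compact)
  have "(\<Sum>x\<in>X. h x * A x / 3) \<le> (\<Sum>x\<in>X. measure lborel (cone x))" using vol by (rule sum_mono)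
  also have "\<dots> = measure lebesgue (\<Union>(cone ` X))"
    by (subst measure_negligible_finite_Union_image[OF finX lmeasurable_compact[OF cc] neg]) (simp add: mc[OF cc])
  also have "\<dots> \<le> measure lebesgue ?P"
  proof (rule measure_mono_fmeasurable)
    show "\<Union>(cone ` X) \<subseteq> ?P" using sub by blast
    show "\<Union>(cone ` X) \<in> sets lebesgue"
      using finX cc by (intro lmeasurable_compact[THEN fmeasurableD] compact_UN) auto
    show "?P \<in> lmeasurable" by (rule lmeasurable_compact[OF comp])
  qed
  also have "\<dots> = measure lborel ?P" by (rule mc[OF comp])
  finally show ?thesis by (simp add: sum_divide_distrib[symmetric] mult.commute)
qed

text \<open>Minkowski's first inequality, with $A$-weighted sums of support numbers in place of
  mixed volumes: if the sum for a body $K$ is at most that for the polytope, then $K$ is not larger.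
  Taking midpoints with the polytope repeatedly gives bodies of weight $s = 2^{-n}$ on $K$. The
  Brunn-Minkowski inequality bounds their logarithmic volume ratio from below by $s$ times that of
  $K$, whereas the first-order expansion of the volume of the surrounding Wulff shape makes the
  ratio $1 + o(s)$.\<close>
lemma volume_le_of_support_le:
  assumes K: "compact K" "K \<subseteq> wulff X m" and m: "\<And>x. x \<in> X \<Longrightarrow> 0 \<le> m x"
    and le: "(\<Sum>x\<in>X. A x * m x) \<le> (\<Sum>x\<in>X. A x * h x)" and V0: "0 < measure lborel (wulff X h)"
  shows "measure lborel K \<le> measure lborel (wulff X h)"
proof (rule ccontr)
  let ?P = "wulff X h"
  assume less: "\<not> measure lborel K \<le> measure lborel ?P"
  define V where "V = measure lborel ?P"
  have V: "0 < V" "V < measure lborel K" using V0 less by (auto simp: V_def)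
  define L where "L = ln (measure lborel K / V)"
  have L: "L > 0" unfolding L_def using V by simp
  define s :: "nat \<Rightarrow> real" where "s n = (1/2) ^ n" for n
  define k where "k n = (midset ?P ^^ n) K" for n
  have k0: "k 0 = K" and kS: "k (Suc n) = midset ?P (k n)" for n by (simp_all add: k_def)
  have ck: "compact (k n)" for n by (induction n) (simp_all add: k0 kS K compact_midset comp)
  have sub: "k n \<subseteq> wulff X (\<lambda>x. (1 - s n) * h x + s n * m x)" for n
  proof (induction n)
    case 0
    then show ?case using K(2) by (simp add: k0 s_def)
  next
    case (Suc n)
    show ?case
    proof
      fix z assume "z \<in> k (Suc n)"
      then obtain a b where ab: "a \<in> ?P" "b \<in> k n" "z = (1/2) *\<^sub>R (a + b)" by (auto simp: kS midset_iff)
      have "x \<bullet> z \<le> (1 - s (Suc n)) * h x + s (Suc n) * m x" if x: "x \<in> X" for x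
      proof -
        have "x \<bullet> a \<le> h x" using ab x by (simp add: wulff_def)
        moreover have "x \<bullet> b \<le> (1 - s n) * h x + s n * m x" using ab(2) Suc x by (auto simp: wulff_def)
        ultimately show ?thesis using ab(3) by (simp add: s_def inner_add_right algebra_simps)
      qed
      then show "z \<in> wulff X (\<lambda>x. (1 - s (Suc n)) * h x + s (Suc n) * m x)" by (simp add: wulff_def)
    qed
  qed
  have low: "measure lborel (k n) > 0 \<and> s n * L \<le> ln (measure lborel (k n) / V)" for n
  proof (induction n)
    case 0
    then show ?case using V by (simp add: k0 s_def L_def)
  next
    case (Suc n)
    let ?a = "measure lborel (k n)" and ?b = "measure lborel (k (Suc n))"
    have bm: "V * ?a \<le> ?b\<^sup>2" unfolding V_def kS by (rule brunn_minkowski_real3[OF comp ck])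
    have a: "?a > 0" using Suc by simp
    have "?b\<^sup>2 > 0" using bm mult_pos_pos[OF V(1) a] by linarith
    then have b: "?b > 0" using measure_nonneg[of lborel "k (Suc n)"] by (simp add: less_le)
    have "?a / V \<le> (?b / V)\<^sup>2" using bm V by (simp add: power_divide power2_eq_square field_simps)
    then have "ln (?a / V) \<le> ln ((?b / V)\<^sup>2)" using a b V by (subst ln_le_cancel_iff) auto
    also have "\<dots> = 2 * ln (?b / V)" using b V by (simp add: ln_realpow)
    finally show ?case using Suc b by (simp add: s_def)
  qed
  have low': "V * (1 + s n * L) \<le> measure lborel (k n)" for n
  proof -
    have "s n * L \<le> ln (measure lborel (k n) / V)" using low by simp
    also have "\<dots> \<le> measure lborel (k n) / V - 1" using low[of n] V by (intro ln_le_minus_one) auto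
    finally have "1 + s n * L \<le> measure lborel (k n) / V" by simp
    then show ?thesis using V by (simp add: pos_le_divide_eq mult.commute)
  qed
  \<comment> \<open>An error below V L contradicts the lower bound obtained from the
    midpoints.\<close>
  define e where "e = V * L / 2"
  have e: "e > 0" using V L by (simp add: e_def)
  have s0: "s \<longlonglongrightarrow> 0" unfolding s_def by (rule LIMSEQ_realpow_zero) auto
  have sp: "s n > 0" for n by (simp add: s_def)
  have lt: "\<forall>\<^sub>F n in sequentially. s n < 1" using s0 by (rule order_tendstoD(2)) simp
  have "((\<lambda>n. s n / (1 - s n)) \<longlongrightarrow> 0 / (1 - 0)) sequentially" by (intro tendsto_intros s0) simp
  moreover have "\<forall>\<^sub>F n in sequentially. s n / (1 - s n) > 0" using lt by eventually_elim (use sp in simp)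
  ultimately have "filterlim (\<lambda>n. s n / (1 - s n)) (at_right 0) sequentially"
    by (intro tendsto_imp_filterlim_at_right) simp_all
  from eventually_compose_filterlim[OF wulff_perturbation[OF m e] this]
  have "\<forall>\<^sub>F n in sequentially. measure lborel (wulff X (\<lambda>x. h x + s n / (1 - s n) * m x))
     \<le> V + s n / (1 - s n) * ((\<Sum>x\<in>X. A x * m x) + e)" by (simp add: V_def)
  with lt have "\<forall>\<^sub>F n in sequentially. False"
  proof eventually_elim
    case (elim n)
    define u where "u = s n"
    have u: "0 < u" "u < 1" using elim(1) sp by (auto simp: u_def)
    have up: "measure lborel (wulff X (\<lambda>x. h x + u / (1 - u) * m x)) \<le> V + u / (1 - u) * ((\<Sum>x\<in>X. A x * m x) + e)"
      using elim(2) by (simp add: u_def)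
    have "(\<Sum>x\<in>X. A x * m x) \<le> 3 * V" using le volume_ge_cones by (simp add: V_def)
    then have up2: "u / (1 - u) * ((\<Sum>x\<in>X. A x * m x) + e) \<le> u / (1 - u) * (3 * V + e)"
      using u by (intro mult_left_mono) auto
    have eq: "(\<lambda>x. (1 - u) * h x + u * m x) = (\<lambda>x. (1 - u) * (h x + u / (1 - u) * m x))"
      using u by (auto simp: fun_eq_iff field_simps)
    have "k n \<subseteq> (*\<^sub>R) (1 - u) ` wulff X (\<lambda>x. h x + u / (1 - u) * m x)"
      using sub[of n] wulff_scale[of "1 - u" X "\<lambda>x. h x + u / (1 - u) * m x"] u unfolding u_def[symmetric] eq by simp
    moreover have cW: "compact (wulff X (\<lambda>x. h x + u / (1 - u) * m x))"
      by (rule compact_wulff_perturbation[OF m]) (use u in auto)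
    ultimately have "measure lborel (k n) \<le> measure lborel ((*\<^sub>R) (1 - u) ` wulff X (\<lambda>x. h x + u / (1 - u) * m x))"
      by (intro compact_measure_mono ck compact_scaling)
    also have "\<dots> = (1 - u) ^ 3 * measure lborel (wulff X (\<lambda>x. h x + u / (1 - u) * m x))"
      using u cW by (subst measure_compact_scale) auto
    also have "\<dots> \<le> (1 - u) ^ 3 * (V + u / (1 - u) * (3 * V + e))"
      using up up2 u by (intro mult_left_mono) auto
    also have "\<dots> = V * (1 - 3 * u\<^sup>2 + 2 * u ^ 3) + u * (1 - u)\<^sup>2 * e"
    proof -
      have "(1 - u) ^ 3 * (V + q * B) = (1 - u)\<^sup>2 * ((1 - u) * V + (1 - u) * q * B)" for q B
        by (simp add: power2_eq_square power3_eq_cube algebra_simps)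
      then have "(1 - u) ^ 3 * (V + u / (1 - u) * (3 * V + e)) = (1 - u)\<^sup>2 * ((1 - u) * V + (1 - u) * (u / (1 - u)) * (3 * V + e))" .
      also have "(1 - u) * (u / (1 - u)) = u" using u by simp
      finally show ?thesis by (simp add: power2_eq_square power3_eq_cube algebra_simps)
    qed
    also have "\<dots> \<le> V * 1 + u * 1 * e"
    proof (intro add_mono mult_left_mono mult_right_mono)
      have "2 * u ^ 3 \<le> 3 * u\<^sup>2" using u by (simp add: power2_eq_square power3_eq_cube)
      then show "1 - 3 * u\<^sup>2 + 2 * u ^ 3 \<le> 1" by simp
      show "(1 - u)\<^sup>2 \<le> 1" using u by (simp add: power_le_one)
    qed (use V e u in auto)
    finally have "measure lborel (k n) \<le> V + u * e" by simp
    with low'[of n] have "V * (u * L) \<le> u * e" by (simp add: u_def algebra_simps)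
    then have "V * L \<le> e" using u by (simp add: mult.left_commute)
    then show False using V L by (simp add: e_def)
  qed
  then show False by simp
qed

end

section \<open>Cutting a convex body by parallel planes\<close>

definition cut_volume :: "(real \<times> (real \<times> real)) set \<Rightarrow> real \<Rightarrow> real" where
  "cut_volume S s = measure lborel (S \<inter> {x. fst x \<le> s})"

lemma compact_cut:
  fixes S :: "(real \<times> (real \<times> real)) set"
  assumes "compact S"
  shows "compact (S \<inter> {x. fst x \<le> s})" "compact (S \<inter> {x. s \<le> fst x})" "compact (S \<inter> {x. r \<le> fst x \<and> fst x \<le> s})"
  using assms by (intro compact_Int_closed closed_Collect_conj closed_Collect_le continuous_intros; assumption)+

lemma volume_cut:
  fixes S :: "(real \<times> (real \<times> real)) set"
  assumes S: "compact S"
  shows "measure lborel S = measure lborel (S \<inter> {x. fst x \<le> s}) + measure lborel (S \<inter> {x. s \<le> fst x})"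
proof -
  let ?L = "S \<inter> {x. fst x \<le> s}" and ?R = "S \<inter> {x. s \<le> fst x}"
  have "measure lborel (?L \<inter> ?R) \<le> (s - s) * slice_area (?L \<inter> ?R) s"
  proof (rule volume_le_height_times_area)
    show "compact (?L \<inter> ?R)" by (rule compact_Int[OF compact_cut(1)[OF S] compact_cut(2)[OF S]])
  qed auto
  then have "measure lborel (?L \<inter> ?R) = 0" using measure_nonneg[of lborel "?L \<inter> ?R"] by simp
  then have "measure lborel (?L \<union> ?R) = measure lborel ?L + measure lborel ?R"
    by (subst measure_Un3) (use compact_cut[OF S] in \<open>auto intro: fmeasurable_compact\<close>)
  moreover have "?L \<union> ?R = S" by auto
  ultimately show ?thesis by simp
qed

lemma slice_area_le_shadow:
  assumes "compact S" shows "slice_area S t \<le> measure lborel (snd ` S)"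
  unfolding slice_area_def
proof (rule compact_measure_mono[OF _ compact_slice[OF assms]])
  show "compact (snd ` S)" using assms by (intro compact_continuous_image continuous_intros)
qed force

lemma slab_slice:
  "slice_area (S \<inter> {x. r \<le> fst x \<and> fst x \<le> s}) t = (if r \<le> t \<and> t \<le> s then slice_area S t else 0)"
  by (auto simp: slice_area_def vimage_def)

lemma cut_volume_diff:
  assumes "compact S" "r \<le> s"
  shows "cut_volume S s - cut_volume S r = measure lborel (S \<inter> {x. r \<le> fst x \<and> fst x \<le> s})"
proof -
  have "S \<inter> {x. fst x \<le> s} \<inter> {x. fst x \<le> r} = S \<inter> {x. fst x \<le> r}"
    "S \<inter> {x. fst x \<le> s} \<inter> {x. r \<le> fst x} = S \<inter> {x. r \<le> fst x \<and> fst x \<le> s}" using assms(2) by auto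
  then show ?thesis
    using volume_cut[OF compact_cut(1)[OF assms(1), of s], of r] by (simp add: cut_volume_def)
qed

lemma cut_volume_diff_le:
  assumes "compact S" "r \<le> s" "\<And>t. r \<le> t \<Longrightarrow> t \<le> s \<Longrightarrow> slice_area S t \<le> B"
  shows "cut_volume S s - cut_volume S r \<le> (s - r) * B"
  unfolding cut_volume_diff[OF assms(1,2)]
  by (rule volume_le_height_times_area[OF compact_cut(3)[OF assms(1)]])
     (use assms(2,3) in \<open>auto simp: slab_slice\<close>)

lemma cut_volume_diff_ge:
  assumes "compact S" "r \<le> s" "0 \<le> B" "\<And>t. r \<le> t \<Longrightarrow> t \<le> s \<Longrightarrow> B \<le> slice_area S t"
  shows "(s - r) * B \<le> cut_volume S s - cut_volume S r"
  unfolding cut_volume_diff[OF assms(1,2)]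
  by (rule height_times_area_le_volume[OF compact_cut(3)[OF assms(1)] assms(2,3)])
     (use assms(4) in \<open>auto simp: slab_slice\<close>)

lemma continuous_cut_volume:
  assumes "compact S" shows "continuous_on UNIV (cut_volume S)"
proof -
  let ?B = "measure lborel (snd ` S)"
  have le: "\<bar>cut_volume S s - cut_volume S r\<bar> \<le> ?B * \<bar>s - r\<bar>" if "r \<le> s" for r s
    using cut_volume_diff_le[OF assms that slice_area_le_shadow[OF assms]]
      measure_nonneg[of lborel "S \<inter> {x. r \<le> fst x \<and> fst x \<le> s}"] cut_volume_diff[OF assms that] that
    by (simp add: mult.commute)
  have "?B-lipschitz_on UNIV (cut_volume S)"
  proof (rule lipschitz_onI)
    fix x y :: real
    show "dist (cut_volume S x) (cut_volume S y) \<le> ?B * dist x y"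
    proof (cases "x \<le> y")
      case True
      show ?thesis using le[OF True] by (simp only: dist_real_def abs_minus_commute)
    next
      case False
      then have "y \<le> x" by simp
      show ?thesis using le[OF \<open>y \<le> x\<close>] by (simp only: dist_real_def)
    qed
  qed simp
  then show ?thesis by (rule lipschitz_on_continuous_on)
qed

locale convex_body_range =
  fixes S :: "(real \<times> (real \<times> real)) set" and a b :: real
  assumes cS: "compact S" and cvS: "convex S"
    and range_S: "\<And>x. x \<in> S \<Longrightarrow> a \<le> fst x \<and> fst x \<le> b"
    and ends: "\<exists>p\<in>S. fst p = a" "\<exists>p\<in>S. fst p = b"
    and Vpos: "0 < measure lborel S"
begin

lemma slice_outside: "t < a \<or> b < t \<Longrightarrow> slice_area S t = 0"
proof -
  assume "t < a \<or> b < t"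
  then have "Pair t -` S = {}" using range_S by fastforce
  then show ?thesis by (simp add: slice_area_def)
qed

lemma cut_low: "cut_volume S a = 0"
proof -
  have "measure lborel (S \<inter> {x. fst x \<le> a}) \<le> (a - a) * slice_area (S \<inter> {x. fst x \<le> a}) a"
    by (rule volume_le_height_times_area[OF compact_cut(1)[OF cS]]) (use range_S in force)+
  then show ?thesis using measure_nonneg[of lborel "S \<inter> {x. fst x \<le> a}"] by (simp add: cut_volume_def)
qed

lemma cut_high: "cut_volume S b = measure lborel S"
proof -
  have "S \<inter> {x. fst x \<le> b} = S" using range_S by blast
  then show ?thesis by (simp add: cut_volume_def)
qed

lemma a_less_b: "a < b"
proof -
  have "a \<le> b" using ends range_S by force
  moreover have "a \<noteq> b" using cut_low cut_high Vpos by auto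
  ultimately show ?thesis by simp
qed

lemma slice_lower_right:
  assumes "s \<le> t" "t < b"
  shows "((b - t) / (b - s))\<^sup>2 * slice_area S s \<le> slice_area S t"
proof -
  obtain p where p: "p \<in> S" "fst p = b" using ends by blast
  define l where "l = (t - s) / (b - s)"
  have l: "0 \<le> l" "l < 1" "1 - l = (b - t) / (b - s)" using assms by (auto simp: l_def field_simps)
  have "(1 - l) * s + l * b = s + l * (b - s)" by (simp add: algebra_simps)
  also have "\<dots> = t" using assms by (simp add: l_def)
  finally have "(1 - l) * s + l * b = t" .
  then show ?thesis using slice_area_convex[OF cS cvS p(1) l(1,2), of s] by (simp add: p(2) l(3))
qed

lemma slice_lower_left:
  assumes "t \<le> s" "a < t"
  shows "((t - a) / (s - a))\<^sup>2 * slice_area S s \<le> slice_area S t"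
proof -
  obtain p where p: "p \<in> S" "fst p = a" using ends by blast
  define l where "l = (s - t) / (s - a)"
  have l: "0 \<le> l" "l < 1" "1 - l = (t - a) / (s - a)" using assms by (auto simp: l_def field_simps)
  have "(1 - l) * s + l * a = s - l * (s - a)" by (simp add: algebra_simps)
  also have "\<dots> = t" using assms by (simp add: l_def)
  finally have "(1 - l) * s + l * a = t" .
  then show ?thesis using slice_area_convex[OF cS cvS p(1) l(1,2), of s] by (simp add: p(2) l(3))
qed

lemma slice_pos:
  assumes t: "a < t" "t < b" shows "0 < slice_area S t"
proof -
  obtain t0 where t0: "slice_area S t0 > 0"
  proof (rule ccontr)
    assume "\<not> thesis"
    with that have "slice_area S t \<le> 0" for t by (meson not_le)
    then have "measure lborel S \<le> (b - a) * 0"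
      using range_S a_less_b by (intro volume_le_height_times_area[OF cS]) auto
    then show False using Vpos by simp
  qed
  then have r: "a \<le> t0" "t0 \<le> b" using slice_outside[of t0] by (auto simp: not_less[symmetric])
  show ?thesis
  proof (cases "t0 \<le> t")
    case True
    have "0 < ((b - t) / (b - t0))\<^sup>2 * slice_area S t0" using t True t0 by simp
    then show ?thesis using slice_lower_right[OF True t(2)] by linarith
  next
    case False
    then have le: "t \<le> t0" by simp
    have "0 < ((t - a) / (t0 - a))\<^sup>2 * slice_area S t0" using t le t0 by simp
    then show ?thesis using slice_lower_left[OF le t(1)] by linarith
  qed
qed

text \<open>Comparing the slices at $s$ and $t$ through the two extreme points of the body gives
  two-sided bounds for their ratio, and these bounds tend to $1$.\<close>
lemma slice_continuous:
  assumes s: "a < s" "s < b" shows "isCont (slice_area S) s"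
proof -
  let ?A = "slice_area S"
  let ?p = "\<lambda>t. ((t - a) / (s - a))\<^sup>2" and ?q = "\<lambda>t. ((b - t) / (b - s))\<^sup>2"
  have bd: "min (?p t) (?q t) * ?A s \<le> ?A t \<and> ?A t \<le> max (?p t) (?q t) * ?A s" if t: "a < t" "t < b" for t
  proof -
    have inv: "x \<le> c\<^sup>2 * y" if "(1 / c)\<^sup>2 * x \<le> y" "c > 0" for c x y :: real
      using that by (simp add: power_divide divide_simps mult.commute split: if_splits)
    have mn: "min (?p t) (?q t) * ?A s \<le> ?p t * ?A s" "min (?p t) (?q t) * ?A s \<le> ?q t * ?A s"
      "?p t * ?A s \<le> max (?p t) (?q t) * ?A s" "?q t * ?A s \<le> max (?p t) (?q t) * ?A s"
      by (intro mult_right_mono; simp)+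
    show ?thesis
    proof (cases "s \<le> t")
      case True
      have "?q t * ?A s \<le> ?A t" using slice_lower_right[OF True t(2)] .
      moreover have "?A t \<le> ?p t * ?A s"
        using slice_lower_left[OF True s(1)] s t by (intro inv) auto
      ultimately show ?thesis using mn by linarith
    next
      case False
      then have le: "t \<le> s" by simp
      have "?p t * ?A s \<le> ?A t" using slice_lower_left[OF le t(1)] .
      moreover have "?A t \<le> ?q t * ?A s"
        using slice_lower_right[OF le s(2)] s t by (intro inv) auto
      ultimately show ?thesis using mn by linarith
    qed
  qed
  have ev: "\<forall>\<^sub>F t in at s. a < t \<and> t < b"
    using s by (intro eventually_conj order_tendstoD[OF tendsto_ident_at])
  have pq: "(?p \<longlongrightarrow> 1) (at s)" "(?q \<longlongrightarrow> 1) (at s)"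
    using s by (auto intro!: tendsto_eq_intros)
  have "((\<lambda>t. min (?p t) (?q t) * ?A s) \<longlongrightarrow> min 1 1 * ?A s) (at s)"
    "((\<lambda>t. max (?p t) (?q t) * ?A s) \<longlongrightarrow> max 1 1 * ?A s) (at s)"
    by (rule tendsto_mult[OF tendsto_min[OF pq] tendsto_const], rule tendsto_mult[OF tendsto_max[OF pq] tendsto_const])
  then have "(?A \<longlongrightarrow> ?A s) (at s)"
    by (intro tendsto_sandwich[of "\<lambda>t. min (?p t) (?q t) * ?A s" ?A "at s" "\<lambda>t. max (?p t) (?q t) * ?A s"])
       (use ev bd in \<open>auto elim: eventually_mono\<close>)
  then show ?thesis by (simp add: isCont_def)
qed

lemma cut_volume_deriv:
  assumes s: "a < s" "s < b"
  shows "(cut_volume S has_real_derivative slice_area S s) (at s)"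
  unfolding has_field_derivative_iff
proof (rule tendstoI)
  let ?A = "slice_area S" and ?C = "cut_volume S"
  fix e :: real assume e: "e > 0"
  have "\<forall>\<^sub>F t in at s. dist (?A t) (?A s) < e / 2"
    using slice_continuous[OF s] e by (intro tendstoD) (auto simp: isCont_def)
  then obtain d where d: "d > 0" "\<And>t. t \<noteq> s \<Longrightarrow> dist t s < d \<Longrightarrow> dist (?A t) (?A s) < e / 2"
    unfolding eventually_at by auto
  have near: "?A s - e / 2 \<le> ?A t \<and> ?A t \<le> ?A s + e / 2" if "\<bar>t - s\<bar> < d" for t
  proof (cases "t = s")
    case False
    have "\<bar>?A t - ?A s\<bar> < e / 2" using d(2)[OF False] that by (simp only: dist_real_def)
    then show ?thesis by linarith
  qed (use e in simp)
  have near0: "max 0 (?A s - e / 2) \<le> ?A t" if "\<bar>t - s\<bar> < d" for t using near[OF that] by simp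
  have quot: "\<bar>(?C y - ?C x) / (y - x) - ?A s\<bar> \<le> e / 2" if "x < y" "\<bar>x - s\<bar> < d" "\<bar>y - s\<bar> < d" for x y
  proof -
    have in_d: "\<bar>t - s\<bar> < d" if "x \<le> t" "t \<le> y" for t using that \<open>\<bar>x - s\<bar> < d\<close> \<open>\<bar>y - s\<bar> < d\<close> by linarith
    have "?C y - ?C x \<le> (y - x) * (?A s + e / 2)"
      using that near in_d by (intro cut_volume_diff_le[OF cS]) auto
    moreover have "(y - x) * (?A s - e / 2) \<le> ?C y - ?C x"
    proof (rule order_trans)
      show "(y - x) * (?A s - e / 2) \<le> (y - x) * max 0 (?A s - e / 2)"
        using that by (intro mult_left_mono) auto
      show "(y - x) * max 0 (?A s - e / 2) \<le> ?C y - ?C x"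
        using that near0 in_d by (intro cut_volume_diff_ge[OF cS]) auto
    qed
    ultimately have "?A s - e / 2 \<le> (?C y - ?C x) / (y - x)" "(?C y - ?C x) / (y - x) \<le> ?A s + e / 2"
      using that by (simp_all add: pos_le_divide_eq pos_divide_le_eq mult.commute)
    moreover have "\<bar>q - A\<bar> \<le> e / 2" if "A - e / 2 \<le> q" "q \<le> A + e / 2" for q A :: real
      using that by linarith
    ultimately show ?thesis by blast
  qed
  have "dist ((?C y - ?C s) / (y - s)) (?A s) < e" if y: "y \<noteq> s" "dist y s < d" for y
  proof (cases "s < y")
    case True
    then show ?thesis using quot[of s y] y d e by (simp add: dist_real_def)
  next
    case False
    then have "\<bar>(?C s - ?C y) / (s - y) - ?A s\<bar> \<le> e / 2" using quot[of y s] y d by (simp add: dist_real_def)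
    moreover have "(?C s - ?C y) / (s - y) = (?C y - ?C s) / (y - s)"
      by (metis minus_diff_eq minus_divide_divide)
    ultimately show ?thesis using e by (simp add: dist_real_def)
  qed
  then show "\<forall>\<^sub>F y in at s. dist ((?C y - ?C s) / (y - s)) (?A s) < e"
    unfolding eventually_at using d(1) by blast
qed

lemma cut_volume_mono: "r \<le> s \<Longrightarrow> cut_volume S r \<le> cut_volume S s"
  using cut_volume_diff[OF cS, of r s] measure_nonneg[of lborel "S \<inter> {x. r \<le> fst x \<and> fst x \<le> s}"] by linarith

lemma cut_volume_strict:
  assumes "a \<le> r" "r < s" "s \<le> b"
  shows "cut_volume S r < cut_volume S s"
proof -
  define u v where "u = r + (s - r) / 3" and "v = r + 2 * (s - r) / 3"
  have uv: "r < u" "u < v" "v < s" using assms by (auto simp: u_def v_def field_simps)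
  have "cut_volume S u < cut_volume S v"
  proof (rule DERIV_pos_imp_increasing[OF uv(2)])
    fix x assume "u \<le> x" "x \<le> v"
    then have "a < x" "x < b" using uv assms by auto
    then show "\<exists>y. (cut_volume S has_real_derivative y) (at x) \<and> 0 < y"
      using cut_volume_deriv slice_pos by blast
  qed
  then show ?thesis using cut_volume_mono[of r u] cut_volume_mono[of v s] uv by linarith
qed

lemma cut_volume_attains:
  assumes "0 < v" "v < measure lborel S"
  obtains s where "a < s" "s < b" "cut_volume S s = v"
proof -
  have "\<exists>s\<ge>a. s \<le> b \<and> cut_volume S s = v"
    using assms cut_low cut_high a_less_b continuous_on_subset[OF continuous_cut_volume[OF cS]]
    by (intro IVT') auto
  then obtain s where s: "a \<le> s" "s \<le> b" "cut_volume S s = v" by blast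
  moreover have "s \<noteq> a" "s \<noteq> b" using s assms cut_low cut_high by auto
  ultimately show thesis using that[of s] by linarith
qed

lemma cut_volume_strictly_between:
  assumes "a < s" "s < b" shows "0 < cut_volume S s" "cut_volume S s < measure lborel S"
  using cut_volume_strict[of a s] cut_volume_strict[of s b] assms cut_low cut_high by auto

end

section \<open>Equality in the Brunn-Minkowski inequality\<close>

lemma midset_restrict:
  assumes "\<And>x y. x \<in> {x. P x} \<Longrightarrow> y \<in> {x. Q x} \<Longrightarrow> (1/2) *\<^sub>R (x + y) \<in> {x. R x}"
  shows "midset (S \<inter> {x. P x}) (T \<inter> {x. Q x}) \<subseteq> midset S T \<inter> {x. R x}"
  using assms unfolding midset_def by auto

lemma midset_commute: "midset A B = midset B A"
proof -
  have "midset A B \<subseteq> midset B A" for A B :: "'a set"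
  proof
    fix z assume "z \<in> midset A B"
    then obtain a b where "a \<in> A" "b \<in> B" "z = (1/2) *\<^sub>R (a + b)" by (auto simp: midset_iff)
    then have "b \<in> B \<and> a \<in> A \<and> z = (1/2) *\<^sub>R (b + a)" by (simp add: add.commute)
    then show "z \<in> midset B A" unfolding midset_iff by blast
  qed
  then show ?thesis by blast
qed

text \<open>If the midpoint body is not larger than $S$ and $T$, cut both bodies at heights below
  which they have the same volume. The lower, middle and upper parts have midpoint sets in
  non-overlapping slabs, and each of these sets is at least as large as the part itself; as the
  sizes add up to the whole, no slab can contain more than its part.\<close>
lemma midset_slab_le:
  fixes S T :: "(real \<times> (real \<times> real)) set"
  assumes c: "compact S" "compact T" and le: "measure lborel (midset S T) \<le> measure lborel S"
    and V: "measure lborel S = measure lborel T"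
    and s: "s1 \<le> s2" "t1 \<le> t2" "cut_volume S s1 = cut_volume T t1" "cut_volume S s2 = cut_volume T t2"
  shows "measure lborel (midset S T \<inter> {x. (s1 + t1) / 2 \<le> fst x \<and> fst x \<le> (s2 + t2) / 2})
     \<le> cut_volume S s2 - cut_volume S s1"
proof -
  let ?M = "midset S T" and ?c1 = "(s1 + t1) / 2" and ?c2 = "(s2 + t2) / 2"
  have cM: "compact ?M" using c by (rule compact_midset)
  have low: "cut_volume S s1 \<le> measure lborel (?M \<inter> {x. fst x \<le> ?c1})"
  proof -
    have "midset (S \<inter> {x. fst x \<le> s1}) (T \<inter> {x. fst x \<le> t1}) \<subseteq> ?M \<inter> {x. fst x \<le> ?c1}"
      by (rule midset_restrict) simp
    then have "measure lborel (S \<inter> {x. fst x \<le> s1}) * measure lborel (T \<inter> {x. fst x \<le> t1})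
        \<le> (measure lborel (?M \<inter> {x. fst x \<le> ?c1}))\<^sup>2"
      by (rule brunn_minkowski_compact[OF midpoint_prekopa_leindler_triple compact_cut(1)[OF c(1)] compact_cut(1)[OF c(2)] compact_cut(1)[OF cM]])
    then have "(cut_volume S s1)\<^sup>2 \<le> (measure lborel (?M \<inter> {x. fst x \<le> ?c1}))\<^sup>2"
      using s(3) by (simp add: cut_volume_def power2_eq_square)
    then show ?thesis by (rule power2_le_imp_le) simp
  qed
  have top: "measure lborel S - cut_volume S s = measure lborel (S \<inter> {x. s \<le> fst x})" if "compact S" for S s
    using volume_cut[OF that, of s] by (simp add: cut_volume_def)
  have high: "measure lborel S - cut_volume S s2 \<le> measure lborel (?M \<inter> {x. ?c2 \<le> fst x})"
  proof -
    have "midset (S \<inter> {x. s2 \<le> fst x}) (T \<inter> {x. t2 \<le> fst x}) \<subseteq> ?M \<inter> {x. ?c2 \<le> fst x}"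
      by (rule midset_restrict) simp
    then have "measure lborel (S \<inter> {x. s2 \<le> fst x}) * measure lborel (T \<inter> {x. t2 \<le> fst x})
        \<le> (measure lborel (?M \<inter> {x. ?c2 \<le> fst x}))\<^sup>2"
      by (rule brunn_minkowski_compact[OF midpoint_prekopa_leindler_triple compact_cut(2)[OF c(1)] compact_cut(2)[OF c(2)] compact_cut(2)[OF cM]])
    then have "(measure lborel S - cut_volume S s2)\<^sup>2 \<le> (measure lborel (?M \<inter> {x. ?c2 \<le> fst x}))\<^sup>2"
      using s(4) V top[OF c(1), of s2] top[OF c(2), of t2] by (simp add: power2_eq_square)
    then show ?thesis by (rule power2_le_imp_le) simp
  qed
  have "?c1 \<le> ?c2" using s by simp
  from cut_volume_diff[OF cM this]
  have "measure lborel (?M \<inter> {x. ?c1 \<le> fst x \<and> fst x \<le> ?c2})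
      = measure lborel ?M - measure lborel (?M \<inter> {x. ?c2 \<le> fst x}) - measure lborel (?M \<inter> {x. fst x \<le> ?c1})"
    using volume_cut[OF cM, of ?c2] by (simp add: cut_volume_def)
  then show ?thesis using low high le by linarith
qed

text \<open>The slices of the midpoint body satisfy the hypothesis of the one-dimensional inequality
  by the Brunn-Minkowski inequality in the plane.\<close>
lemma slab_midset_volume_ge:
  fixes S T M :: "(real \<times> (real \<times> real)) set"
  assumes c: "compact S" "compact T" "compact M" and sub: "midset S T \<subseteq> M"
    and F: "F > 0" "\<And>t. slice_area S t \<le> F" "\<And>t. 0 \<le> t \<Longrightarrow> t < F \<Longrightarrow> \<exists>x. slice_area S x > t"
    and G: "G > 0" "\<And>t. slice_area T t \<le> G" "\<And>t. 0 \<le> t \<Longrightarrow> t < G \<Longrightarrow> \<exists>x. slice_area T x > t"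
  shows "G * measure lborel S + F * measure lborel T \<le> 2 * sqrt (F * G) * measure lborel M"
proof -
  let ?f = "\<lambda>S t. ennreal (slice_area S t)"
  have PL2: "midpoint_prekopa_leindler TYPE(real \<times> real)"
    by (intro midpoint_prekopa_leindler_prod midpoint_prekopa_leindler_real)
  have "ennreal G * (\<integral>\<^sup>+t. ?f S t \<partial>lborel) + ennreal F * (\<integral>\<^sup>+t. ?f T t \<partial>lborel)
     \<le> ennreal (2 * sqrt (F * G)) * (\<integral>\<^sup>+t. ?f M t \<partial>lborel)"
  proof (rule prekopa_leindler_real_sup)
    fix x y
    have "midset (Pair x -` S) (Pair y -` T) \<subseteq> Pair ((1/2) * (x + y)) -` M"
    proof
      fix z assume "z \<in> midset (Pair x -` S) (Pair y -` T)"
      then obtain p q where pq: "(x, p) \<in> S" "(y, q) \<in> T" "z = (1/2) *\<^sub>R (p + q)" by (auto simp: midset_iff)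
      have "(1/2) *\<^sub>R ((x, p) + (y, q)) \<in> midset S T" using pq(1,2) unfolding midset_iff by blast
      moreover have "(1/2) *\<^sub>R ((x, p) + (y, q)) = ((1/2) * (x + y), z)" unfolding pq(3) by simp
      ultimately show "z \<in> Pair ((1/2) * (x + y)) -` M" using sub by auto
    qed
    then have "slice_area S x * slice_area T y \<le> (slice_area M ((1/2) * (x + y)))\<^sup>2"
      unfolding slice_area_def
      by (rule brunn_minkowski_compact[OF PL2 compact_slice[OF c(1)] compact_slice[OF c(2)] compact_slice[OF c(3)]])
    then have "ennreal (slice_area S x * slice_area T y) \<le> ennreal ((slice_area M ((1/2) * (x + y)))\<^sup>2)"
      by (rule ennreal_leI)
    then show "?f S x * ?f T y \<le> (?f M ((1/2) * (x + y)))\<^sup>2"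
      by (simp only: ennreal_mult[symmetric] ennreal_power slice_area_nonneg)
  next
    fix t :: real assume "0 \<le> t" "t < F"
    then show "\<exists>x. ennreal t < ?f S x" using F(3)[of t] by (auto simp: ennreal_less_iff)
  next
    fix t :: real assume "0 \<le> t" "t < G"
    then show "\<exists>x. ennreal t < ?f T x" using G(3)[of t] by (auto simp: ennreal_less_iff)
  qed (use c F G borel_measurable_slice_area in \<open>auto intro!: ennreal_leI\<close>)
  then have "ennreal (G * measure lborel S + F * measure lborel T) \<le> ennreal (2 * sqrt (F * G) * measure lborel M)"
    using F G volume_by_slices[OF c(1)] volume_by_slices[OF c(2)] volume_by_slices[OF c(3)]
    by (simp add: compact_emeasure_lborel c ennreal_mult)
  then show ?thesis using F G by (subst (asm) ennreal_le_iff) auto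
qed

lemma slice_sup:
  assumes c: "compact S" and x0: "slice_area S x0 > 0"
  shows "\<exists>F>0. (\<forall>t. slice_area S t \<le> F) \<and> (\<forall>t. 0 \<le> t \<longrightarrow> t < F \<longrightarrow> (\<exists>x. slice_area S x > t))"
proof (rule exI[of _ "Sup (range (slice_area S))"], intro conjI allI impI)
  let ?R = "range (slice_area S)"
  have bdd: "bdd_above ?R" using slice_area_le_shadow[OF c] by (auto intro!: bdd_aboveI)
  show le: "slice_area S t \<le> Sup ?R" for t by (rule cSup_upper[OF _ bdd]) simp
  show "Sup ?R > 0" using x0 le[of x0] by linarith
  show "\<exists>x. slice_area S x > t" if "0 \<le> t" "t < Sup ?R" for t
    using less_cSup_iff[OF _ bdd, of t] that by auto
qed

text \<open>Otherwise, for a suitable $\beta$, there are thin slabs of equal volume directly above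
  the two heights such that the lowest slice of $S$ is larger than $\beta$ and no slice of $T$ is.
  Equality of the volumes forces the suprema of the slice areas over the two slabs to agree, which
  is impossible.\<close>
lemma matched_slice_le:
  assumes "convex_body_range S a b" "convex_body_range T a' b'"
    and V: "measure lborel S = measure lborel T" and le: "measure lborel (midset S T) \<le> measure lborel S"
    and s: "a < s" "s < b" and t: "a' < t" "t < b'" and st: "cut_volume S s = cut_volume T t"
  shows "slice_area S s \<le> slice_area T t"
proof (rule ccontr)
  interpret S: convex_body_range S a b by fact
  interpret T: convex_body_range T a' b' by fact
  assume neg: "\<not> slice_area S s \<le> slice_area T t"
  define \<beta> where "\<beta> = (slice_area S s + slice_area T t) / 2"
  have \<beta>: "slice_area T t < \<beta>" "\<beta> < slice_area S s" using neg by (auto simp: \<beta>_def)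
  have "\<forall>\<^sub>F r in at t. slice_area T r < \<beta>"
    using T.slice_continuous[OF t] \<beta> by (intro order_tendstoD(2)) (auto simp: isCont_def)
  then obtain d0 where d0: "d0 > 0" "\<And>r. r \<noteq> t \<Longrightarrow> dist r t < d0 \<Longrightarrow> slice_area T r < \<beta>"
    unfolding eventually_at by auto
  define d where "d = min (d0 / 2) (min ((b - s) / 2) ((b' - t) / 2))"
  have d: "d > 0" "d < d0" "s + d < b" "t + d < b'"
  proof -
    have "d \<le> d0 / 2" "d \<le> (b - s) / 2" "d \<le> (b' - t) / 2" unfolding d_def
      by (rule min.cobounded1, rule min.coboundedI2[OF min.cobounded1], rule min.coboundedI2[OF min.cobounded2])
    note le = this
    show "d < d0" using le(1) d0(1) by linarith
    have half: "y + x < z" if "x \<le> (z - y) / 2" "y < z" for x y z :: real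
      using that by (simp add: field_simps)
    show "s + d < b" using le(2) s(2) by (rule half)
    show "t + d < b'" using le(3) t(2) by (rule half)
    show "d > 0" using d0(1) s t by (simp add: d_def)
  qed
  have Tle: "slice_area T r \<le> \<beta>" if "t \<le> r" "r \<le> t + d" for r
    using d0(2)[of r] that d \<beta>(1) by (cases "r = t") (auto simp: dist_real_def less_imp_le)
  define v where "v = min (cut_volume S (s + d)) (cut_volume T (t + d))"
  have v: "cut_volume S s < v" "v \<le> cut_volume S (s + d)" "v \<le> cut_volume T (t + d)"
    using S.cut_volume_strict[of s "s + d"] T.cut_volume_strict[of t "t + d"] s t d st by (auto simp: v_def)
  have "\<exists>s2\<ge>s. s2 \<le> s + d \<and> cut_volume S s2 = v"
    using v d by (intro IVT' continuous_on_subset[OF continuous_cut_volume[OF S.cS]]) auto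
  then obtain s2 where s2: "s \<le> s2" "s2 \<le> s + d" "cut_volume S s2 = v" by blast
  have "\<exists>t2\<ge>t. t2 \<le> t + d \<and> cut_volume T t2 = v"
    using v d st by (intro IVT' continuous_on_subset[OF continuous_cut_volume[OF T.cS]]) auto
  then obtain t2 where t2: "t \<le> t2" "t2 \<le> t + d" "cut_volume T t2 = v" by blast
  let ?S = "S \<inter> {x. s \<le> fst x \<and> fst x \<le> s2}" and ?T = "T \<inter> {x. t \<le> fst x \<and> fst x \<le> t2}"
  let ?M = "midset S T \<inter> {x. (s + t) / 2 \<le> fst x \<and> fst x \<le> (s2 + t2) / 2}"
  have cs: "compact ?S" "compact ?T" "compact ?M"
    by (rule compact_cut(3), fact S.cS, rule compact_cut(3), fact T.cS, rule compact_cut(3), rule compact_midset[OF S.cS T.cS])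
  define e where "e = v - cut_volume S s"
  have e: "e > 0" using v by (simp add: e_def)
  have vS: "measure lborel ?S = e" "measure lborel ?T = e"
    using cut_volume_diff[OF S.cS s2(1)] cut_volume_diff[OF T.cS t2(1)] s2 t2 st by (simp_all add: e_def)
  have vM: "measure lborel ?M \<le> e"
    using midset_slab_le[OF S.cS T.cS le V s2(1) t2(1) st] s2 t2 by (simp add: e_def)
  have sub: "midset ?S ?T \<subseteq> ?M" by (rule midset_restrict) simp
  have "slice_area ?S s > 0" using S.slice_pos[OF s] s2 by (simp only: slab_slice) simp
  then obtain F where F: "F > 0" "\<And>t. slice_area ?S t \<le> F" "\<And>t. 0 \<le> t \<Longrightarrow> t < F \<Longrightarrow> \<exists>x. slice_area ?S x > t"
    using slice_sup[OF cs(1)] by blast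
  have "slice_area ?T t > 0" using T.slice_pos[OF t] t2 by (simp only: slab_slice) simp
  then obtain G where G: "G > 0" "\<And>t. slice_area ?T t \<le> G" "\<And>t. 0 \<le> t \<Longrightarrow> t < G \<Longrightarrow> \<exists>x. slice_area ?T x > t"
    using slice_sup[OF cs(2)] by blast
  have "G * e + F * e \<le> 2 * sqrt (F * G) * measure lborel ?M"
    using slab_midset_volume_ge[OF cs sub F G] unfolding vS .
  also have "\<dots> \<le> 2 * sqrt (F * G) * e" using vM F G by (intro mult_left_mono) auto
  finally have "(G + F) * e \<le> (2 * sqrt (F * G)) * e" by (simp add: distrib_right)
  then have "G + F \<le> 2 * sqrt (F * G)" using e by simp
  then have "(sqrt F - sqrt G)\<^sup>2 \<le> 0" using F G by (simp add: power2_diff real_sqrt_mult)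
  then have "F = G" using F G by simp
  moreover have "\<beta> < F" using F(2)[of s] \<beta> s2 by (simp only: slab_slice) simp
  moreover have "G \<le> \<beta>"
  proof (rule ccontr)
    assume "\<not> G \<le> \<beta>"
    moreover have "0 \<le> \<beta>" using \<beta>(1) slice_area_nonneg[of T t] by linarith
    ultimately obtain x where "slice_area ?T x > \<beta>" using G(3)[of \<beta>] by auto
    then show False using Tle[of x] t2 \<open>0 \<le> \<beta>\<close> by (simp only: slab_slice split: if_splits) auto
  qed
  ultimately show False by simp
qed

lemma matched_slice_eq:
  assumes "convex_body_range S a b" "convex_body_range T a' b'"
    and V: "measure lborel S = measure lborel T" and le: "measure lborel (midset S T) \<le> measure lborel S"
    and s: "a < s" "s < b" and t: "a' < t" "t < b'" and st: "cut_volume S s = cut_volume T t"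
  shows "slice_area S s = slice_area T t"
proof (rule antisym)
  show "slice_area S s \<le> slice_area T t" by (rule matched_slice_le) fact+
  show "slice_area T t \<le> slice_area S s"
    by (rule matched_slice_le[OF assms(2,1)]) (use assms midset_commute[of S T] in auto)
qed

text \<open>The height $\kappa(s)$ at which $T$ has the same volume below it as $S$ has below $s$ is
  a differentiable function, and its derivative is the quotient of two matched slice areas, hence
  $1$.\<close>
lemma slices_translate:
  assumes S: "convex_body_range S a b" and T: "convex_body_range T a' b'"
    and V: "measure lborel S = measure lborel T" and le: "measure lborel (midset S T) \<le> measure lborel S"
  obtains \<tau> where "a' = a + \<tau>" "b' = b + \<tau>" "\<And>s. a < s \<Longrightarrow> s < b \<Longrightarrow> slice_area T (s + \<tau>) = slice_area S s"
proof -
  interpret S: convex_body_range S a b by fact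
  interpret T: convex_body_range T a' b' by fact
  let ?V = "measure lborel T"
  have inj: "u = v" if uv: "a' < u" "u < b'" "a' < v" "v < b'" "cut_volume T u = cut_volume T v" for u v
    using T.cut_volume_strict[of u v] T.cut_volume_strict[of v u] uv by (cases u v rule: linorder_cases) auto
  have "\<exists>t. a' < t \<and> t < b' \<and> cut_volume T t = v" if "0 < v" "v < ?V" for v
    using T.cut_volume_attains[OF that] by metis
  then obtain g where g: "\<And>v. 0 < v \<Longrightarrow> v < ?V \<Longrightarrow> a' < g v \<and> g v < b' \<and> cut_volume T (g v) = v" by metis
  have g_inv: "g (cut_volume T t) = t" if t: "a' < t" "t < b'" for t
    using g[OF T.cut_volume_strictly_between[OF t]] t inj by metis
  have g_cont: "isCont g v" if v: "0 < v" "v < ?V" for v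
  proof -
    define c d where "c = (a' + g v) / 2" and "d = (g v + b') / 2"
    have cd: "a' < c" "c < g v" "g v < d" "d < b'" using g[OF v] by (auto simp: c_def d_def)
    have "continuous_on (cut_volume T ` {c..d}) g"
      using cd g_inv by (intro continuous_on_inv continuous_on_subset[OF continuous_cut_volume[OF T.cS]]) auto
    moreover have "{cut_volume T c<..<cut_volume T d} \<subseteq> cut_volume T ` {c..d}"
    proof
      fix w assume w: "w \<in> {cut_volume T c<..<cut_volume T d}"
      have "\<exists>x\<ge>c. x \<le> d \<and> cut_volume T x = w"
        using w cd by (intro IVT' continuous_on_subset[OF continuous_cut_volume[OF T.cS]]) auto
      then show "w \<in> cut_volume T ` {c..d}" by auto
    qed
    ultimately have "continuous_on {cut_volume T c<..<cut_volume T d} g" by (rule continuous_on_subset)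
    moreover have "v \<in> {cut_volume T c<..<cut_volume T d}"
      using T.cut_volume_strict[of c "g v"] T.cut_volume_strict[of "g v" d] cd g[OF v] by auto
    ultimately show ?thesis by (simp add: continuous_on_eq_continuous_at)
  qed
  define \<kappa> where "\<kappa> s = g (cut_volume S s)" for s
  have Cb: "0 < cut_volume S s" "cut_volume S s < ?V" if "a < s" "s < b" for s
    using S.cut_volume_strictly_between[OF that] V by auto
  have \<kappa>: "a' < \<kappa> s" "\<kappa> s < b'" "cut_volume T (\<kappa> s) = cut_volume S s" if "a < s" "s < b" for s
    using g[OF Cb[OF that]] by (auto simp: \<kappa>_def)
  have \<kappa>_slice: "slice_area S s = slice_area T (\<kappa> s)" if "a < s" "s < b" for s
    by (rule matched_slice_eq[OF S T V le that \<kappa>(1,2)[OF that]]) (simp add: \<kappa>(3)[OF that])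
  have deriv: "((\<lambda>s. \<kappa> s - s) has_real_derivative 0) (at s)" if s: "a < s" "s < b" for s
  proof -
    let ?v = "cut_volume S s"
    have "(g has_real_derivative inverse (slice_area T (\<kappa> s))) (at ?v)"
    proof (rule DERIV_inverse_function[where f = "cut_volume T" and a = 0 and b = ?V])
      show "(cut_volume T has_real_derivative slice_area T (\<kappa> s)) (at (g ?v))"
        using T.cut_volume_deriv[OF \<kappa>(1,2)[OF s]] by (simp add: \<kappa>_def)
      show "slice_area T (\<kappa> s) \<noteq> 0" using T.slice_pos[OF \<kappa>(1,2)[OF s]] by simp
    qed (use Cb[OF s] g g_cont in auto)
    from DERIV_chain2[OF this S.cut_volume_deriv[OF s]]
    have "(\<kappa> has_real_derivative inverse (slice_area T (\<kappa> s)) * slice_area S s) (at s)"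
      unfolding \<kappa>_def .
    then have "(\<kappa> has_real_derivative 1) (at s)"
      using \<kappa>_slice[OF s] S.slice_pos[OF s] by simp
    from DERIV_diff[OF this DERIV_ident] show ?thesis by simp
  qed
  have "\<exists>\<tau>. \<forall>s\<in>{a<..<b}. \<kappa> s - s = \<tau>"
    by (rule has_field_derivative_zero_constant) (use deriv in \<open>auto intro: has_field_derivative_at_within\<close>)
  then obtain \<tau> where \<tau>: "\<And>s. a < s \<Longrightarrow> s < b \<Longrightarrow> \<kappa> s = s + \<tau>"
    by (metis diff_add_cancel add.commute greaterThanLessThan_iff)
  have img: "{a'<..<b'} = {a + \<tau><..<b + \<tau>}"
  proof (intro antisym subsetI)
    fix t assume "t \<in> {a'<..<b'}"
    then have t: "a' < t" "t < b'" by auto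
    obtain s where s: "a < s" "s < b" "cut_volume S s = cut_volume T t"
      using S.cut_volume_attains[of "cut_volume T t"] T.cut_volume_strictly_between[OF t] V by metis
    have "\<kappa> s = t" using g_inv[OF t] s by (simp add: \<kappa>_def)
    then show "t \<in> {a + \<tau><..<b + \<tau>}" using \<tau>[of s] s by auto
  next
    fix t assume "t \<in> {a + \<tau><..<b + \<tau>}"
    then have t: "a < t - \<tau>" "t - \<tau> < b" by auto
    then show "t \<in> {a'<..<b'}" using \<kappa>(1,2)[OF t] \<tau>[OF t] by simp
  qed
  have ab: "a < b" "a' < b'" by (rule S.a_less_b, rule T.a_less_b)
  have "Inf {a'<..<b'} = a'" "Sup {a'<..<b'} = b'" "Inf {a + \<tau><..<b + \<tau>} = a + \<tau>" "Sup {a + \<tau><..<b + \<tau>} = b + \<tau>"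
    using ab by simp_all
  then have "a' = a + \<tau>" "b' = b + \<tau>" using img by auto
  moreover have "slice_area T (s + \<tau>) = slice_area S s" if "a < s" "s < b" for s
    using \<kappa>_slice[OF that] \<tau>[OF that] by simp
  ultimately show thesis by (rule that)
qed

lemma nn_moment_by_slices:
  fixes S :: "(real \<times> (real \<times> real)) set"
  assumes S: "compact S"
  shows "(\<integral>\<^sup>+x. indicator S x * ennreal (fst x - a) \<partial>lborel)
    = (\<integral>\<^sup>+t. ennreal (t - a) * ennreal (slice_area S t) \<partial>lborel)"
proof -
  have m: "S \<in> sets (lborel \<Otimes>\<^sub>M lborel)" unfolding lborel_prod using S by (simp add: borel_compact)
  have meas: "(\<lambda>x. indicator S x * ennreal (fst x - a)) \<in> borel_measurable (lborel \<Otimes>\<^sub>M lborel)"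
    using m by measurable
  have "(\<integral>\<^sup>+x. indicator S x * ennreal (fst x - a) \<partial>lborel)
      = (\<integral>\<^sup>+x. indicator S x * ennreal (fst x - a) \<partial>(lborel \<Otimes>\<^sub>M lborel))" by (simp only: lborel_prod)
  also have "\<dots> = (\<integral>\<^sup>+t. (\<integral>\<^sup>+z. indicator S (t, z) * ennreal (fst (t, z) - a) \<partial>lborel) \<partial>lborel)"
    by (rule lborel.nn_integral_fst[OF meas, symmetric])
  also have "\<dots> = (\<integral>\<^sup>+t. ennreal (t - a) * ennreal (slice_area S t) \<partial>lborel)"
  proof (rule nn_integral_cong)
    fix t
    have "(\<integral>\<^sup>+z. indicator S (t, z) * ennreal (fst (t, z) - a) \<partial>lborel)
        = (\<integral>\<^sup>+z. ennreal (t - a) * indicator (Pair t -` S) z \<partial>lborel)"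
      by (intro nn_integral_cong) (auto simp: indicator_def)
    also have "\<dots> = ennreal (t - a) * emeasure lborel (Pair t -` S)"
      by (rule nn_integral_cmult_indicator) (simp add: borel_compact[OF compact_slice[OF S]])
    finally show "(\<integral>\<^sup>+z. indicator S (t, z) * ennreal (fst (t, z) - a) \<partial>lborel) = ennreal (t - a) * ennreal (slice_area S t)"
      by (simp only: slice_area_emeasure[OF S])
  qed
  finally show ?thesis .
qed

lemma integrable_on_compact:
  fixes f :: "'a::euclidean_space \<Rightarrow> 'b::{banach, second_countable_topology}"
  assumes "compact S" "continuous_on S f"
  shows "integrable lborel (\<lambda>x. indicator S x *\<^sub>R f x)"
  using borel_integrable_compact[OF assms] by (simp add: indicator_scaleR_eq_if)

text \<open>The slice areas of $T$ are those of $S$ shifted by $b' - b$, hence so is the mean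
  height.\<close>
lemma moment_translate:
  assumes S: "convex_body_range S a b" and T: "convex_body_range T a' b'"
    and V: "measure lborel S = measure lborel T" and le: "measure lborel (midset S T) \<le> measure lborel S"
  shows "(\<integral>x. indicator T x *\<^sub>R fst x \<partial>lborel) = (\<integral>x. indicator S x *\<^sub>R fst x \<partial>lborel) + (b' - b) * measure lborel S"
proof -
  interpret S: convex_body_range S a b by fact
  interpret T: convex_body_range T a' b' by fact
  obtain \<tau> where \<tau>: "a' = a + \<tau>" "b' = b + \<tau>" "\<And>s. a < s \<Longrightarrow> s < b \<Longrightarrow> slice_area T (s + \<tau>) = slice_area S s"
    using slices_translate[OF S T V le] by metis
  have slice: "slice_area T (s + \<tau>) = slice_area S s" if "s \<noteq> a" "s \<noteq> b" for s
  proof (cases "a < s \<and> s < b")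
    case False
    then have "s < a \<or> b < s" using that by linarith
    then show ?thesis using S.slice_outside[of s] T.slice_outside[of "s + \<tau>"] \<tau> by auto
  qed (use \<tau>(3) in simp)
  have real: "(\<integral>x. indicator S x *\<^sub>R fst x \<partial>lborel) =
      enn2real (\<integral>\<^sup>+x. indicator S x * ennreal (fst x - a) \<partial>lborel) + a * measure lborel S"
    if S: "compact S" and lo: "\<And>x. x \<in> S \<Longrightarrow> a \<le> fst x" for S :: "(real \<times> (real \<times> real)) set" and a
  proof -
    have i1: "integrable lborel (\<lambda>x. indicator S x *\<^sub>R (fst x - a))"
      by (intro integrable_on_compact[OF S] continuous_intros)
    have i2: "integrable lborel (\<lambda>x. indicator S x *\<^sub>R a)"
      by (intro integrable_on_compact[OF S] continuous_intros)
    have "(\<integral>x. indicator S x *\<^sub>R fst x \<partial>lborel) = (\<integral>x. indicator S x *\<^sub>R (fst x - a) + indicator S x *\<^sub>R a \<partial>lborel)"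
      by (intro Bochner_Integration.integral_cong) (auto simp: algebra_simps)
    also have "\<dots> = (\<integral>x. indicator S x *\<^sub>R (fst x - a) \<partial>lborel) + (\<integral>x. indicator S x *\<^sub>R a \<partial>lborel)"
      by (rule Bochner_Integration.integral_add[OF i1 i2])
    also have "(\<integral>x. indicator S x *\<^sub>R a \<partial>lborel) = a * measure lborel S"
      using S by (simp add: borel_compact)
    also have "(\<integral>x. indicator S x *\<^sub>R (fst x - a) \<partial>lborel)
        = enn2real (\<integral>\<^sup>+x. ennreal (indicator S x *\<^sub>R (fst x - a)) \<partial>lborel)"
      by (rule integral_eq_nn_integral) (use i1 lo in \<open>auto simp: indicator_def\<close>)
    also have "(\<integral>\<^sup>+x. ennreal (indicator S x *\<^sub>R (fst x - a)) \<partial>lborel) = (\<integral>\<^sup>+x. indicator S x * ennreal (fst x - a) \<partial>lborel)"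
      by (intro nn_integral_cong) (auto simp: indicator_def)
    finally show ?thesis .
  qed
  have "(\<integral>\<^sup>+x. indicator T x * ennreal (fst x - a') \<partial>lborel) = (\<integral>\<^sup>+t. ennreal (t - a') * ennreal (slice_area T t) \<partial>lborel)"
    by (rule nn_moment_by_slices[OF T.cS])
  also have "\<dots> = ennreal \<bar>1\<bar> * (\<integral>\<^sup>+t. ennreal (\<tau> + 1 * t - a') * ennreal (slice_area T (\<tau> + 1 * t)) \<partial>lborel)"
    by (rule nn_integral_real_affine) (use borel_measurable_slice_area[OF T.cS] in measurable)
  also have "\<dots> = (\<integral>\<^sup>+t. ennreal (\<tau> + t - a') * ennreal (slice_area T (\<tau> + t)) \<partial>lborel)" by simp
  also have "\<dots> = (\<integral>\<^sup>+t. ennreal (t - a) * ennreal (slice_area S t) \<partial>lborel)"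
  proof (rule nn_integral_cong_AE)
    show "AE t in lborel. ennreal (\<tau> + t - a') * ennreal (slice_area T (\<tau> + t)) = ennreal (t - a) * ennreal (slice_area S t)"
      using AE_lborel_singleton[of a] AE_lborel_singleton[of b]
    proof eventually_elim
      case (elim t)
      then show ?case using slice[of t] \<tau>(1) by (simp add: add.commute)
    qed
  qed
  also have "\<dots> = (\<integral>\<^sup>+x. indicator S x * ennreal (fst x - a) \<partial>lborel)"
    by (rule nn_moment_by_slices[OF S.cS, symmetric])
  finally have "(\<integral>\<^sup>+x. indicator T x * ennreal (fst x - a') \<partial>lborel) = (\<integral>\<^sup>+x. indicator S x * ennreal (fst x - a) \<partial>lborel)" .
  then show ?thesis
    using real[OF S.cS, of a] real[OF T.cS, of a'] S.range_S T.range_S V \<tau> by (simp add: algebra_simps)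
qed

text \<open>The centroid multiplied by the volume.\<close>
definition moment :: "(real^3) set \<Rightarrow> real^3" where
  "moment P = (\<integral>y. indicator P y *\<^sub>R y \<partial>lborel)"

lemma inner_moment:
  assumes "compact P" shows "u \<bullet> moment P = (\<integral>y. indicator P y *\<^sub>R (u \<bullet> y) \<partial>lborel)"
proof -
  have "integrable lborel (\<lambda>y. indicator P y *\<^sub>R y)"
    by (intro integrable_on_compact[OF assms] continuous_intros)
  then have "(\<integral>y. u \<bullet> (indicator P y *\<^sub>R y) \<partial>lborel) = u \<bullet> moment P"
    unfolding moment_def by (rule integral_inner_right)
  then show ?thesis by simp
qed

lemma support_function_attained:
  assumes "compact P" "P \<noteq> {}"
  obtains y where "y \<in> P" "u \<bullet> y = support_function P u" "\<And>z. z \<in> P \<Longrightarrow> u \<bullet> z \<le> support_function P u"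
proof -
  obtain y where y: "y \<in> P" "\<And>z. z \<in> P \<Longrightarrow> u \<bullet> z \<le> u \<bullet> y"
    using continuous_attains_sup[OF assms continuous_on_inner[OF continuous_on_const continuous_on_id], of u] by blast
  have "support_function P u = u \<bullet> y"
    unfolding support_function_def by (rule cSup_eq_maximum) (use y in auto)
  then show thesis using that[of y] y by simp
qed

lemma frame_body_range:
  assumes u: "adapted_frame u \<phi>" and P: "compact P" "convex P" "measure lborel P > 0"
  obtains a where "convex_body_range (\<phi> -` P) a (support_function P u)"
proof -
  note f = adapted_frameD[OF u]
  let ?S = "\<phi> -` P"
  have ne: "P \<noteq> {}" using P by auto
  obtain y where y: "y \<in> P" "u \<bullet> y = support_function P u" "\<And>z. z \<in> P \<Longrightarrow> u \<bullet> z \<le> support_function P u"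
    using support_function_attained[OF P(1) ne, of u] by metis
  obtain w where w: "w \<in> P" "\<And>z. z \<in> P \<Longrightarrow> u \<bullet> w \<le> u \<bullet> z"
    using continuous_attains_inf[OF P(1) ne continuous_on_inner[OF continuous_on_const continuous_on_id], of u] by blast
  obtain p where p: "\<phi> p = y" using f(2) by (metis surjD)
  obtain q where q: "\<phi> q = w" using f(2) by (metis surjD)
  have "convex_body_range ?S (u \<bullet> w) (support_function P u)"
  proof
    show "compact ?S" by (rule frame_vimage_compact[OF u P(1)])
    show "convex ?S" by (rule convex_linear_vimage[OF f(1) P(2)])
    show "u \<bullet> w \<le> fst x \<and> fst x \<le> support_function P u" if "x \<in> ?S" for x
      using that w(2)[of "\<phi> x"] y(3)[of "\<phi> x"] f(4)[of x] by simp
    show "\<exists>p\<in>?S. fst p = u \<bullet> w" using q w f(4)[of q] by (intro bexI[of _ q]) auto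
    show "\<exists>p\<in>?S. fst p = support_function P u" using p y f(4)[of p] by (intro bexI[of _ p]) auto
    show "0 < measure lborel ?S" using P(3) measure_frame[OF u P(1)] by simp
  qed
  then show thesis by (rule that)
qed

lemma moment_frame:
  assumes u: "adapted_frame u \<phi>" and P: "compact P"
  shows "u \<bullet> moment P = (\<integral>x. indicator (\<phi> -` P) x *\<^sub>R fst x \<partial>lborel)"
proof -
  note f = adapted_frameD[OF u]
  note f(6)[measurable]
  have [measurable]: "P \<in> sets borel" using P by (rule borel_compact)
  have "u \<bullet> moment P = (\<integral>y. indicator P y *\<^sub>R (u \<bullet> y) \<partial>distr lborel borel \<phi>)"
    by (simp add: distr_lborel_frame[OF u] inner_moment[OF P])
  also have "\<dots> = (\<integral>x. indicator P (\<phi> x) *\<^sub>R (u \<bullet> \<phi> x) \<partial>lborel)"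
    by (rule integral_distr) measurable
  also have "\<dots> = (\<integral>x. indicator (\<phi> -` P) x *\<^sub>R fst x \<partial>lborel)"
    by (intro Bochner_Integration.integral_cong) (auto simp: f(4) indicator_def)
  finally show ?thesis .
qed

text \<open>In every direction the slices of $Q$ are those of $P$ shifted by some amount. The first
  moments identify that amount as a linear function of the direction, so that $Q$ is a translate of
  $P$.\<close>
lemma brunn_minkowski_equality:
  fixes P Q :: "(real^3) set"
  assumes P: "compact P" "convex P" and Q: "compact Q" "convex Q"
    and V: "0 < measure lborel P" "measure lborel Q = measure lborel P"
    and le: "measure lborel (midset P Q) \<le> measure lborel P" and u: "norm u = 1"
  shows "measure lborel P * (support_function Q u - support_function P u) = u \<bullet> (moment Q - moment P)"
proof -
  obtain \<phi> where \<phi>: "adapted_frame u \<phi>" by (rule adapted_frame_exists[OF u])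
  obtain a where S: "convex_body_range (\<phi> -` P) a (support_function P u)"
    using frame_body_range[OF \<phi> P V(1)] by metis
  obtain a' where T: "convex_body_range (\<phi> -` Q) a' (support_function Q u)"
    using frame_body_range[OF \<phi> Q] V by metis
  have cM: "compact (midset P Q)" by (rule compact_midset[OF P(1) Q(1)])
  have "measure lborel (midset (\<phi> -` P) (\<phi> -` Q)) \<le> measure lborel (\<phi> -` midset P Q)"
    by (rule compact_measure_mono[OF midset_frame[OF \<phi>]])
       (intro compact_midset frame_vimage_compact[OF \<phi>] P Q cM)+
  also have "\<dots> \<le> measure lborel (\<phi> -` P)" using le by (simp only: measure_frame[OF \<phi> cM] measure_frame[OF \<phi> P(1)])
  finally have le': "measure lborel (midset (\<phi> -` P) (\<phi> -` Q)) \<le> measure lborel (\<phi> -` P)" .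
  have V': "measure lborel (\<phi> -` P) = measure lborel (\<phi> -` Q)"
    using V by (simp only: measure_frame[OF \<phi> Q(1)] measure_frame[OF \<phi> P(1)])
  show ?thesis
    using moment_translate[OF S T V' le']
    unfolding moment_frame[OF \<phi> P(1), symmetric] moment_frame[OF \<phi> Q(1), symmetric] measure_frame[OF \<phi> P(1)]
    by (simp add: inner_diff_right right_diff_distrib mult.commute)
qed

lemma orthogonal_image_measure:
  fixes g :: "real^3 \<Rightarrow> real^3"
  assumes g: "orthogonal_transformation g" and P: "compact P"
  shows "measure lborel (g ` P) = measure lborel P" "compact (g ` P)"
    "u \<bullet> moment (g ` P) = u \<bullet> g (moment P)"
proof -
  note m[measurable] = borel_measurable_linear[OF orthogonal_transformation_linear[OF g]]
  have inj: "inj g" by (rule orthogonal_transformation_inj[OF g])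
  show c: "compact (g ` P)"
    using linear_continuous_on[of g P] orthogonal_transformation_linear[OF g]
    by (intro compact_continuous_image P) (auto simp: linear_conv_bounded_linear)
  have [measurable]: "g ` P \<in> sets borel" using c by (rule borel_compact)
  have v: "g -` (g ` P) = P" using inj by (rule inj_vimage_image_eq)
  have "emeasure lborel (g ` P) = emeasure (distr lborel borel g) (g ` P)"
    by (simp only: distr_lborel_orthogonal[OF g])
  also have "\<dots> = emeasure lborel P" by (subst emeasure_distr) (simp_all add: v)
  finally show "measure lborel (g ` P) = measure lborel P" by (simp add: measure_def)
  have "g u' \<bullet> moment (g ` P) = g u' \<bullet> g (moment P)" for u'
  proof -
    have "g u' \<bullet> moment (g ` P) = (\<integral>y. indicator (g ` P) y *\<^sub>R (g u' \<bullet> y) \<partial>distr lborel borel g)"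
      by (simp add: distr_lborel_orthogonal[OF g] inner_moment[OF c])
    also have "\<dots> = (\<integral>x. indicator (g ` P) (g x) *\<^sub>R (g u' \<bullet> g x) \<partial>lborel)"
      by (rule integral_distr) measurable
    also have "\<dots> = (\<integral>x. indicator P x *\<^sub>R (u' \<bullet> x) \<partial>lborel)"
      using g inj by (intro Bochner_Integration.integral_cong)
        (auto simp: orthogonal_transformation_def indicator_def inj_image_mem_iff)
    also have "\<dots> = u' \<bullet> moment P" by (simp add: inner_moment[OF P])
    also have "\<dots> = g u' \<bullet> g (moment P)" using g by (simp add: orthogonal_transformation_def)
    finally show ?thesis .
  qed
  then show "u \<bullet> moment (g ` P) = u \<bullet> g (moment P)"
    using orthogonal_transformation_surj[OF g] by (metis surjD)
qed

section \<open>Facets and vertices of a bicentric polytope\<close>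

lemma generic_direction:
  fixes V :: "'a::euclidean_space set"
  assumes "finite V"
  obtains w where "inj_on (\<lambda>v. w \<bullet> v) V"
proof -
  let ?D = "{(u, v) \<in> V \<times> V. u \<noteq> v}"
  let ?H = "\<Union>p\<in>?D. {w. (fst p - snd p) \<bullet> w = 0}"
  have "finite ?D" using finite_subset[of ?D "V \<times> V"] assms by auto
  then have "negligible ?H"
    by (intro negligible_Union) (auto intro!: negligible_hyperplane)
  then have "?H \<noteq> UNIV" using non_negligible_UNIV by metis
  then obtain w where w: "w \<notin> ?H" by blast
  have "inj_on (\<lambda>v. w \<bullet> v) V"
  proof (rule inj_onI, rule ccontr)
    fix u v assume uv: "u \<in> V" "v \<in> V" "w \<bullet> u = w \<bullet> v" "u \<noteq> v"
    then have "(u - v) \<bullet> w = 0" by (metis right_minus_eq inner_commute inner_diff_right)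
    then have "w \<in> ?H" using uv by (intro UN_I[of "(u, v)"]) auto
    then show False using w by contradiction
  qed
  then show thesis by (rule that)
qed

lemma card_middle:
  fixes f :: "'a \<Rightarrow> real"
  assumes F: "finite F" and inj: "inj_on f F"
  shows "card {v\<in>F. (\<exists>a\<in>F. f v < f a) \<and> (\<exists>b\<in>F. f b < f v)} = card F - 2"
proof (cases "F = {}")
  case False
  obtain m where m: "m \<in> F" "\<And>v. v \<in> F \<Longrightarrow> f m \<le> f v"
    using ex_min_if_finite[of "f ` F"] F False by (metis (no_types, lifting) arg_min_if_finite(1) arg_min_least)
  obtain M where M: "M \<in> F" "\<And>v. v \<in> F \<Longrightarrow> f v \<le> f M"
    using arg_min_if_finite(1)[OF F False, of "\<lambda>v. - f v"] arg_min_least[OF F False, of _ "\<lambda>v. - f v"]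
    by (metis neg_le_iff_le)
  have "{v\<in>F. (\<exists>a\<in>F. f v < f a) \<and> (\<exists>b\<in>F. f b < f v)} = F - {m, M}"
  proof (intro antisym subsetI)
    fix v assume "v \<in> F - {m, M}"
    then have v: "v \<in> F" "v \<noteq> m" "v \<noteq> M" by auto
    have "f m < f v" "f v < f M"
      using inj_onD[OF inj, of m v] inj_onD[OF inj, of v M] m M v by (auto simp: less_le)
    then show "v \<in> {v\<in>F. (\<exists>a\<in>F. f v < f a) \<and> (\<exists>b\<in>F. f b < f v)}" using v m M by auto
  next
    fix v assume "v \<in> {v\<in>F. (\<exists>a\<in>F. f v < f a) \<and> (\<exists>b\<in>F. f b < f v)}"
    then show "v \<in> F - {m, M}" using m(2) M(2) by (auto simp: not_le[symmetric])
  qed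
  moreover have "card (F - {m, M}) = card F - 2"
  proof (cases "m = M")
    case True
    have "x = m" if "x \<in> F" for x
      using inj_onD[OF inj _ that m(1)] m(2)[OF that] M(2)[OF that] True by auto
    then have "F = {m}" using m(1) by blast
    then show ?thesis using True by simp
  next
    case False
    then show ?thesis using F m M by (subst card_Diff_subset) auto
  qed
  ultimately show ?thesis by simp
qed simp

text \<open>If the face of the convex hull on which $x$ equals $h$ meets the plane through $v$
  orthogonal to $w$ in a further point $z$, then it has vertices on both sides of that plane: in a
  convex combination of vertices representing $z$, the vertices on the plane can only be
  $v$.\<close>
lemma facet_edge_two_sided:
  fixes V :: "'a::real_inner set"
  assumes V: "finite V" and w: "inj_on (\<lambda>v. w \<bullet> v) V" and le: "\<And>u. u \<in> V \<Longrightarrow> x \<bullet> u \<le> h"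
    and v: "v \<in> V" and z: "z \<in> convex hull V" "x \<bullet> z = h" "w \<bullet> z = w \<bullet> v" "z \<noteq> v"
  shows "(\<exists>a\<in>V. x \<bullet> a = h \<and> w \<bullet> v < w \<bullet> a) \<and> (\<exists>b\<in>V. x \<bullet> b = h \<and> w \<bullet> b < w \<bullet> v)"
proof -
  obtain l where l: "\<And>u. u \<in> V \<Longrightarrow> 0 \<le> l u" "sum l V = 1" "(\<Sum>u\<in>V. l u *\<^sub>R u) = z"
    using z(1) unfolding convex_hull_finite[OF V] by auto
  have "(\<Sum>u\<in>V. l u * (h - x \<bullet> u)) = h * sum l V - x \<bullet> (\<Sum>u\<in>V. l u *\<^sub>R u)"
    by (simp add: inner_sum_right sum_subtractf sum_distrib_left sum_distrib_right right_diff_distrib mult.commute)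
  also have "\<dots> = 0" using l z by simp
  finally have "\<forall>u\<in>V. l u * (h - x \<bullet> u) = 0"
    by (subst (asm) sum_nonneg_eq_0_iff[OF V]) (use l le in auto)
  then have F: "x \<bullet> u = h" if "u \<in> V" "l u \<noteq> 0" for u using that by auto
  have s0: "(\<Sum>u\<in>V. l u * (w \<bullet> u - w \<bullet> v)) = 0"
  proof -
    have "(\<Sum>u\<in>V. l u * (w \<bullet> u - w \<bullet> v)) = w \<bullet> (\<Sum>u\<in>V. l u *\<^sub>R u) - (w \<bullet> v) * sum l V"
      by (simp add: inner_sum_right sum_subtractf sum_distrib_left sum_distrib_right right_diff_distrib mult.commute)
    then show ?thesis using l z by simp
  qed
  have flat: False if "\<forall>u\<in>V. l u * (w \<bullet> u - w \<bullet> v) = 0"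
  proof -
    have "l u *\<^sub>R u = l u *\<^sub>R v" if "u \<in> V" for u
      using \<open>\<forall>u\<in>V. l u * (w \<bullet> u - w \<bullet> v) = 0\<close> that inj_onD[OF w, of u v] v by auto
    then have "(\<Sum>u\<in>V. l u *\<^sub>R u) = (\<Sum>u\<in>V. l u *\<^sub>R v)" by (intro sum.cong) auto
    also have "\<dots> = v" using l(2) by (simp add: scaleR_left.sum[symmetric])
    finally show False using l(3) z(4) by simp
  qed
  have "\<exists>a\<in>V. l a * (w \<bullet> a - w \<bullet> v) > 0"
  proof (rule ccontr)
    assume "\<not> ?thesis"
    then have "\<forall>u\<in>V. l u * (w \<bullet> u - w \<bullet> v) = 0"
      using s0 sum_nonneg_eq_0_iff[OF V, of "\<lambda>u. - (l u * (w \<bullet> u - w \<bullet> v))"]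
      by (auto simp: sum_negf not_less)
    then show False by (rule flat)
  qed
  then obtain a where a: "a \<in> V" "l a * (w \<bullet> a - w \<bullet> v) > 0" by blast
  have "\<exists>b\<in>V. l b * (w \<bullet> b - w \<bullet> v) < 0"
  proof (rule ccontr)
    assume "\<not> ?thesis"
    then have "\<forall>u\<in>V. l u * (w \<bullet> u - w \<bullet> v) = 0"
      using s0 sum_nonneg_eq_0_iff[OF V, of "\<lambda>u. l u * (w \<bullet> u - w \<bullet> v)"]
      by (auto simp: not_less)
    then show False by (rule flat)
  qed
  then obtain b where b: "b \<in> V" "l b * (w \<bullet> b - w \<bullet> v) < 0" by blast
  have "l a \<noteq> 0" "l b \<noteq> 0" using a(2) b(2) by auto
  moreover have "w \<bullet> v < w \<bullet> a" using a l(1)[of a] by (simp add: zero_less_mult_iff)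
  moreover have "w \<bullet> b < w \<bullet> v" using b l(1)[of b] by (auto simp: mult_less_0_iff)
  ultimately show ?thesis using F a b by blast
qed

text \<open>The two planes meet in a line, and besides $v$ a line meets a sphere through $v$ in at
  most one point.\<close>
lemma two_planes_meet_sphere:
  fixes x y :: "real^3"
  assumes xy: "norm x = 1" "norm y = 1" "x \<noteq> y" and h: "h > 0"
    and v: "x \<bullet> v = h" "y \<bullet> v = h" "norm v = R"
    and a: "x \<bullet> a = h" "y \<bullet> a = h" "norm a = R" "a \<noteq> v"
    and b: "x \<bullet> b = h" "y \<bullet> b = h" "norm b = R" "b \<noteq> v"
  shows "a = b"
proof -
  define n where "n = cross3 x y"
  have n0: "n \<noteq> 0"
  proof
    assume "n = 0"
    then have "collinear {0, x, y}" by (simp add: n_def cross_eq_0)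
    then obtain c where c: "y = c *\<^sub>R x" using xy unfolding collinear_lemma by fastforce
    then have "\<bar>c\<bar> = 1" using xy by simp
    then have "c = -1" using c xy(3) by (auto simp: abs_if split: if_splits)
    then show False using c v h by simp
  qed
  have line: "\<exists>t. p = v + t *\<^sub>R n" if p: "x \<bullet> p = h" "y \<bullet> p = h" for p
  proof -
    have "x \<bullet> (p - v) = 0" "y \<bullet> (p - v) = 0" by (simp_all add: p v inner_diff_right)
    then have "cross3 n (p - v) = 0"
      unfolding n_def cross_skew[of "cross3 x y"] Lagrange
      by (simp add: inner_commute[of "p - v"] del: inner_diff_left inner_diff_right)
    then have "collinear {0, n, p - v}" by (simp add: cross_eq_0)
    then have "p - v = 0 \<or> (\<exists>t. p - v = t *\<^sub>R n)" using n0 unfolding collinear_lemma by blast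
    then show ?thesis
    proof
      assume "p - v = 0" then show ?thesis by (intro exI[of _ 0]) simp
    next
      assume "\<exists>t. p - v = t *\<^sub>R n" then show ?thesis by (metis add.commute diff_add_cancel)
    qed
  qed
  have sol: "t = - 2 * (v \<bullet> n) / (n \<bullet> n)" if "p = v + t *\<^sub>R n" "norm p = R" "p \<noteq> v" for p t
  proof -
    have "(norm p)\<^sup>2 = (norm v)\<^sup>2 + t * (2 * (v \<bullet> n) + t * (n \<bullet> n))"
      unfolding that(1) power2_norm_eq_inner by (simp add: inner_add inner_commute algebra_simps)
    then have "t * (2 * (v \<bullet> n) + t * (n \<bullet> n)) = 0" using that(2) v(3) by simp
    moreover have "t \<noteq> 0" using that by auto
    ultimately have "2 * (v \<bullet> n) + t * (n \<bullet> n) = 0" by simp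
    then show ?thesis using n0 by (simp add: field_simps)
  qed
  obtain s t where st: "a = v + s *\<^sub>R n" "b = v + t *\<^sub>R n" using line a b by metis
  have "s = t" using sol[OF st(1) a(3,4)] sol[OF st(2) b(3,4)] by simp
  then show ?thesis using st by simp
qed

text \<open>The vectors $d_i$ are the directions of three edges at a vertex of a planar convex
  polygon, and the $x_i$ are normals of the sides. Three vectors in a plane satisfy a linear
  relation. Applying each normal to it shows that any two coefficients have opposite signs or both
  vanish, so all three vanish.\<close>
lemma three_edges_impossible:
  fixes d1 d2 d3 :: "real^3"
  assumes w: "w \<noteq> 0" "w \<bullet> d1 = 0" "w \<bullet> d2 = 0" "w \<bullet> d3 = 0"
    and x1: "x1 \<bullet> d1 = 0" "x1 \<bullet> d2 < 0" "x1 \<bullet> d3 < 0"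
    and x2: "x2 \<bullet> d1 < 0" "x2 \<bullet> d2 = 0" "x2 \<bullet> d3 < 0"
    and x3: "x3 \<bullet> d1 < 0" "x3 \<bullet> d2 < 0" "x3 \<bullet> d3 = 0"
  shows False
proof -
  have dist: "d1 \<noteq> d2" "d1 \<noteq> d3" "d2 \<noteq> d3" using x1 x2 x3 by auto
  let ?S = "{d1, d2, d3}"
  have "dependent ?S"
  proof (rule ccontr)
    assume "independent ?S"
    then have "card ?S \<le> dim {y. w \<bullet> y = 0}" using w by (intro independent_card_le_dim) auto
    then show False using dim_hyperplane[OF w(1)] dist by simp
  qed
  then obtain u where u: "\<exists>v\<in>?S. u v \<noteq> 0" "(\<Sum>v\<in>?S. u v *\<^sub>R v) = 0"
    by (subst (asm) dependent_finite) auto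
  define p q r where "p = u d1" and "q = u d2" and "r = u d3"
  have nz: "p \<noteq> 0 \<or> q \<noteq> 0 \<or> r \<noteq> 0" using u(1) by (auto simp: p_def q_def r_def)
  have sum: "p *\<^sub>R d1 + q *\<^sub>R d2 + r *\<^sub>R d3 = 0"
    using u(2) dist by (simp add: p_def q_def r_def add.assoc)
  have eq: "p * (x \<bullet> d1) + q * (x \<bullet> d2) + r * (x \<bullet> d3) = 0" for x
    using arg_cong[OF sum, of "\<lambda>y. x \<bullet> y"] by (simp add: inner_add_right)
  \<comment> \<open>Each normal kills its own vector and is negative on the others, so any two
    coefficients have opposite signs.\<close>
  have opp: "(s > 0 \<longrightarrow> t < 0) \<and> (s < 0 \<longrightarrow> t > 0) \<and> (t > 0 \<longrightarrow> s < 0) \<and> (t < 0 \<longrightarrow> s > 0)"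
    if "s * m + t * k = 0" "m < 0" "k < 0" for s t m k :: real
  proof -
    have "s * m = - (t * k)" using that by simp
    then have "s * m > 0 \<longleftrightarrow> t * k < 0" "s * m < 0 \<longleftrightarrow> t * k > 0" by auto
    then show ?thesis using that by (auto simp: zero_less_mult_iff mult_less_0_iff)
  qed
  from eq[of x1] x1 have 1: "q * (x1 \<bullet> d2) + r * (x1 \<bullet> d3) = 0" by simp
  from eq[of x2] x2 have 2: "p * (x2 \<bullet> d1) + r * (x2 \<bullet> d3) = 0" by simp
  from eq[of x3] x3 have 3: "p * (x3 \<bullet> d1) + q * (x3 \<bullet> d2) = 0" by simp
  show False using opp[OF 1 x1(2,3)] opp[OF 2 x2(1,3)] opp[OF 3 x3(1,2)] nz by linarith
qed

text \<open>A polytope with an inscribed and a circumscribed sphere, both centred at the origin.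
  That all vertices have the same norm replaces a theory of faces: every vertex is extreme, and no
  three vertices are collinear.\<close>
locale bicentric =
  fixes X V :: "(real^3) set" and h R :: real
  assumes finX: "finite X" and finV: "finite V" and h: "h > 0"
    and X1: "\<And>x. x \<in> X \<Longrightarrow> norm x = 1" and VR: "\<And>v. v \<in> V \<Longrightarrow> norm v = R"
    and P: "{y. \<forall>x\<in>X. x \<bullet> y \<le> h} = convex hull V"
begin

lemma V_le: "v \<in> V \<Longrightarrow> x \<in> X \<Longrightarrow> x \<bullet> v \<le> h"
  using P hull_subset[of V convex] by blast

lemma small_step:
  assumes v: "v \<in> V" and d: "\<And>x. x \<in> X \<Longrightarrow> x \<bullet> v = h \<Longrightarrow> x \<bullet> d \<le> 0"
  shows "\<forall>\<^sub>F e in at_right 0. v + e *\<^sub>R d \<in> convex hull V"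
proof -
  have "\<forall>\<^sub>F e in at_right 0. \<forall>x\<in>X. x \<bullet> (v + e *\<^sub>R d) \<le> h"
  proof (rule eventually_ball_finite[OF finX], rule)
    fix x assume x: "x \<in> X"
    show "\<forall>\<^sub>F e in at_right 0. x \<bullet> (v + e *\<^sub>R d) \<le> h"
    proof (cases "x \<bullet> v = h")
      case True
      have "\<forall>\<^sub>F e in at_right 0. (0::real) < e" by (rule eventually_at_right_less)
      then show ?thesis
      proof eventually_elim
        case (elim e)
        then show ?case using d[OF x True] True by (simp add: inner_add_right mult_nonneg_nonpos)
      qed
    next
      case False
      then have lt: "x \<bullet> v < h" using V_le[OF v x] by simp
      have "((\<lambda>e. x \<bullet> (v + e *\<^sub>R d)) \<longlongrightarrow> x \<bullet> (v + 0 *\<^sub>R d)) (at_right 0)" by (intro tendsto_intros)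
      then have "\<forall>\<^sub>F e in at_right 0. x \<bullet> (v + e *\<^sub>R d) < h" using lt by (intro order_tendstoD(2)) auto
      then show ?thesis by eventually_elim simp
    qed
  qed
  then show ?thesis
  proof eventually_elim
    case (elim e)
    then show ?case unfolding P[symmetric] by simp
  qed
qed

text \<open>A direction orthogonal to all facet normals at $v$ would allow a step from $v$ both
  forwards and backwards inside the circumscribed ball, although $v$ lies on its boundary.\<close>
lemma tight_normals_span:
  assumes v: "v \<in> V" and d: "\<And>x. x \<in> X \<Longrightarrow> x \<bullet> v = h \<Longrightarrow> x \<bullet> d = 0"
  shows "d = 0"
proof -
  have ball: "norm z \<le> R" if "z \<in> convex hull V" for z
  proof -
    have "convex hull V \<subseteq> cball 0 R" using VR by (intro hull_minimal) auto
    then show ?thesis using that by auto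
  qed
  have "\<forall>\<^sub>F e in at_right 0. v + e *\<^sub>R d \<in> convex hull V" using d by (intro small_step[OF v]) auto
  moreover have "\<forall>\<^sub>F e in at_right 0. v + e *\<^sub>R (- d) \<in> convex hull V" using d by (intro small_step[OF v]) auto
  moreover have "\<forall>\<^sub>F e in at_right 0. (0::real) < e" by (rule eventually_at_right_less)
  ultimately have "\<forall>\<^sub>F e in at_right (0::real). d = 0"
  proof eventually_elim
    case (elim e)
    have "(norm (v + e *\<^sub>R d))\<^sup>2 \<le> R\<^sup>2" "(norm (v + e *\<^sub>R (- d)))\<^sup>2 \<le> R\<^sup>2"
      using ball elim by (intro power_mono; simp)+
    moreover have "(norm (v + e *\<^sub>R d))\<^sup>2 + (norm (v + e *\<^sub>R (- d)))\<^sup>2 = 2 * (norm v)\<^sup>2 + 2 * e\<^sup>2 * (norm d)\<^sup>2"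
      unfolding power2_norm_eq_inner by (simp add: inner_add inner_diff inner_commute power2_eq_square algebra_simps)
    ultimately have "e\<^sup>2 * (norm d)\<^sup>2 \<le> 0" using VR[OF v] by simp
    then show "d = 0" using elim by (simp add: mult_le_0_iff)
  qed
  then show ?thesis by simp
qed

text \<open>These are the facets at $v$, given by their normals, that the plane through $v$
  orthogonal to $w$ divides.\<close>
definition crossing :: "real^3 \<Rightarrow> real^3 \<Rightarrow> (real^3) set" where
  "crossing w v = {x\<in>X. x \<bullet> v = h \<and> (\<exists>a\<in>V. x \<bullet> a = h \<and> w \<bullet> v < w \<bullet> a) \<and> (\<exists>b\<in>V. x \<bullet> b = h \<and> w \<bullet> b < w \<bullet> v)}"

text \<open>A facet crossed by the plane through $v$ orthogonal to $w$ contributes an edge at $v$ to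
  the polygon in which this plane cuts the polytope, and a polygon has at most two edges at a
  vertex.\<close>
lemma at_most_two_crossing:
  assumes v: "v \<in> V" shows "card (crossing w v) \<le> 2"
proof (rule ccontr)
  assume "\<not> ?thesis"
  then obtain T where T: "T \<subseteq> crossing w v" "card T = 3"
    using obtain_subset_with_card_n[of 3 "crossing w v"] by force
  then obtain x1 x2 x3 where x: "x1 \<in> crossing w v" "x2 \<in> crossing w v" "x3 \<in> crossing w v"
    "x1 \<noteq> x2" "x1 \<noteq> x3" "x2 \<noteq> x3" unfolding card_3_iff by auto
  have edge: "\<exists>d. w \<bullet> d = 0 \<and> x \<bullet> d = 0 \<and> (\<forall>y\<in>crossing w v. y \<noteq> x \<longrightarrow> y \<bullet> d < 0) \<and> w \<noteq> 0"
    if x: "x \<in> crossing w v" for x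
  proof -
    obtain a b where ab: "x \<in> X" "x \<bullet> v = h" "a \<in> V" "x \<bullet> a = h" "w \<bullet> v < w \<bullet> a" "b \<in> V" "x \<bullet> b = h" "w \<bullet> b < w \<bullet> v"
      using x unfolding crossing_def by auto
    \<comment> \<open>The segment from a to b crosses the plane; d points from v to the crossing
      point.\<close>
    define l where "l = (w \<bullet> v - w \<bullet> b) / (w \<bullet> a - w \<bullet> b)"
    have l: "0 < l" "l < 1" using ab by (auto simp: l_def field_simps)
    define d where "d = l *\<^sub>R (a - v) + (1 - l) *\<^sub>R (b - v)"
    have "w \<bullet> d = l * (w \<bullet> a - w \<bullet> b) - (w \<bullet> v - w \<bullet> b)"
      by (simp add: d_def inner_add_right inner_diff_right algebra_simps)
    also have "\<dots> = 0" using ab by (simp add: l_def)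
    finally have wd: "w \<bullet> d = 0" .
    have xd: "x \<bullet> d = 0" using ab by (simp add: d_def inner_add_right inner_diff_right)
    have "y \<bullet> d < 0" if y: "y \<in> crossing w v" "y \<noteq> x" for y
    proof -
      have yX: "y \<in> X" "y \<bullet> v = h" using y by (auto simp: crossing_def)
      have yd: "y \<bullet> d = l * (y \<bullet> a - h) + (1 - l) * (y \<bullet> b - h)"
        using yX by (simp add: d_def inner_add_right inner_diff_right)
      have le: "y \<bullet> a - h \<le> 0" "y \<bullet> b - h \<le> 0" using V_le[OF _ yX(1)] ab by auto
      have "\<not> (y \<bullet> a = h \<and> y \<bullet> b = h)"
      proof
        assume *: "y \<bullet> a = h \<and> y \<bullet> b = h"
        have "a = b"
          by (rule two_planes_meet_sphere[of x y h v R]) (use ab yX y * X1 VR v h in auto)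
        then show False using ab by simp
      qed
      then have "l * (y \<bullet> a - h) < 0 \<or> (1 - l) * (y \<bullet> b - h) < 0" using le l by (auto simp: mult_less_0_iff)
      moreover have "l * (y \<bullet> a - h) \<le> 0" "(1 - l) * (y \<bullet> b - h) \<le> 0" using le l by (auto simp: mult_le_0_iff)
      ultimately show ?thesis unfolding yd by linarith
    qed
    moreover have "w \<noteq> 0" using ab by auto
    ultimately show ?thesis using wd xd by blast
  qed
  obtain d1 where d1: "w \<noteq> 0" "w \<bullet> d1 = 0" "x1 \<bullet> d1 = 0" "x2 \<bullet> d1 < 0" "x3 \<bullet> d1 < 0" using edge[OF x(1)] x by metis
  obtain d2 where d2: "w \<bullet> d2 = 0" "x2 \<bullet> d2 = 0" "x1 \<bullet> d2 < 0" "x3 \<bullet> d2 < 0" using edge[OF x(2)] x by metis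
  obtain d3 where d3: "w \<bullet> d3 = 0" "x3 \<bullet> d3 = 0" "x1 \<bullet> d3 < 0" "x2 \<bullet> d3 < 0" using edge[OF x(3)] x by metis
  show False by (rule three_edges_impossible[of w d1 d2 d3 x1 x2 x3]) fact+
qed

text \<open>When a direction $d_0$ that points into the interior of the polygon is rotated towards
  $e$, the last direction that still points into the polygon at $v$ runs along one of its edges. The
  vector $n$ guarantees that this direction is not zero.\<close>
lemma crossing_in_direction:
  assumes w: "inj_on (\<lambda>v. w \<bullet> v) V" and v: "v \<in> V"
    and d0: "w \<bullet> d0 = 0" "\<And>x. x \<in> X \<Longrightarrow> x \<bullet> v = h \<Longrightarrow> x \<bullet> d0 < 0"
    and e: "w \<bullet> e = 0" and n: "n \<bullet> e = 0" "n \<bullet> d0 < 0" and pos: "\<exists>x\<in>X. x \<bullet> v = h \<and> 0 < x \<bullet> e"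
  shows "\<exists>x\<in>crossing w v. 0 < x \<bullet> e"
proof -
  let ?I = "{x\<in>X. x \<bullet> v = h \<and> 0 < x \<bullet> e}"
  let ?r = "\<lambda>x. - (x \<bullet> d0) / (x \<bullet> e)"
  have I: "finite ?I" "?I \<noteq> {}" using finX pos by auto
  define x0 where "x0 = arg_min_on ?r ?I"
  have x0: "x0 \<in> ?I" "\<And>x. x \<in> ?I \<Longrightarrow> ?r x0 \<le> ?r x"
    unfolding x0_def by (rule arg_min_if_finite(1)[OF I], rule arg_min_least[OF I])
  define t where "t = ?r x0"
  have t: "t > 0" using x0 d0(2)[of x0] by (simp add: t_def divide_less_0_iff)
  define d where "d = d0 + t *\<^sub>R e"
  have wd: "w \<bullet> d = 0" using d0(1) e by (simp add: d_def inner_add_right)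
  have x0d: "x0 \<bullet> d = 0" using x0(1) unfolding d_def inner_add_right inner_scaleR_right t_def by simp
  have "n \<bullet> d < 0" using n by (simp add: d_def inner_add_right)
  then have "d \<noteq> 0" by auto
  have dle: "x \<bullet> d \<le> 0" if x: "x \<in> X" "x \<bullet> v = h" for x
  proof (cases "0 < x \<bullet> e")
    case True
    then have "t \<le> ?r x" using x0(2)[of x] x by (simp add: t_def)
    then have "t * (x \<bullet> e) \<le> - (x \<bullet> d0)" by (simp only: pos_le_divide_eq[OF True])
    then show ?thesis by (simp add: d_def inner_add_right)
  next
    case False
    then have "t * (x \<bullet> e) \<le> 0" using t by (simp add: mult_nonneg_nonpos)
    then show ?thesis using d0(2)[OF x] by (simp add: d_def inner_add_right)
  qed
  have "\<forall>\<^sub>F s in at_right 0. v + s *\<^sub>R d \<in> convex hull V \<and> 0 < s"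
    by (intro eventually_conj small_step[OF v dle] eventually_at_right_less)
  then have "\<exists>s. v + s *\<^sub>R d \<in> convex hull V \<and> 0 < s" by (rule eventually_happens'[rotated]) simp
  then obtain s where s: "v + s *\<^sub>R d \<in> convex hull V" "0 < s" by blast
  have x0X: "x0 \<in> X" "x0 \<bullet> v = h" using x0(1) by auto
  have "(\<exists>a\<in>V. x0 \<bullet> a = h \<and> w \<bullet> v < w \<bullet> a) \<and> (\<exists>b\<in>V. x0 \<bullet> b = h \<and> w \<bullet> b < w \<bullet> v)"
    by (rule facet_edge_two_sided[OF finV w V_le[OF _ x0X(1)] v s(1)])
       (use x0X x0d wd s \<open>d \<noteq> 0\<close> in \<open>auto simp: inner_add_right\<close>)
  then have "x0 \<in> crossing w v" using x0X by (simp add: crossing_def)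
  then show ?thesis using x0(1) by blast
qed

text \<open>For $e$ orthogonal to the sum of the facet normals at $v$, some of these normals are
  positive on $e$ and some are negative, so that rotating towards $e$ and towards $-e$ ends at two
  different facets.\<close>
lemma at_least_two_crossing:
  assumes w: "inj_on (\<lambda>v. w \<bullet> v) V" and v: "v \<in> V"
    and ab: "a \<in> V" "w \<bullet> v < w \<bullet> a" "b \<in> V" "w \<bullet> b < w \<bullet> v"
  shows "2 \<le> card (crossing w v)"
proof -
  \<comment> \<open>A point of the plane in the interior: since the origin is interior, so is any
    point between it and a vertex beyond the plane.\<close>
  have "\<exists>p. w \<bullet> p = w \<bullet> v \<and> (\<forall>x\<in>X. x \<bullet> p < h)"
  proof -
    have scale: "\<exists>p. w \<bullet> p = w \<bullet> v \<and> (\<forall>x\<in>X. x \<bullet> p < h)"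
      if l: "0 \<le> l" "l < 1" "l * (w \<bullet> c) = w \<bullet> v" "c \<in> V" for l c
    proof (intro exI conjI ballI)
      fix x assume x: "x \<in> X"
      have "l * (x \<bullet> c) \<le> l * h" using V_le[OF l(4) x] l(1) by (rule mult_left_mono)
      also have "\<dots> < h" using l h by simp
      finally show "x \<bullet> (l *\<^sub>R c) < h" by simp
    qed (use l in simp)
    consider "w \<bullet> v = 0" | "w \<bullet> v > 0" | "w \<bullet> v < 0" by linarith
    then show ?thesis
    proof cases
      case 1 then show ?thesis using scale[of 0 a] ab by simp
    next
      case 2 then show ?thesis using scale[of "(w \<bullet> v) / (w \<bullet> a)" a] ab by simp
    next
      case 3 then show ?thesis using scale[of "(w \<bullet> v) / (w \<bullet> b)" b] ab by (simp add: divide_less_eq zero_le_divide_iff)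
    qed
  qed
  then obtain p where p: "w \<bullet> p = w \<bullet> v" "\<And>x. x \<in> X \<Longrightarrow> x \<bullet> p < h" by blast
  define d0 where "d0 = p - v"
  have d0: "w \<bullet> d0 = 0" "\<And>x. x \<in> X \<Longrightarrow> x \<bullet> v = h \<Longrightarrow> x \<bullet> d0 < 0"
    using p by (auto simp: d0_def inner_diff_right)
  let ?I = "{x\<in>X. x \<bullet> v = h}"
  define n where "n = \<Sum>?I"
  have finI: "finite ?I" using finX by simp
  have "dim {w, n} \<le> card {w, n}" by (rule dim_le_card') simp
  also have "\<dots> \<le> 2" by (simp add: card_insert_le_m1)
  finally have "dim {w, n} < DIM(real^3)" by simp
  then obtain e where e: "e \<noteq> 0" "\<And>y. y \<in> span {w, n} \<Longrightarrow> orthogonal e y"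
    using orthogonal_to_subspace_exists by metis
  have we: "w \<bullet> e = 0" "n \<bullet> e = 0"
    using e(2)[of w] e(2)[of n] by (auto simp: orthogonal_def inner_commute span_base)
  have sum0: "(\<Sum>x\<in>?I. x \<bullet> e) = 0" using we(2) by (simp add: n_def inner_sum_left)
  have ne: "\<not> (\<forall>x\<in>?I. x \<bullet> e = 0)" using tight_normals_span[OF v, of e] e(1) by auto
  have pos: "\<exists>x\<in>X. x \<bullet> v = h \<and> 0 < x \<bullet> e"
  proof (rule ccontr)
    assume "\<not> ?thesis"
    then have "\<forall>x\<in>?I. x \<bullet> e = 0"
      using sum0 sum_nonneg_eq_0_iff[OF finI, of "\<lambda>x. - (x \<bullet> e)"] by (auto simp: sum_negf not_less)
    then show False using ne by contradiction
  qed
  have neg: "\<exists>x\<in>X. x \<bullet> v = h \<and> 0 < x \<bullet> (- e)"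
  proof (rule ccontr)
    assume "\<not> ?thesis"
    then have "\<forall>x\<in>?I. x \<bullet> e = 0"
      using sum0 sum_nonneg_eq_0_iff[OF finI, of "\<lambda>x. x \<bullet> e"] by (auto simp: not_less)
    then show False using ne by contradiction
  qed
  have nd0: "n \<bullet> d0 < 0"
  proof -
    have "(\<Sum>x\<in>?I. x \<bullet> d0) < (\<Sum>x\<in>?I. 0)"
      by (rule sum_strict_mono[OF finI]) (use pos d0(2) in auto)
    then show ?thesis by (simp add: n_def inner_sum_left)
  qed
  obtain x where x: "x \<in> crossing w v" "0 < x \<bullet> e"
    using crossing_in_direction[OF w v d0 we nd0 pos] by blast
  obtain y where y: "y \<in> crossing w v" "0 < y \<bullet> (- e)"
    using crossing_in_direction[OF w v d0, of "- e" n] we nd0 neg by auto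
  have "x \<noteq> y" using x y by auto
  have "finite (crossing w v)" using finX by (simp add: crossing_def)
  then have "card {x, y} \<le> card (crossing w v)" using x y by (intro card_mono) auto
  then show ?thesis using \<open>x \<noteq> y\<close> by simp
qed

text \<open>Euler's formula in disguise. A facet with $k$ vertices has $k - 2$ vertices that are
  neither highest nor lowest in it, and each vertex except the highest and the lowest one of the
  polytope is such a vertex of exactly two facets. With $N$ facets and $N$ vertices this gives $N (k
  - 2) = 2 (N - 2)$, which has no solution with $N \<ge> 4$ other than $N = 4$, $k = 3$.\<close>
lemma four_vertices:
  assumes card: "card X = card V" "4 \<le> card V" and k: "\<And>x. x \<in> X \<Longrightarrow> card {v\<in>V. x \<bullet> v = h} = k"
  shows "card V = 4"
proof -
  obtain w where w: "inj_on (\<lambda>v. w \<bullet> v) V" using generic_direction[OF finV] by blast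
  let ?R = "\<lambda>x v. x \<in> crossing w v"
  have "card {v\<in>V. ?R x v} = k - 2" if x: "x \<in> X" for x
  proof -
    let ?F = "{v\<in>V. x \<bullet> v = h}"
    have "{v\<in>V. ?R x v} = {v\<in>?F. (\<exists>a\<in>?F. w \<bullet> v < w \<bullet> a) \<and> (\<exists>b\<in>?F. w \<bullet> b < w \<bullet> v)}"
      using x by (auto simp: crossing_def)
    also have "card \<dots> = card ?F - 2"
      by (rule card_middle) (use finV w in \<open>auto intro: inj_on_subset\<close>)
    finally show ?thesis using k[OF x] by simp
  qed
  then have "(\<Sum>v\<in>V. card {x\<in>X. ?R x v}) = (\<Sum>x\<in>X. k - 2)"
    using sum_multicount_gen[OF finV finX, of "\<lambda>v x. ?R x v" "\<lambda>_. k - 2"] by simp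
  also have "\<dots> = card V * (k - 2)" using card by simp
  finally have total: "(\<Sum>v\<in>V. card (crossing w v)) = card V * (k - 2)"
    by (simp add: crossing_def)
  have Vne: "V \<noteq> {}" using card by auto
  obtain m where m: "m \<in> V" "\<And>v. v \<in> V \<Longrightarrow> w \<bullet> m \<le> w \<bullet> v"
    using arg_min_if_finite(1)[OF finV Vne, of "\<lambda>v. w \<bullet> v"] arg_min_least[OF finV Vne, of _ "\<lambda>v. w \<bullet> v"] by metis
  obtain M where M: "M \<in> V" "\<And>v. v \<in> V \<Longrightarrow> w \<bullet> v \<le> w \<bullet> M"
    using arg_min_if_finite(1)[OF finV Vne, of "\<lambda>v. - (w \<bullet> v)"] arg_min_least[OF finV Vne, of _ "\<lambda>v. - (w \<bullet> v)"]
    by (metis neg_le_iff_le)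
  have "m \<noteq> M"
  proof
    assume "m = M"
    have "x = m" if "x \<in> V" for x
      using inj_onD[OF w _ that m(1)] m(2)[OF that] M(2)[OF that] \<open>m = M\<close> by auto
    then have "V \<subseteq> {m}" by blast
    then have "card V \<le> card {m}" by (intro card_mono) auto
    then show False using card by simp
  qed
  have ends: "crossing w m = {}" "crossing w M = {}"
    using m(2) M(2) by (auto simp: crossing_def not_le[symmetric])
  have mid: "card (crossing w v) = 2" if "v \<in> V - {m, M}" for v
  proof -
    have "w \<bullet> m < w \<bullet> v" "w \<bullet> v < w \<bullet> M"
      using inj_onD[OF w, of m v] inj_onD[OF w, of v M] m M that by (auto simp: less_le)
    then show ?thesis using at_least_two_crossing[OF w, of v M m] at_most_two_crossing[of v w] that m M by force
  qed
  have "(\<Sum>v\<in>V. card (crossing w v)) = (\<Sum>v\<in>V - {m, M}. card (crossing w v)) + (\<Sum>v\<in>{m, M}. card (crossing w v))"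
    using m M finV by (intro sum.subset_diff) auto
  also have "\<dots> = card (V - {m, M}) * 2" using mid ends \<open>m \<noteq> M\<close> by simp
  also have "card (V - {m, M}) = card V - 2" using m M finV \<open>m \<noteq> M\<close> by (subst card_Diff_subset) auto
  finally have eq: "card V * (k - 2) = (card V - 2) * 2" using total by simp
  consider "k - 2 = 0" | "k - 2 = 1" | "2 \<le> k - 2" by linarith
  then show ?thesis
  proof cases
    case 3
    then have "card V * 2 \<le> card V * (k - 2)" by (rule mult_le_mono2)
    then show ?thesis using eq card by linarith
  qed (use eq card in auto)
qed

end

section \<open>Moments of the sphere and of designs\<close>

lemma poly_of_degree_le_monomial:
  assumes "(\<Sum>i\<in>UNIV. a $ i) \<le> t"
  shows "poly_of_degree_le t (\<lambda>x. \<Prod>i\<in>UNIV. (x $ i) ^ (a $ i))"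
  unfolding poly_of_degree_le_def
proof (intro exI[of _ "\<lambda>b. if b = a then 1 else 0"] allI)
  fix x :: "real^3"
  have "(\<Sum>b \<in> {a. (\<Sum>i\<in>UNIV. a $ i) \<le> t}. (if b = a then 1 else 0) * (\<Prod>i\<in>UNIV. (x $ i) ^ (b $ i)))
    = (\<Sum>b \<in> {a. (\<Sum>i\<in>UNIV. a $ i) \<le> t}. if b = a then (\<Prod>i\<in>UNIV. (x $ i) ^ (b $ i)) else 0)"
    by (intro sum.cong) auto
  then show "(\<Prod>i\<in>UNIV. (x $ i) ^ (a $ i)) =
    (\<Sum>b \<in> {a. (\<Sum>i\<in>UNIV. a $ i) \<le> t}. (if b = a then 1 else 0) * (\<Prod>i\<in>UNIV. (x $ i) ^ (b $ i)))"
    using assms by (simp add: sum.delta finite_exponents)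
qed

lemma poly_of_degree_le_scale:
  assumes "poly_of_degree_le t p" shows "poly_of_degree_le t (\<lambda>x. r * p x)"
proof -
  obtain c where c: "\<And>x. p x = (\<Sum>a \<in> {a. (\<Sum>i\<in>UNIV. a $ i) \<le> t}. c a * (\<Prod>i\<in>UNIV. (x $ i) ^ (a $ i)))"
    using assms unfolding poly_of_degree_le_def by blast
  show ?thesis unfolding poly_of_degree_le_def
    by (intro exI[of _ "\<lambda>a. r * c a"] allI) (simp add: c sum_distrib_left mult.assoc)
qed

lemma poly_of_degree_le_add:
  assumes "poly_of_degree_le t p" "poly_of_degree_le t q" shows "poly_of_degree_le t (\<lambda>x. p x + q x)"
proof -
  obtain c where c: "\<And>x. p x = (\<Sum>a \<in> {a. (\<Sum>i\<in>UNIV. a $ i) \<le> t}. c a * (\<Prod>i\<in>UNIV. (x $ i) ^ (a $ i)))"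
    using assms(1) unfolding poly_of_degree_le_def by blast
  obtain d where d: "\<And>x. q x = (\<Sum>a \<in> {a. (\<Sum>i\<in>UNIV. a $ i) \<le> t}. d a * (\<Prod>i\<in>UNIV. (x $ i) ^ (a $ i)))"
    using assms(2) unfolding poly_of_degree_le_def by blast
  show ?thesis unfolding poly_of_degree_le_def
    by (intro exI[of _ "\<lambda>a. c a + d a"] allI) (simp add: c d sum.distrib distrib_right)
qed

lemma poly_of_degree_le_sum:
  assumes "finite I" "\<And>i. i \<in> I \<Longrightarrow> poly_of_degree_le t (p i)"
  shows "poly_of_degree_le t (\<lambda>x. \<Sum>i\<in>I. p i x)"
  using assms
proof (induction I rule: finite_induct)
  case empty
  show ?case unfolding poly_of_degree_le_def by (intro exI[of _ "\<lambda>_. 0"]) simp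
qed (simp add: poly_of_degree_le_add)

lemma poly_of_degree_le_coord_mult:
  assumes "poly_of_degree_le t p" shows "poly_of_degree_le (Suc t) (\<lambda>x. x $ j * p x)"
proof -
  let ?E = "{a :: nat^3. (\<Sum>i\<in>UNIV. a $ i) \<le> t}"
  obtain c where c: "\<And>x. p x = (\<Sum>a \<in> ?E. c a * (\<Prod>i\<in>UNIV. (x $ i) ^ (a $ i)))"
    using assms unfolding poly_of_degree_le_def by blast
  define s where "s a = (\<chi> i. a $ i + (if i = j then 1 else 0))" for a :: "nat^3"
  have mono: "x $ j * (\<Prod>i\<in>UNIV. (x $ i) ^ (a $ i)) = (\<Prod>i\<in>UNIV. (x $ i) ^ (s a $ i))" for a and x :: "real^3"
  proof -
    have "(\<Prod>i\<in>UNIV. (x $ i) ^ (s a $ i)) = (\<Prod>i\<in>UNIV. (x $ i) ^ (a $ i) * (if i = j then x $ i else 1))"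
      by (intro prod.cong) (auto simp: s_def)
    also have "\<dots> = (\<Prod>i\<in>UNIV. (x $ i) ^ (a $ i)) * x $ j" by (simp add: prod.distrib prod.delta)
    finally show ?thesis by (simp add: mult.commute)
  qed
  have deg: "(\<Sum>i\<in>UNIV. s a $ i) \<le> Suc t" if "a \<in> ?E" for a
    using that by (simp add: s_def sum.distrib sum.delta)
  have "poly_of_degree_le (Suc t) (\<lambda>x. \<Sum>a\<in>?E. c a * (\<Prod>i\<in>UNIV. (x $ i) ^ (s a $ i)))"
    by (intro poly_of_degree_le_sum finite_exponents poly_of_degree_le_scale poly_of_degree_le_monomial deg)
  moreover have "x $ j * p x = (\<Sum>a\<in>?E. c a * (\<Prod>i\<in>UNIV. (x $ i) ^ (s a $ i)))" for x
    by (simp add: c sum_distrib_left mono[symmetric] mult.left_commute)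
  ultimately show ?thesis by simp
qed

text \<open>Designs enter the argument through their moments in a fixed direction, which are sums of
  powers of a linear form.\<close>
lemma poly_of_degree_le_inner_power: "poly_of_degree_le k (\<lambda>x. (x \<bullet> v) ^ k)"
proof (induction k)
  case 0
  show ?case using poly_of_degree_le_monomial[of 0 0] by simp
next
  case (Suc k)
  have "poly_of_degree_le (Suc k) (\<lambda>x. \<Sum>j\<in>UNIV. v $ j * (x $ j * (x \<bullet> v) ^ k))"
    by (intro poly_of_degree_le_sum poly_of_degree_le_scale poly_of_degree_le_coord_mult Suc) simp
  moreover have "(x \<bullet> v) ^ Suc k = (\<Sum>j\<in>UNIV. v $ j * (x $ j * (x \<bullet> v) ^ k))" for x
  proof -
    have "x \<bullet> v = (\<Sum>j\<in>UNIV. v $ j * x $ j)" by (simp add: inner_vec_def mult.commute)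
    then have "(x \<bullet> v) ^ Suc k = (\<Sum>j\<in>UNIV. v $ j * x $ j) * (x \<bullet> v) ^ k" by simp
    then show ?thesis by (simp only: sum_distrib_right mult.assoc)
  qed
  ultimately show ?case by presburger
qed

lemma poly_of_degree_le_mono:
  assumes "poly_of_degree_le s p" "s \<le> t" shows "poly_of_degree_le t p"
proof -
  let ?E = "{a :: nat^3. (\<Sum>i\<in>UNIV. a $ i) \<le> s}"
  obtain c where c: "\<And>x. p x = (\<Sum>a \<in> ?E. c a * (\<Prod>i\<in>UNIV. (x $ i) ^ (a $ i)))"
    using assms(1) unfolding poly_of_degree_le_def by blast
  have "poly_of_degree_le t (\<lambda>x. \<Sum>a\<in>?E. c a * (\<Prod>i\<in>UNIV. (x $ i) ^ (a $ i)))"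
    by (intro poly_of_degree_le_sum finite_exponents poly_of_degree_le_scale poly_of_degree_le_monomial)
       (use assms(2) in auto)
  then show ?thesis using c by presburger
qed

lemma spherical_design_mono:
  "spherical_design t X \<Longrightarrow> s \<le> t \<Longrightarrow> spherical_design s X"
  unfolding spherical_design_def using poly_of_degree_le_mono by blast

lemma sets_sphere_measure [simp]: "sets sphere_measure = sets borel"
  and space_sphere_measure [simp]: "space sphere_measure = UNIV"
  by (simp_all add: sphere_measure_def)

lemma borel_measurable_sgn [measurable]: "(sgn :: real^3 \<Rightarrow> real^3) \<in> borel_measurable borel"
proof -
  have "(\<lambda>x::real^3. inverse (norm x) *\<^sub>R x) \<in> borel_measurable borel" by measurable
  then show ?thesis by (simp add: sgn_div_norm[abs_def])
qed

lemma emeasure_ball_pos: "0 < emeasure lborel (ball (0::real^3) 1)" "emeasure lborel (ball (0::real^3) 1) < \<infinity>"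
proof -
  have "\<not> negligible (ball (0::real^3) 1)" by (intro open_not_negligible) auto
  then have "ball (0::real^3) 1 \<notin> null_sets lborel"
    by (metis negligible_iff_null_sets null_sets_completionI)
  then show "0 < emeasure lborel (ball (0::real^3) 1)" by (auto simp: null_sets_def zero_less_iff_neq_zero)
  show "emeasure lborel (ball (0::real^3) 1) < \<infinity>" by (rule emeasure_lborel_ball_finite)
qed

lemma prob_uniform_ball: "emeasure (uniform_measure lborel (ball (0::real^3) 1)) UNIV = 1"
  using emeasure_ball_pos by (simp add: emeasure_uniform_measure)

lemma emeasure_sphere_measure: "emeasure sphere_measure UNIV = 1"
  unfolding sphere_measure_def using prob_uniform_ball by (subst emeasure_distr) auto

lemma finite_sphere_measure: "finite_measure sphere_measure"
  by (rule finite_measureI) (simp add: emeasure_sphere_measure)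

lemma AE_sphere_norm: "AE u in sphere_measure. norm u = 1"
proof -
  have "AE x in uniform_measure lborel (ball (0::real^3) 1). norm (sgn x) = 1"
    by (rule AE_uniform_measureI) (use AE_lborel_singleton[of "0::real^3"] in \<open>auto simp: norm_sgn\<close>)
  then show ?thesis unfolding sphere_measure_def by (subst AE_distr_iff) auto
qed

lemma emeasure_orthogonal_vimage:
  fixes g :: "real^3 \<Rightarrow> real^3"
  assumes g: "orthogonal_transformation g" and S: "S \<in> sets (borel :: (real^3) measure)"
  shows "emeasure lborel (g -` S) = emeasure lborel S"
proof -
  note borel_measurable_linear[OF orthogonal_transformation_linear[OF g], measurable]
  have "emeasure lborel S = emeasure (distr lborel borel g) S" by (simp only: distr_lborel_orthogonal[OF g])
  also have "\<dots> = emeasure lborel (g -` S)" using S by (subst emeasure_distr) auto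
  finally show ?thesis by simp
qed

lemma sphere_measure_rotation:
  assumes g: "orthogonal_transformation g"
  shows "distr sphere_measure borel g = sphere_measure"
proof -
  note lin = orthogonal_transformation_linear[OF g]
  note m[measurable] = borel_measurable_linear[OF lin]
  let ?B = "ball (0::real^3) 1" and ?U = "uniform_measure lborel (ball (0::real^3) 1)"
  have U: "distr ?U borel g = ?U"
  proof (rule measure_eqI)
    fix S assume "S \<in> sets (distr ?U borel g)"
    then have S[measurable]: "S \<in> sets borel" by simp
    have "g -` (?B \<inter> S) = ?B \<inter> g -` S" using g by (auto simp: orthogonal_transformation_norm)
    then have "emeasure lborel (?B \<inter> g -` S) = emeasure lborel (?B \<inter> S)"
      using emeasure_orthogonal_vimage[OF g, of "?B \<inter> S"] by simp
    moreover have "g -` S \<in> sets borel" using measurable_sets[OF m S] by simp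
    ultimately show "emeasure (distr ?U borel g) S = emeasure ?U S"
      by (subst emeasure_distr) (auto simp: emeasure_uniform_measure)
  qed simp
  have sgn: "g (sgn x) = sgn (g x)" for x
    using g by (simp add: sgn_div_norm linear_scale[OF lin] orthogonal_transformation_norm)
  have "distr sphere_measure borel g = distr ?U borel (g \<circ> sgn)"
    unfolding sphere_measure_def by (subst distr_distr) auto
  also have "g \<circ> sgn = sgn \<circ> g" by (auto simp: sgn)
  also have "distr ?U borel (sgn \<circ> g) = distr (distr ?U borel g) borel sgn"
    by (subst distr_distr) auto
  also have "\<dots> = sphere_measure" unfolding U sphere_measure_def ..
  finally show ?thesis .
qed

lemma sphere_integral_rotation:
  fixes f :: "real^3 \<Rightarrow> real"
  assumes g: "orthogonal_transformation g" and f: "f \<in> borel_measurable borel"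
  shows "(\<integral>u. f (g u) \<partial>sphere_measure) = (\<integral>u. f u \<partial>sphere_measure)"
proof -
  note m[measurable] = borel_measurable_linear[OF orthogonal_transformation_linear[OF g]]
  have "(\<integral>u. f u \<partial>sphere_measure) = (\<integral>u. f u \<partial>distr sphere_measure borel g)"
    by (simp only: sphere_measure_rotation[OF g])
  also have "\<dots> = (\<integral>u. f (g u) \<partial>sphere_measure)"
  proof (rule integral_distr)
    show "g \<in> sphere_measure \<rightarrow>\<^sub>M borel" using m by (simp cong: measurable_cong_sets)
  qed (use f in auto)
  finally show ?thesis by simp
qed

lemma sphere_integral_odd:
  fixes f :: "real^3 \<Rightarrow> real"
  assumes f: "f \<in> borel_measurable borel" and odd: "\<And>u. f (- u) = - f u"
  shows "(\<integral>u. f u \<partial>sphere_measure) = 0"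
proof -
  have "orthogonal_transformation (uminus :: real^3 \<Rightarrow> real^3)"
    by (simp add: orthogonal_transformation linear_uminus)
  from sphere_integral_rotation[OF this f] show ?thesis by (simp add: odd)
qed

lemma sphere_integrable:
  fixes f :: "real^3 \<Rightarrow> 'b::{banach, second_countable_topology}"
  assumes f: "f \<in> borel_measurable borel" and B: "\<And>u. norm u = 1 \<Longrightarrow> norm (f u) \<le> B"
  shows "integrable sphere_measure f"
  by (rule finite_measure.integrable_const_bound[OF finite_sphere_measure, of _ B])
     (use AE_sphere_norm B f in \<open>auto simp: sphere_measure_def\<close>)

lemma sphere_integrable_inner_mult:
  "integrable sphere_measure (\<lambda>u::real^3. (u \<bullet> c) * (u \<bullet> a))"
proof (rule sphere_integrable[where B = "norm c * norm a"])
  fix u :: "real^3" assume u: "norm u = 1"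
  then have "\<bar>u \<bullet> a\<bar> \<le> norm a" "\<bar>u \<bullet> c\<bar> \<le> norm c"
    using Cauchy_Schwarz_ineq2[of u a] Cauchy_Schwarz_ineq2[of u c] by simp_all
  then show "norm ((u \<bullet> c) * (u \<bullet> a)) \<le> norm c * norm a"
    by (auto simp: abs_mult intro!: mult_mono)
qed measurable

text \<open>By rotation invariance the integral depends only on the norm of $a$, and over an
  orthonormal basis these integrals add up to the integral of $|u|^2 = 1$.\<close>
lemma sphere_second_moment: "(\<integral>u. (u \<bullet> a)\<^sup>2 \<partial>sphere_measure) = (norm a)\<^sup>2 / 3"
proof -
  let ?Q = "\<lambda>a. (\<integral>u. (u \<bullet> a)\<^sup>2 \<partial>sphere_measure)"
  have meas: "(\<lambda>u::real^3. (u \<bullet> a)\<^sup>2) \<in> borel_measurable borel" for a by measurable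
  have same: "?Q a = ?Q b" if n: "norm a = norm b" for a b :: "real^3"
  proof -
    obtain g :: "real^3 \<Rightarrow> real^3" where g: "orthogonal_transformation g" "g a = b"
      using n by (rule orthogonal_transformation_exists) (rule that)
    have "?Q b = (\<integral>u. (g u \<bullet> b)\<^sup>2 \<partial>sphere_measure)" by (rule sphere_integral_rotation[OF g(1) meas, symmetric])
    also have "(\<lambda>u. (g u \<bullet> b)\<^sup>2) = (\<lambda>u. (u \<bullet> a)\<^sup>2)"
      using g unfolding orthogonal_transformation_def g(2)[symmetric] by simp
    finally show ?thesis by simp
  qed
  have int: "integrable sphere_measure (\<lambda>u::real^3. (u \<bullet> b)\<^sup>2)" for b
    unfolding power2_eq_square by (rule sphere_integrable_inner_mult)
  have "(\<Sum>i\<in>UNIV. ?Q (axis i 1 :: real^3)) = (\<integral>u. (\<Sum>i\<in>UNIV. (u \<bullet> axis i 1)\<^sup>2) \<partial>sphere_measure)"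
    by (rule Bochner_Integration.integral_sum[symmetric]) (rule int)
  also have "\<dots> = (\<integral>u. 1 \<partial>sphere_measure)"
  proof (rule integral_cong_AE)
    show "AE u in sphere_measure. (\<Sum>i\<in>UNIV. (u \<bullet> axis i 1)\<^sup>2) = (1::real)"
      using AE_sphere_norm
    proof eventually_elim
      case (elim u)
      have "(\<Sum>i\<in>UNIV. (u \<bullet> axis i 1)\<^sup>2) = (\<Sum>i\<in>UNIV. u $ i * u $ i)"
        by (simp add: inner_axis power2_eq_square)
      also have "\<dots> = (norm u)\<^sup>2" unfolding power2_norm_eq_inner by (simp add: inner_vec_def)
      finally have "(\<Sum>i\<in>UNIV. (u \<bullet> axis i 1)\<^sup>2) = (norm u)\<^sup>2" .
      then show ?case using elim by simp
    qed
  qed (auto simp: sphere_measure_def)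
  also have "\<dots> = 1" using emeasure_sphere_measure by (simp add: measure_def)
  finally have "(\<Sum>i\<in>(UNIV::3 set). ?Q (axis i 1 :: real^3)) = 1" .
  moreover have "(\<Sum>i\<in>(UNIV::3 set). ?Q (axis i 1 :: real^3)) = (\<Sum>i\<in>(UNIV::3 set). ?Q (axis 1 1))"
    by (intro sum.cong refl same) simp
  ultimately have "3 * ?Q (axis 1 1 :: real^3) = 1" by simp
  then have one: "?Q (axis 1 1 :: real^3) = 1 / 3" by simp
  have "?Q a = ?Q (norm a *\<^sub>R axis 1 1)" by (rule same) simp
  also have "\<dots> = (norm a)\<^sup>2 * ?Q (axis 1 1)" by (simp add: power_mult_distrib)
  finally show ?thesis using one by simp
qed

lemma design_moment:
  assumes X: "spherical_design t X" and k: "k \<le> t"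
  shows "(\<Sum>x\<in>X. (x \<bullet> a) ^ k) = real (card X) * (\<integral>u. (u \<bullet> a) ^ k \<partial>sphere_measure)"
proof -
  have p: "poly_of_degree_le t (\<lambda>x. (x \<bullet> a) ^ k)"
    by (rule poly_of_degree_le_mono[OF poly_of_degree_le_inner_power k])
  have "card X > 0" using X by (auto simp: spherical_design_def card_gt_0_iff)
  moreover have "(\<Sum>x\<in>X. (x \<bullet> a) ^ k) / real (card X) = (\<integral>u. (u \<bullet> a) ^ k \<partial>sphere_measure)"
    using X p unfolding spherical_design_def by blast
  ultimately show ?thesis by (simp add: field_simps)
qed

lemma design_sum:
  assumes "spherical_design t X" "1 \<le> t" shows "(\<Sum>x\<in>X. x \<bullet> a) = 0"
proof -
  have "(\<integral>u. (u \<bullet> a) ^ 1 \<partial>sphere_measure) = 0" by (rule sphere_integral_odd) auto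
  then show ?thesis using design_moment[OF assms, of a] by simp
qed

lemma design_sum_squares:
  assumes "spherical_design t X" "2 \<le> t"
  shows "(\<Sum>x\<in>X. (x \<bullet> a)\<^sup>2) = real (card X) * (norm a)\<^sup>2 / 3"
  using design_moment[OF assms, of a] by (simp add: sphere_second_moment)

lemma design_sum_cubes:
  assumes "spherical_design t X" "3 \<le> t" shows "(\<Sum>x\<in>X. (x \<bullet> a) ^ 3) = 0"
proof -
  have "(\<integral>u. (u \<bullet> a) ^ 3 \<partial>sphere_measure) = 0" by (rule sphere_integral_odd) auto
  then show ?thesis using design_moment[OF assms, of a] by simp
qed

section \<open>Symmetry of the Minkowski polytope\<close>

lemma facet_normal_exists:
  assumes P: "polytope P" "aff_dim P = 3" and F: "F facet_of P"
  obtains u where "outer_unit_normal P F u"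
proof -
  have "F face_of P" "F \<noteq> {}" using F by (auto simp: facet_of_def)
  have "F exposed_face_of P"
    using \<open>F face_of P\<close> by (simp add: exposed_face_of_polyhedron[OF polytope_imp_polyhedron[OF P(1)]])
  then obtain a b where ab: "P \<subseteq> {x. a \<bullet> x \<le> b}" "F = P \<inter> {x. a \<bullet> x = b}"
    unfolding exposed_face_of_def by blast
  have "a \<noteq> 0"
  proof
    assume "a = 0"
    then have "F = P" using ab \<open>F \<noteq> {}\<close> by auto
    then show False using F by (simp add: facet_of_def)
  qed
  then have n: "norm a > 0" by simp
  have scale: "((1 / norm a) *\<^sub>R a) \<bullet> y \<le> b / norm a \<longleftrightarrow> a \<bullet> y \<le> b"
    "((1 / norm a) *\<^sub>R a) \<bullet> y = b / norm a \<longleftrightarrow> a \<bullet> y = b" for y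
    using n by (simp_all add: divide_le_cancel)
  have "outer_unit_normal P F ((1 / norm a) *\<^sub>R a)"
    unfolding outer_unit_normal_def
  proof (intro conjI exI[of _ "b / norm a"])
    show "P \<subseteq> {y. ((1 / norm a) *\<^sub>R a) \<bullet> y \<le> b / norm a}" unfolding scale by (rule ab(1))
    show "F = P \<inter> {y. ((1 / norm a) *\<^sub>R a) \<bullet> y = b / norm a}" unfolding scale by (rule ab(2))
  qed (use n in simp)
  then show thesis by (rule that)
qed

lemma interior_strictly_below_support:
  fixes P :: "'a::euclidean_space set"
  assumes z: "z \<in> interior P" and x: "x \<noteq> 0" and le: "\<And>y. y \<in> P \<Longrightarrow> x \<bullet> y \<le> b"
  shows "x \<bullet> z < b"
proof -
  obtain e where e: "e > 0" "cball z e \<subseteq> P" using z by (auto simp: mem_interior_cball)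
  have "z + (e / norm x) *\<^sub>R x \<in> cball z e" using e x by (simp add: dist_norm)
  then have "x \<bullet> (z + (e / norm x) *\<^sub>R x) \<le> b" using e le by blast
  moreover have "0 < (e / norm x) * (x \<bullet> x)" using e x by simp
  ultimately show ?thesis by (simp add: inner_add_right)
qed

context
  fixes X P :: "(real^3) set"
  assumes mink: "minkowski_polytope X P"
begin

lemma minkowski_basic:
  shows "polytope P" "compact P" "convex P" "interior P \<noteq> {}" "P \<noteq> {}" "0 < measure lborel P"
proof -
  show 1: "polytope P" using mink by (simp add: minkowski_polytope_def)
  show 2: "compact P" "convex P" using 1 by (simp_all add: polytope_imp_compact polytope_imp_convex)
  have dim: "aff_dim P = 3" using mink by (simp add: minkowski_polytope_def)
  then have "P \<noteq> {}" by auto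
  then have "rel_interior P \<noteq> {}" using 2(2) by (simp add: rel_interior_eq_empty)
  then show 3: "interior P \<noteq> {}" using dim by (simp add: interior_rel_interior_gen)
  then show "P \<noteq> {}" using interior_subset by blast
  have "\<not> negligible P" using 3 by (metis interior_subset negligible_subset open_interior open_not_negligible)
  then have "measure lebesgue P \<noteq> 0" using negligible_iff_measure0[OF lmeasurable_compact[OF 2(1)]] by blast
  then have "measure lborel P \<noteq> 0" using 2(1) by (simp add: borel_compact)
  then show "0 < measure lborel P" using measure_nonneg[of lborel P] by linarith
qed

lemma facet_data:
  assumes x: "x \<in> X"
  shows "norm x = 1" "\<And>y. y \<in> P \<Longrightarrow> x \<bullet> y \<le> support_function P x"
    "planar_area (P \<inter> {y. x \<bullet> y = support_function P x}) = 4 * pi / real (card X)"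
    "aff_dim (P \<inter> {y. x \<bullet> y = support_function P x}) = 2"
proof -
  note M = mink[unfolded minkowski_polytope_def]
  obtain F where F: "F facet_of P" "outer_unit_normal P F x" using M x by blast
  then obtain b where b: "norm x = 1" "P \<subseteq> {y. x \<bullet> y \<le> b}" "F = P \<inter> {y. x \<bullet> y = b}"
    unfolding outer_unit_normal_def by blast
  show "norm x = 1" by fact
  have "F \<noteq> {}" using F(1) by (simp add: facet_of_def)
  then obtain y where "y \<in> P" "x \<bullet> y = b" using b by blast
  then have sb: "support_function P x = b"
    unfolding support_function_def using b(2) by (intro cSup_eq_maximum) auto
  show "x \<bullet> y \<le> support_function P x" if "y \<in> P" for y using b(2) that sb by blast
  show "planar_area (P \<inter> {y. x \<bullet> y = support_function P x}) = 4 * pi / real (card X)"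
    unfolding sb b(3)[symmetric] using M F(1) by blast
  show "aff_dim (P \<inter> {y. x \<bullet> y = support_function P x}) = 2"
    unfolding sb b(3)[symmetric] using F(1) M by (simp add: facet_of_def)
qed

text \<open>A segment from an interior point to a point outside leaves the polytope through a facet,
  and the normal of this facet, which belongs to $X$, separates the outer point.\<close>
lemma minkowski_eq_wulff: "P = wulff X (support_function P)"
proof
  show "P \<subseteq> wulff X (support_function P)" using facet_data(2) by (auto simp: wulff_def)
  show "wulff X (support_function P) \<subseteq> P"
  proof (rule subsetI, rule ccontr)
    fix y assume y: "y \<in> wulff X (support_function P)" "y \<notin> P"
    note M = mink[unfolded minkowski_polytope_def]
    note B = minkowski_basic
    obtain z where z: "z \<in> interior P" using B(4) by blast
    then have zP: "z \<in> P" using interior_subset by blast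
    have "closed_segment z y \<inter> frontier P \<noteq> {}"
      by (rule connected_Int_frontier) (use zP y in auto)
    then obtain q where q: "q \<in> closed_segment z y" "q \<in> frontier P" by blast
    have "frontier P = rel_frontier P" by (rule rel_frontier_nonempty_interior[OF B(4), symmetric])
    also have "\<dots> = \<Union>{F. F facet_of P}" by (rule rel_frontier_of_polyhedron[OF polytope_imp_polyhedron[OF B(1)]])
    finally obtain F where F: "F facet_of P" "q \<in> F" using q(2) by blast
    obtain x where xF: "outer_unit_normal P F x" by (rule facet_normal_exists[OF B(1) _ F(1)]) (use M in auto)
    have x: "x \<in> X" using M F(1) xF by blast
    obtain b where b: "norm x = 1" "P \<subseteq> {y. x \<bullet> y \<le> b}" "F = P \<inter> {y. x \<bullet> y = b}"
      using xF unfolding outer_unit_normal_def by blast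
    have qb: "q \<in> P" "x \<bullet> q = b" using F(2) b(3) by auto
    have "support_function P x = b"
      unfolding support_function_def using b(2) qb by (intro cSup_eq_maximum) auto
    then have yb: "x \<bullet> y \<le> b" using y(1) x by (auto simp: wulff_def)
    have zb: "x \<bullet> z < b" by (rule interior_strictly_below_support[OF z]) (use b in auto)
    obtain l where l: "q = (1 - l) *\<^sub>R z + l *\<^sub>R y" "0 \<le> l" "l \<le> 1" using q(1) by (auto simp: in_segment)
    have "l \<noteq> 1" using l qb(1) y(2) by auto
    then have "(1 - l) * (x \<bullet> z) < (1 - l) * b" using l zb by (intro mult_strict_left_mono) auto
    moreover have "l * (x \<bullet> y) \<le> l * b" using l yb by (intro mult_left_mono) auto
    moreover have "x \<bullet> q = (1 - l) * (x \<bullet> z) + l * (x \<bullet> y)" by (simp add: l(1) inner_add_right)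
    ultimately have "x \<bullet> q < b" by (simp add: algebra_simps)
    then show False using qb by simp
  qed
qed

end

lemma slice_area_translate:
  assumes "compact S"
  shows "slice_area ((\<lambda>z. z + q) -` S) t = slice_area S (t + fst q)"
proof -
  let ?A = "Pair (t + fst q) -` S"
  have "Pair t -` ((\<lambda>z. z + q) -` S) = (\<lambda>x. - snd q + 1 *\<^sub>R x) ` ?A"
  proof (intro antisym subsetI)
    fix z assume "z \<in> Pair t -` ((\<lambda>z. z + q) -` S)"
    then have "z + snd q \<in> ?A" by (cases q) simp
    then show "z \<in> (\<lambda>x. - snd q + 1 *\<^sub>R x) ` ?A" by (rule rev_image_eqI) simp
  next
    fix z assume "z \<in> (\<lambda>x. - snd q + 1 *\<^sub>R x) ` ?A"
    then obtain x where "x \<in> ?A" "z = x - snd q" by auto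
    then show "z \<in> Pair t -` ((\<lambda>z. z + q) -` S)" by (cases q) simp
  qed
  then show ?thesis
    unfolding slice_area_def using measure_compact_affine_image[OF compact_slice[OF assms], of 1 "- snd q" "t + fst q"] by simp
qed

lemma support_function_translate:
  assumes "compact P" "P \<noteq> {}"
  shows "support_function ((+) p ` P) u = u \<bullet> p + support_function P u"
proof -
  obtain y where y: "y \<in> P" "u \<bullet> y = support_function P u" "\<And>z. z \<in> P \<Longrightarrow> u \<bullet> z \<le> support_function P u"
    using support_function_attained[OF assms, of u] by metis
  show ?thesis
    unfolding support_function_def[of "(+) p ` P"]
  proof (rule cSup_eq_maximum)
    show "u \<bullet> p + support_function P u \<in> (\<bullet>) u ` ((+) p ` P)"
      by (rule image_eqI[of _ _ "p + y"]) (use y(1,2) in \<open>auto simp: inner_add_right\<close>)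
  qed (use y in \<open>auto simp: inner_add_right\<close>)
qed

lemma support_function_orthogonal_image:
  assumes "orthogonal_transformation g"
  shows "support_function (g ` P) (g u) = support_function P u"
  using assms by (simp add: support_function_def image_image orthogonal_transformation_def)

text \<open>A symmetry $g$ of the normals turns $P$ into a polytope with the same normals and facet
  areas. Since $g$ permutes the support numbers, the midpoint body of $P$ and $g(P)$ is not larger
  than $P$, so equality holds in the Brunn-Minkowski inequality. As $g$ maps centroid to centroid,
  the point $c$ can be taken to be the centroid, the same one for all $g$.\<close>
lemma symmetric_up_to_translation:
  assumes mink: "minkowski_polytope X P" and finX: "finite X"
  obtains c where "\<And>g u. orthogonal_transformation g \<Longrightarrow> g ` X = X \<Longrightarrow> norm u = 1 \<Longrightarrow>
     support_function P (g u) - g u \<bullet> c = support_function P u - u \<bullet> c"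
proof -
  note B = minkowski_basic[OF mink] and FD = facet_data[OF mink]
  obtain p where p: "p \<in> interior P" using B(4) by blast
  \<comment> \<open>Minkowski's inequality requires the origin to be an interior point.\<close>
  define P1 where "P1 = (+) (- p) ` P"
  define h where "h u = support_function P u - u \<bullet> p" for u
  have suppP1: "support_function P1 u = h u" for u
    unfolding P1_def support_function_translate[OF B(2,5)] h_def by simp
  have P1: "compact P1" "convex P1" "P1 \<noteq> {}"
    unfolding P1_def by (rule compact_translation[OF B(2)], rule convex_translation[OF B(3)], use B(5) in simp)
  have P1_iff: "y \<in> P1 \<longleftrightarrow> y + p \<in> P" for y by (force simp: P1_def image_iff)
  have W: "wulff X h = P1"
  proof -
    have "y \<in> P1 \<longleftrightarrow> y \<in> wulff X h" for y
    proof -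
      have "y \<in> P1 \<longleftrightarrow> y + p \<in> wulff X (support_function P)"
        unfolding P1_iff using minkowski_eq_wulff[OF mink] by simp
      also have "\<dots> \<longleftrightarrow> y \<in> wulff X h" by (auto simp: wulff_def h_def inner_add_right algebra_simps)
      finally show ?thesis .
    qed
    then show ?thesis by blast
  qed
  have hpos: "0 < h x" if x: "x \<in> X" for x
  proof -
    have "x \<noteq> 0" using FD(1)[OF x] by auto
    from interior_strictly_below_support[OF p this FD(2)[OF x]] show ?thesis by (simp add: h_def)
  qed
  have "\<exists>\<phi>. adapted_frame x \<phi>" if "x \<in> X" for x
    by (rule adapted_frame_exists[OF FD(1)[OF that]]) blast
  then obtain \<Phi> where \<Phi>: "\<And>x. x \<in> X \<Longrightarrow> adapted_frame x (\<Phi> x)" by metis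
  define A where "A = 4 * pi / real (card X)"
  have face: "slice_area (\<Phi> x -` wulff X h) (h x) = A" if x: "x \<in> X" for x
  proof -
    note f = adapted_frameD[OF \<Phi>[OF x]]
    let ?b = "support_function P x"
    obtain q where q: "\<Phi> x q = p" using f(2) by (metis surjD)
    have "\<Phi> x -` P1 = (\<lambda>z. z + q) -` (\<Phi> x -` P)"
      by (simp only: set_eq_iff vimage_eq P1_iff linear_add[OF f(1)] q simp_thms)
    then have "slice_area (\<Phi> x -` P1) (h x) = slice_area (\<Phi> x -` P) (h x + fst q)"
      by (simp only: slice_area_translate[OF frame_vimage_compact[OF \<Phi>[OF x] B(2)]])
    also have "h x + fst q = ?b" using f(4)[of q] q by (simp add: h_def)
    also have "slice_area (\<Phi> x -` P) ?b = measure lborel (Pair ?b -` \<Phi> x -` (P \<inter> {y. x \<bullet> y = ?b}))"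
      by (simp add: slice_area_def vimage_def f(4))
    also have "\<dots> = planar_area (P \<inter> {y. x \<bullet> y = ?b})"
    proof (rule planar_area_eq_section[OF FD(1)[OF x] \<Phi>[OF x], symmetric])
      show "compact (P \<inter> {y. x \<bullet> y = ?b})" by (intro compact_Int_closed B closed_hyperplane)
    qed (use FD(4)[OF x] in auto)
    finally show ?thesis unfolding W using FD(3)[OF x] by (simp add: A_def)
  qed
  have V1: "0 < measure lborel P1"
    using measure_compact_affine_image[OF B(2), of 1 "- p"] B(6) by (simp add: P1_def)
  have A0: "0 \<le> A" by (simp add: A_def)
  have key: "measure lborel P1 * (h u - h (g u)) = g u \<bullet> (g (moment P1) - moment P1)"
    if g: "orthogonal_transformation g" "g ` X = X" and u: "norm u = 1" for g u
  proof -
    let ?Q = "g ` P1"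
    define m where "m x = support_function ?Q x" for x
    note Q = orthogonal_image_measure[OF g(1) P1(1)]
    have m_g: "m (g x) = h x" for x unfolding m_def by (simp only: support_function_orthogonal_image[OF g(1)] suppP1)
    have m0: "0 \<le> m x" if "x \<in> X" for x
      using that g(2) hpos m_g by (metis imageE less_imp_le)
    have "inj_on g X" using orthogonal_transformation_inj[OF g(1)] by (rule inj_on_subset) simp
    then have "(\<Sum>x\<in>X. m x) = (\<Sum>x\<in>X. m (g x))" using g(2) by (metis sum.reindex_cong)
    then have summ: "(\<Sum>x\<in>X. m x) = (\<Sum>x\<in>X. h x)" by (simp only: m_g)
    let ?m = "\<lambda>x. (h x + m x) / 2"
    have sub: "midset P1 ?Q \<subseteq> wulff X ?m"
    proof
      fix z assume "z \<in> midset P1 ?Q"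
      then obtain a b where ab: "a \<in> P1" "b \<in> ?Q" "z = (1/2) *\<^sub>R (a + b)" by (auto simp: midset_iff)
      have "x \<bullet> a \<le> h x \<and> x \<bullet> b \<le> m x" for x
      proof
        have "\<And>z. z \<in> P1 \<Longrightarrow> x \<bullet> z \<le> support_function P1 x"
          using support_function_attained[OF P1(1,3), of x] by metis
        then show "x \<bullet> a \<le> h x" using ab(1) suppP1 by simp
        have "?Q \<noteq> {}" using P1(3) by simp
        then have "\<And>z. z \<in> ?Q \<Longrightarrow> x \<bullet> z \<le> support_function ?Q x"
          using support_function_attained[OF Q(2), of x] by metis
        then show "x \<bullet> b \<le> m x" using ab(2) by (simp add: m_def)
      qed
      then show "z \<in> wulff X ?m" by (simp add: wulff_def ab(3) inner_add_right add_mono divide_right_mono)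
    qed
    have le: "measure lborel (midset P1 ?Q) \<le> measure lborel P1"
    proof (rule volume_le_of_support_le[where X = X and h = h and \<Phi> = \<Phi> and A = "\<lambda>_. A" and m = ?m, unfolded W])
      show "(\<Sum>x\<in>X. A * ?m x) \<le> (\<Sum>x\<in>X. A * h x)"
        using summ by (simp add: sum_distrib_left[symmetric] sum_divide_distrib[symmetric] sum.distrib)
      show "slice_area (\<Phi> x -` P1) (h x) = A" if "x \<in> X" for x using face[OF that] by (simp only: W)
      show "0 \<le> ?m x" if "x \<in> X" for x using hpos[OF that] m0[OF that] by simp
      show "compact (midset P1 ?Q)" by (rule compact_midset[OF P1(1) Q(2)])
    qed (fact finX FD(1) \<Phi> hpos P1(1) sub V1)+
    have "norm (g u) = 1" using g(1) u by (simp add: orthogonal_transformation_norm)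
    from brunn_minkowski_equality[OF P1(1,2) Q(2) _ V1 Q(1) le this]
    have "measure lborel P1 * (m (g u) - h (g u)) = g u \<bullet> (moment ?Q - moment P1)"
      using convex_linear_image[OF orthogonal_transformation_linear[OF g(1)] P1(2)]
      by (simp add: m_def suppP1)
    then show ?thesis by (simp add: m_g inner_diff_right Q(3))
  qed
  define c where "c = (1 / measure lborel P1) *\<^sub>R moment P1"
  have "support_function P (g u) - g u \<bullet> (c + p) = support_function P u - u \<bullet> (c + p)"
    if g: "orthogonal_transformation g" "g ` X = X" and u: "norm u = 1" for g u
  proof -
    have gi: "g x \<bullet> g y = x \<bullet> y" for x y using g(1) by (simp add: orthogonal_transformation_def)
    have "measure lborel P1 * (h u - h (g u)) = u \<bullet> moment P1 - g u \<bullet> moment P1"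
      using key[OF g u] by (simp add: inner_diff_right gi)
    then have "h u - h (g u) = u \<bullet> c - g u \<bullet> c"
      using V1 by (simp add: c_def field_simps)
    then show ?thesis by (simp add: h_def inner_add_right)
  qed
  then show thesis by (rule that)
qed

lemma support_function_lipschitz:
  assumes P: "compact P" "P \<noteq> {}" and B: "\<And>y. y \<in> P \<Longrightarrow> norm y \<le> B"
  shows "\<bar>support_function P u - support_function P v\<bar> \<le> B * norm (u - v)"
proof -
  have le: "support_function P u - support_function P v \<le> B * norm (u - v)" for u v
  proof -
    obtain y where y: "y \<in> P" "u \<bullet> y = support_function P u"
      using support_function_attained[OF P, of u] by metis
    have "v \<bullet> y \<le> support_function P v"
      using support_function_attained[OF P, of v] y(1) by metis
    moreover have "(u - v) \<bullet> y \<le> B * norm (u - v)"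
    proof -
      have "(u - v) \<bullet> y \<le> norm (u - v) * norm y" by (rule norm_cauchy_schwarz)
      also have "\<dots> \<le> norm (u - v) * B" using B[OF y(1)] by (intro mult_left_mono) auto
      finally show ?thesis by (simp add: mult.commute)
    qed
    ultimately show ?thesis using y(2) by (simp add: inner_diff_left)
  qed
  show ?thesis using le[of u v] le[of v u] by (simp add: abs_le_iff norm_minus_commute)
qed

lemma support_function_measurable:
  assumes P: "compact P" "P \<noteq> {}"
  shows "support_function P \<in> borel_measurable borel"
proof -
  obtain B where B: "\<And>y. y \<in> P \<Longrightarrow> norm y \<le> B" using compact_imp_bounded[OF P(1)] unfolding bounded_iff by blast
  have B0: "0 \<le> B" using B P(2) norm_ge_zero by (metis ex_in_conv order_trans)
  have "B-lipschitz_on UNIV (support_function P)"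
    by (rule lipschitz_onI) (use support_function_lipschitz[OF P B] B0 in \<open>auto simp: dist_real_def dist_norm\<close>)
  then show ?thesis by (intro borel_measurable_continuous_onI lipschitz_on_continuous_on)
qed

lemma support_function_bounded:
  assumes P: "compact P" "P \<noteq> {}"
  obtains C where "\<And>u. norm u = 1 \<Longrightarrow> \<bar>support_function P u\<bar> \<le> C"
proof -
  obtain B where B: "\<And>y. y \<in> P \<Longrightarrow> norm y \<le> B" using compact_imp_bounded[OF P(1)] unfolding bounded_iff by blast
  have "\<bar>support_function P u\<bar> \<le> B + \<bar>support_function P 0\<bar>" if "norm u = 1" for u
    using support_function_lipschitz[OF P B, of u 0] that by simp
  then show thesis by (rule that)
qed

lemma sphere_moment_inner: "(\<integral>u. (u \<bullet> c) * (u \<bullet> a) \<partial>sphere_measure) = c \<bullet> a / 3"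
proof -
  have int: "integrable sphere_measure (\<lambda>u::real^3. (u \<bullet> b)\<^sup>2)" for b
    unfolding power2_eq_square by (rule sphere_integrable_inner_mult)
  have "(\<lambda>u. (u \<bullet> c) * (u \<bullet> a)) = (\<lambda>u::real^3. ((u \<bullet> (c + a))\<^sup>2 - (u \<bullet> (c - a))\<^sup>2) / 4)"
    by (auto simp: inner_add_right inner_diff_right power2_eq_square algebra_simps)
  then have "(\<integral>u. (u \<bullet> c) * (u \<bullet> a) \<partial>sphere_measure) = ((norm (c + a))\<^sup>2 / 3 - (norm (c - a))\<^sup>2 / 3) / 4"
    by (simp add: int sphere_second_moment)
  also have "\<dots> = ((norm (c + a))\<^sup>2 - (norm (c - a))\<^sup>2) / 12" by simp
  also have "(norm (c + a))\<^sup>2 - (norm (c - a))\<^sup>2 = 4 * (c \<bullet> a)"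
    by (simp add: power2_norm_eq_inner inner_add inner_diff inner_commute)
  also have "4 * (c \<bullet> a) / 12 = c \<bullet> a / 3" by simp
  finally show ?thesis .
qed

text \<open>With $c$ the centre of symmetry of $P$, the Steiner point of $P - c$ is $-c$, because
  that of $P$ is $0$, and it is fixed by the symmetries. So the inner products of $c$ with the
  design points are all equal. The first moment of the design makes them $0$, and then the second
  moment gives $c = 0$.\<close>
lemma steiner_symmetric:
  assumes X: "spherical_design t X" "2 \<le> t" and tr: "node_transitive X" and S: "steiner_minkowski_polytope X P"
    and g: "orthogonal_transformation g" "g ` X = X" and u: "norm u = 1"
  shows "support_function P (g u) = support_function P u"
proof -
  have mink: "minkowski_polytope X P" and st: "steiner_point P = 0"
    using S by (auto simp: steiner_minkowski_polytope_def)
  note B = minkowski_basic[OF mink]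
  have finX: "finite X" "X \<noteq> {}" using X(1) by (auto simp: spherical_design_def)
  let ?h = "support_function P"
  obtain c where c: "\<And>g u. orthogonal_transformation g \<Longrightarrow> g ` X = X \<Longrightarrow> norm u = 1 \<Longrightarrow> ?h (g u) - g u \<bullet> c = ?h u - u \<bullet> c"
    using symmetric_up_to_translation[OF mink finX(1)] by metis
  note meas[measurable] = support_function_measurable[OF B(2,5)]
  obtain C where C: "\<And>u. norm u = 1 \<Longrightarrow> \<bar>?h u\<bar> \<le> C" using support_function_bounded[OF B(2,5)] by metis
  have "integrable sphere_measure (\<lambda>u. ?h u *\<^sub>R u)"
    by (rule sphere_integrable[where B = C]) (use C in auto)
  then have "(\<integral>u. (?h u *\<^sub>R u) \<bullet> a \<partial>sphere_measure) = (\<integral>u. ?h u *\<^sub>R u \<partial>sphere_measure) \<bullet> a" for a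
    by (intro integral_inner_left) simp
  then have hs: "(\<integral>u. ?h u * (u \<bullet> a) \<partial>sphere_measure) = 0" for a
    using st by (simp add: steiner_point_def)
  have int1: "integrable sphere_measure (\<lambda>u. ?h u * (u \<bullet> a))" for a
  proof (rule sphere_integrable[where B = "C * norm a"])
    fix u :: "real^3" assume u: "norm u = 1"
    then have "\<bar>u \<bullet> a\<bar> \<le> norm a" using Cauchy_Schwarz_ineq2[of u a] by simp
    then show "norm (?h u * (u \<bullet> a)) \<le> C * norm a"
      using C[OF u] by (auto simp: abs_mult intro!: mult_mono)
  qed measurable
  \<comment> \<open>The support function of the polytope moved to its centre of symmetry.\<close>
  define H where "H u = ?h u - u \<bullet> c" for u
  have Hm[measurable]: "H \<in> borel_measurable borel" unfolding H_def by measurable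
  have Hint: "(\<integral>u. H u * (u \<bullet> a) \<partial>sphere_measure) = - (c \<bullet> a / 3)" for a
  proof -
    have "(\<lambda>u. H u * (u \<bullet> a)) = (\<lambda>u. ?h u * (u \<bullet> a) - (u \<bullet> c) * (u \<bullet> a))"
      by (auto simp: H_def left_diff_distrib)
    then show ?thesis using hs[of a] by (simp add: int1 sphere_integrable_inner_mult sphere_moment_inner)
  qed
  have inv: "c \<bullet> g a = c \<bullet> a" if g: "orthogonal_transformation g" "g ` X = X" for g a
  proof -
    have "(\<integral>u. H u * (u \<bullet> g a) \<partial>sphere_measure) = (\<integral>u. H (g u) * (g u \<bullet> g a) \<partial>sphere_measure)"
      by (rule sphere_integral_rotation[OF g(1), symmetric]) measurable
    also have "\<dots> = (\<integral>u. H u * (u \<bullet> a) \<partial>sphere_measure)"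
    proof (rule integral_cong_AE)
      note m[measurable] = borel_measurable_linear[OF orthogonal_transformation_linear[OF g(1)]]
      show "AE u in sphere_measure. H (g u) * (g u \<bullet> g a) = H u * (u \<bullet> a)"
        using AE_sphere_norm
      proof eventually_elim
        case (elim u)
        have "g u \<bullet> g a = u \<bullet> a" using g(1) by (simp add: orthogonal_transformation_def)
        then show ?case using c[OF g elim] by (simp add: H_def)
      qed
      have "(\<lambda>u. H (g u) * (g u \<bullet> g a)) \<in> borel_measurable borel" by measurable
      then show "(\<lambda>u. H (g u) * (g u \<bullet> g a)) \<in> borel_measurable sphere_measure" by (simp add: sphere_measure_def)
      have "(\<lambda>u. H u * (u \<bullet> a)) \<in> borel_measurable borel" by measurable
      then show "(\<lambda>u. H u * (u \<bullet> a)) \<in> borel_measurable sphere_measure" by (simp add: sphere_measure_def)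
    qed
    finally show ?thesis by (simp add: Hint)
  qed
  obtain G where G: "subgroup G O3" "\<forall>g\<in>G. g ` X = X" "\<forall>x\<in>X. \<forall>y\<in>X. \<exists>g\<in>G. g x = y"
    using tr unfolding node_transitive_def by blast
  have GO: "orthogonal_transformation g" if "g \<in> G" for g
    using subgroup.subset[OF G(1)] that by (auto simp: O3_def)
  obtain x0 where x0: "x0 \<in> X" using finX by blast
  have const: "c \<bullet> x = c \<bullet> x0" if "x \<in> X" for x
    using G(2,3) x0 that inv GO by metis
  have "(\<Sum>x\<in>X. x \<bullet> c) = (\<Sum>x\<in>X. c \<bullet> x0)" using const by (intro sum.cong) (simp_all add: inner_commute)
  then have "real (card X) * (c \<bullet> x0) = 0" using design_sum[OF X(1), of c] X(2) by simp
  then have "c \<bullet> x0 = 0" using finX by simp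
  then have "(\<Sum>x\<in>X. (x \<bullet> c)\<^sup>2) = 0" using const by (simp add: inner_commute)
  then have "real (card X) * (norm c)\<^sup>2 / 3 = 0" using design_sum_squares[OF X, of c] by simp
  then have "c = 0" using finX by simp
  then show ?thesis using c[OF g u] by simp
qed

section \<open>Self-polarity and the regular tetrahedron\<close>

text \<open>A hyperplane separating $z$ from the hull does not pass through the origin and leaves
  the origin on the side of the hull, because the normals sum to $0$. Its polar point then lies in
  the body and shows that $z$ is not in the polar.\<close>
lemma polar_wulff_const:
  assumes X: "finite X" and s0: "(\<Sum>x\<in>X. x) = 0" "X \<noteq> {}" and h: "h > 0"
  shows "polar (wulff X (\<lambda>_. h)) = convex hull ((\<lambda>x. (1 / h) *\<^sub>R x) ` X)"
proof
  let ?Y = "(\<lambda>x. (1 / h) *\<^sub>R x) ` X"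
  let ?W = "wulff X (\<lambda>_. h)"
  show "convex hull ?Y \<subseteq> polar ?W"
  proof (rule hull_minimal)
    show "?Y \<subseteq> polar ?W" using h by (auto simp: polar_def wulff_def)
    have "polar ?W = (\<Inter>y\<in>?W. {z. y \<bullet> z \<le> 1})" by (auto simp: polar_def inner_commute)
    then show "convex (polar ?W)" by (simp add: convex_INT convex_halfspace_le)
  qed
  show "polar ?W \<subseteq> convex hull ?Y"
  proof (rule subsetI, rule ccontr)
    fix z assume z: "z \<in> polar ?W" "z \<notin> convex hull ?Y"
    have "compact (convex hull ?Y)" using X by (intro finite_imp_compact_convex_hull) simp
    then obtain a b where ab: "a \<bullet> z < b" "\<forall>y\<in>convex hull ?Y. a \<bullet> y > b"
      using separating_hyperplane_closed_point[OF convex_convex_hull _ z(2)] compact_imp_closed by blast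
    have up: "a \<bullet> x > b * h" if "x \<in> X" for x
    proof -
      have "(1 / h) *\<^sub>R x \<in> convex hull ?Y" using that by (intro hull_inc) auto
      then have "a \<bullet> x / h > b" using ab(2) by auto
      then show ?thesis using h by (simp add: field_simps)
    qed
    have b0: "b < 0"
    proof (rule ccontr)
      assume "\<not> b < 0"
      then have "0 < a \<bullet> x" if "x \<in> X" for x using up[OF that] h by (meson le_less_trans mult_nonneg_nonneg not_less less_imp_le)
      then have "0 < (\<Sum>x\<in>X. a \<bullet> x)" using X s0(2) by (intro sum_pos) auto
      moreover have "(\<Sum>x\<in>X. a \<bullet> x) = 0" using s0(1) by (simp add: inner_sum_right[symmetric])
      ultimately show False by simp
    qed
    define y where "y = (1 / b) *\<^sub>R a"
    have "y \<in> ?W"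
      unfolding wulff_def y_def using up b0 by (auto simp: inner_commute divide_le_eq less_imp_le mult.commute)
    then have "z \<bullet> y \<le> 1" using z(1) by (simp add: polar_def)
    moreover have "z \<bullet> y > 1" using ab(1) b0 by (simp add: y_def inner_commute less_divide_eq)
    ultimately show False by simp
  qed
qed

lemma sphere_point_of_hull:
  fixes V :: "'a::real_inner set"
  assumes V: "\<And>v. v \<in> V \<Longrightarrow> norm v = R" and z: "z \<in> convex hull V" "norm z = R"
  shows "z \<in> V"
proof (rule ccontr)
  assume nz: "z \<notin> V"
  have "V \<subseteq> {y. z \<bullet> y < R\<^sup>2}"
  proof
    fix v assume v: "v \<in> V"
    have "0 < (norm (z - v))\<^sup>2" using v nz by auto
    also have "(norm (z - v))\<^sup>2 = (norm z)\<^sup>2 + (norm v)\<^sup>2 - 2 * (z \<bullet> v)"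
      by (simp add: power2_norm_eq_inner inner_diff inner_commute)
    finally show "v \<in> {y. z \<bullet> y < R\<^sup>2}" using z(2) V[OF v] by simp
  qed
  then have "convex hull V \<subseteq> {y. z \<bullet> y < R\<^sup>2}" by (intro hull_minimal convex_halfspace_lt)
  then have "z \<bullet> z < R\<^sup>2" using z(1) by blast
  then show False using z(2) by (simp add: power2_norm_eq_inner[symmetric])
qed

text \<open>Without $y = x$ the inner products $y \cdot x$ sum to $-1$ and their squares to $1/3$.
  For these three numbers the Cauchy-Schwarz inequality is an equality, so they coincide.\<close>
lemma four_point_design_gram:
  assumes X: "spherical_design t X" "2 \<le> t" "card X = 4" and xy: "x \<in> X" "y \<in> X" "x \<noteq> y"
  shows "y \<bullet> x = - 1 / 3"
proof -
  have fin: "finite X" and unit: "norm x = 1" using X(1) xy by (auto simp: spherical_design_def)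
  have xx: "x \<bullet> x = 1" using unit by (simp add: power2_norm_eq_inner[symmetric])
  have s1: "(\<Sum>z\<in>X - {x}. z \<bullet> x) = - 1"
    using design_sum[OF X(1), of x] X(2) fin xy(1) xx by (simp add: sum.remove[of X x])
  have s2: "(\<Sum>z\<in>X - {x}. (z \<bullet> x)\<^sup>2) = 1 / 3"
    using design_sum_squares[OF X(1,2), of x] fin xy(1) xx X(3) unit by (simp add: sum.remove[of X x])
  have card: "card (X - {x}) = 3" using fin xy(1) X(3) by simp
  have "(\<Sum>z\<in>X - {x}. (z \<bullet> x + 1 / 3)\<^sup>2)
      = (\<Sum>z\<in>X - {x}. (z \<bullet> x)\<^sup>2) + 2 / 3 * (\<Sum>z\<in>X - {x}. z \<bullet> x) + real (card (X - {x})) * (1 / 9)"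
    by (simp add: power2_eq_square algebra_simps sum.distrib sum_distrib_left sum_divide_distrib)
  also have "\<dots> = 0" using s1 s2 card by simp
  finally have "\<forall>z\<in>X - {x}. (z \<bullet> x + 1 / 3)\<^sup>2 = 0"
    using sum_nonneg_eq_0_iff[of "X - {x}" "\<lambda>z. (z \<bullet> x + 1 / 3)\<^sup>2"] fin by simp
  then show ?thesis using xy by (simp add: eq_neg_iff_add_eq_0)
qed

theorem theorem8p5:
  fixes X P :: "(real^3) set" and t :: nat
  assumes "t \<ge> 2"
    and "spherical_design t X"
    and "node_transitive X"
    and "steiner_minkowski_polytope X P"
  shows "(self_polar_up_to_scale P \<longrightarrow>
            3 simplex P \<and>
            X \<subseteq> sphere 0 1 \<and> regular_tetrahedron_vertices X \<and> spherical_design 2 X) \<and>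
         (t \<ge> 3 \<longrightarrow> \<not> self_polar_up_to_scale P)"
proof -
  note X = assms(2) and t = assms(1) and tr = assms(3) and S = assms(4)
  have mink: "minkowski_polytope X P" using S by (simp add: steiner_minkowski_polytope_def)
  note B = minkowski_basic[OF mink]
  have finX: "finite X" "X \<noteq> {}" and unitX: "\<And>x. x \<in> X \<Longrightarrow> norm x = 1"
    using X by (auto simp: spherical_design_def)
  obtain G where G: "subgroup G O3" "\<forall>g\<in>G. g ` X = X" "\<forall>x\<in>X. \<forall>y\<in>X. \<exists>g\<in>G. g x = y"
    using tr unfolding node_transitive_def by blast
  have GO: "orthogonal_transformation g" if "g \<in> G" for g
    using subgroup.subset[OF G(1)] that by (auto simp: O3_def)
  obtain x0 where x0: "x0 \<in> X" using finX by blast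
  define h where "h = support_function P x0"
  have hc: "support_function P x = h" if "x \<in> X" for x
  proof -
    from G(3)[rule_format, OF x0 that] obtain g where g: "g \<in> G" "g x0 = x" ..
    from steiner_symmetric[OF X t tr S GO[OF g(1)] G(2)[rule_format, OF g(1)] unitX[OF x0]]
    show ?thesis unfolding g(2) h_def .
  qed
  have PW: "P = wulff X (\<lambda>_. h)"
    using minkowski_eq_wulff[OF mink] hc by (simp add: wulff_def)
  have sumX: "(\<Sum>x\<in>X. x) = 0"
  proof -
    have "(\<Sum>x\<in>X. x) \<bullet> a = 0" for a using design_sum[OF X, of a] t by (simp add: inner_sum_left)
    from this[of "\<Sum>x\<in>X. x"] show ?thesis by (simp only: inner_eq_zero_iff)
  qed
  have h: "h > 0"
  proof -
    obtain p where p: "p \<in> interior P" using B(4) by blast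
    have "0 < h - x \<bullet> p" if x: "x \<in> X" for x
    proof -
      have "x \<noteq> 0" using unitX[OF x] by auto
      from interior_strictly_below_support[OF p this facet_data(2)[OF mink x]] show ?thesis using hc[OF x] by simp
    qed
    then have "0 < (\<Sum>x\<in>X. h - x \<bullet> p)" using finX by (intro sum_pos) auto
    also have "\<dots> = real (card X) * h" using design_sum[OF X, of p] t by (simp add: sum_subtractf)
    finally show ?thesis using finX by (simp add: zero_less_mult_iff)
  qed
  have main: "3 simplex P \<and> card X = 4 \<and> \<not> affine_dependent X" if sp: "self_polar_up_to_scale P"
  proof -
    obtain c U where cU: "c > 0" "orthogonal_transformation U" "polar P = (\<lambda>y. c *\<^sub>R U y) ` P"
      using sp unfolding self_polar_up_to_scale_def by blast
    \<comment> \<open>Self-polarity presents P as the hull V of a rotated and rescaled copy of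
      X.\<close>
    define W where "W = inv_into UNIV U"
    have W: "orthogonal_transformation W" unfolding W_def by (rule orthogonal_transformation_inv[OF cU(2)])
    have WU: "W (U y) = y" for y unfolding W_def by (simp add: orthogonal_transformation_inj[OF cU(2)])
    define f where "f z = (1 / c) *\<^sub>R W z" for z
    have linf: "linear f" unfolding f_def
      using orthogonal_transformation_linear[OF W] by (rule linear_compose_scale_right)
    have fP: "P = f ` polar P"
    proof -
      have "f (c *\<^sub>R U y) = y" for y
        unfolding f_def using cU(1) by (simp add: linear_scale[OF orthogonal_transformation_linear[OF W]] WU)
      then show ?thesis unfolding cU(3) image_image by simp
    qed
    define k where "k x = f ((1 / h) *\<^sub>R x)" for x
    have lin: "linear k" unfolding k_def using linf by (intro linear_compose[of "\<lambda>x. (1 / h) *\<^sub>R x" f, unfolded comp_def]) (auto intro: linear_scaleR)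
    have normk: "norm (k x) = norm x / (c * h)" for x
      unfolding k_def f_def using cU(1) h W by (simp add: orthogonal_transformation_norm)
    have injk: "inj k"
    proof (rule linear_injective_0[OF lin, THEN iffD2], intro allI impI)
      fix x assume "k x = 0"
      then have "norm x / (c * h) = 0" using normk[of x] by simp
      then show "x = 0" using cU(1) h by simp
    qed
    define V where "V = k ` X"
    have hullV: "P = convex hull V"
    proof -
      have "P = f ` (convex hull ((\<lambda>x. (1 / h) *\<^sub>R x) ` X))"
        using fP polar_wulff_const[OF finX(1) sumX finX(2) h] PW by simp
      also have "\<dots> = convex hull V"
        unfolding V_def k_def by (simp add: convex_hull_linear_image[OF linf] image_image)
      finally show ?thesis .
    qed
    define R where "R = 1 / (c * h)"
    have VR: "norm v = R" if "v \<in> V" for v using that unitX normk by (auto simp: V_def R_def)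
    have cardV: "card V = card X" unfolding V_def by (rule card_image[OF inj_on_subset[OF injk]]) simp
    have finV: "finite V" using finX by (simp add: V_def)
    interpret bicentric X V h R
    proof
      show "{y. \<forall>x\<in>X. x \<bullet> y \<le> h} = convex hull V" using PW hullV by (simp add: wulff_def)
    qed (use finX finV h unitX VR in auto)
    \<comment> \<open>This description of V shows that the symmetries of P permute V, so that all
      facets carry equally many vertices.\<close>
    have Vsph: "V = P \<inter> sphere 0 R"
      using sphere_point_of_hull[OF VR] VR hull_subset[of V convex] unfolding hullV by auto
    have gV: "g ` V = V" if g: "g \<in> G" for g
    proof -
      have gX: "g ` X = X" by (rule G(2)[rule_format, OF g])
      have gi: "g x \<bullet> g y = x \<bullet> y" for x y using GO[OF g] by (simp add: orthogonal_transformation_def)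
      have memP: "g y \<in> P \<longleftrightarrow> y \<in> P" for y
      proof -
        have "g y \<in> P \<longleftrightarrow> (\<forall>x\<in>g ` X. x \<bullet> g y \<le> h)" unfolding gX PW wulff_def by simp
        also have "\<dots> \<longleftrightarrow> y \<in> P" unfolding PW wulff_def by (simp add: gi)
        finally show ?thesis .
      qed
      have memV: "g y \<in> V \<longleftrightarrow> y \<in> V" for y
        unfolding Vsph using memP[of y] orthogonal_transformation_norm[OF GO[OF g], of y] by simp
      show ?thesis
      proof
        show "g ` V \<subseteq> V" using memV by blast
        show "V \<subseteq> g ` V"
        proof
          fix v assume v: "v \<in> V"
          obtain y where "g y = v" using orthogonal_transformation_surj[OF GO[OF g]] by (metis surjD)
          then show "v \<in> g ` V" using memV v by blast
        qed
      qed
    qed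
    have same: "card {v\<in>V. x \<bullet> v = h} = card {v\<in>V. x0 \<bullet> v = h}" if x: "x \<in> X" for x
    proof -
      from G(3)[rule_format, OF x0 x] obtain g where g: "g \<in> G" "g x0 = x" ..
      have gi: "g a \<bullet> g b = a \<bullet> b" for a b using GO[OF g(1)] by (simp add: orthogonal_transformation_def)
      have "{v\<in>V. x \<bullet> v = h} = g ` {v\<in>V. x0 \<bullet> v = h}"
      proof (intro antisym subsetI)
        fix v assume v: "v \<in> {v\<in>V. x \<bullet> v = h}"
        then obtain y where y: "y \<in> V" "v = g y" using gV[OF g(1)] by blast
        then have "x0 \<bullet> y = h" using v gi[of x0 y] g(2) by simp
        then show "v \<in> g ` {v\<in>V. x0 \<bullet> v = h}" using y by blast
      next
        fix v assume "v \<in> g ` {v\<in>V. x0 \<bullet> v = h}"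
        then obtain y where y: "y \<in> V" "x0 \<bullet> y = h" "v = g y" by blast
        then show "v \<in> {v\<in>V. x \<bullet> v = h}" using gi[of x0 y] g(2) gV[OF g(1)] by auto
      qed
      moreover have "inj_on g {v\<in>V. x0 \<bullet> v = h}"
        by (rule inj_on_subset[OF orthogonal_transformation_inj[OF GO[OF g(1)]]]) simp
      ultimately show ?thesis by (simp add: card_image)
    qed
    have dimV: "aff_dim V = 3" using mink hullV by (simp add: minkowski_polytope_def aff_dim_convex_hull)
    have "4 \<le> card V" using aff_dim_le_card[OF finV] dimV by simp
    then have four: "card V = 4" using four_vertices[of "card {v\<in>V. x0 \<bullet> v = h}"] same cardV by simp
    have indV: "\<not> affine_dependent V" using dimV four finV by (simp add: affine_independent_iff_card)
    have "aff_dim X = 3" using dimV aff_dim_injective_linear_image[OF lin injk, of X] by (simp add: V_def)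
    then have "\<not> affine_dependent X" using four cardV finX by (simp add: affine_independent_iff_card)
    moreover have "3 simplex P" unfolding simplex_def using indV four hullV by (intro exI[of _ V]) simp
    ultimately show ?thesis using four cardV by simp
  qed
  have concl: "3 simplex P \<and> X \<subseteq> sphere 0 1 \<and> regular_tetrahedron_vertices X \<and> spherical_design 2 X"
    if sp: "self_polar_up_to_scale P"
  proof -
    have "dist x y = sqrt (8 / 3)" if xy: "x \<in> X" "y \<in> X" "x \<noteq> y" for x y
    proof -
      have "(dist x y)\<^sup>2 = (norm x)\<^sup>2 + (norm y)\<^sup>2 - 2 * (y \<bullet> x)"
        by (simp add: dist_norm power2_norm_eq_inner inner_diff inner_commute)
      also have "\<dots> = 8 / 3" using four_point_design_gram[OF X t _ xy] main[OF sp] unitX xy by simp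
      finally show ?thesis by (metis real_sqrt_unique zero_le_dist)
    qed
    then have "regular_tetrahedron_vertices X"
      unfolding regular_tetrahedron_vertices_def using main[OF sp] by blast
    moreover have "X \<subseteq> sphere 0 1" using X by (simp add: spherical_design_def)
    ultimately show ?thesis using main[OF sp] spherical_design_mono[OF X t] by blast
  qed
  moreover have "\<not> self_polar_up_to_scale P" if t3: "t \<ge> 3"
  proof
    assume sp: "self_polar_up_to_scale P"
    have xx: "x0 \<bullet> x0 = 1" using unitX[OF x0] by (simp add: power2_norm_eq_inner[symmetric])
    \<comment> \<open>The cubic moment in the direction of a vertex is 1 - 3/27, whereas a 3-design
      has vanishing cubic moments.\<close>
    have "(\<Sum>y\<in>X - {x0}. (y \<bullet> x0) ^ 3) = (\<Sum>y\<in>X - {x0}. (- 1 / 3) ^ 3)"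
      using four_point_design_gram[OF X t _ x0] main[OF sp] by (intro sum.cong) auto
    also have "\<dots> = - 1 / 9" using main[OF sp] x0 finX by (simp add: power3_eq_cube)
    finally have "(\<Sum>y\<in>X. (y \<bullet> x0) ^ 3) = 8 / 9"
      using finX x0 xx by (simp add: sum.remove[of X x0])
    then show False using design_sum_cubes[OF X t3, of x0] by simp
  qed
  ultimately show ?thesis by blast
qed

end
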